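(* Let $\beta_2\ge\beta_1>0$ and let $V\in L^\infty_{\mathrm{loc}}(\mathbb{R})$ be a nonnegative real-valued potential for which there exist constants $c_1,c_2,c_3,c_4>0$ such that $$c_1(|x|-c_3)_+^{\beta_1}\le V(x)\le c_2\langle x\rangle^{\beta_2},\qquad \forall x\in\mathbb{R},$$ and such that $V$ can be written as $V=V_1+V_2$ with $$|V_1(x)|+|DV_1(x)|+|V_2(x)|^{4/3}\le c_4\langle x\rangle^{\beta_2}.$$ Let $\Omega\subset\mathbb{R}$ be a measurable set for which there exist $L>0$, $\gamma\in(0,1)$ and $\tau\ge0$ with $$|\Omega\cap[Ln,L(n+1)]|\ge\gamma^{\langle n\rangle^\tau}L,\qquad\forall n\in\mathbb{Z}.$$ Then there exists a constant $C=C(V,\Omega)>0$, depending only on $V$ and $\Omega$, such that for any $\lambda>0$ and any $\phi\in\mathcal{E}_\lambda(\sqrt H)$, $$\|\phi\|_{L^2(\mathbb{R})}\le Ce^{C\lambda^\zeta\log(\lambda+1)}\|\phi\|_{L^2(\Omega)},\qquad \zeta=\frac{4\tau}{\beta_1}+\frac{\beta_2}{\beta_1}.$$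
   Context: Notation: $(a)_+:=\max\{0,a\}$, $\langle x\rangle:=(1+|x|^2)^{1/2}$, $|E|$ is the Lebesgue measure of $E\subset\mathbb{R}$, and $DV_1$ is the (weak) derivative of $V_1$. $H=-\partial_x^2+V(x)$ is the Schrödinger operator, i.e. the unique self-adjoint operator on $L^2(\mathbb{R})$ extending $-\partial_x^2+V$ from the Schwartz space. Since $V(x)\to\infty$ as $|x|\to\infty$, there are an orthonormal basis $\{\phi_k\}_{k\in\mathbb{N}}$ of $L^2(\mathbb{R})$ and numbers $0<\lambda_0\le\lambda_1\le\cdots$, $\lambda_k\to\infty$, with $H\phi_k=\lambda_k^2\phi_k$. The spectral subspace is $\mathcal{E}_\lambda(\sqrt H)=\mathrm{span}\{\phi_k:\lambda_k\le\lambda\}$. *)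

theory Defs
  imports "HOL-Analysis.Analysis"
begin

text \<open>Elements of $L^2(\mathbb{R})$ (complex-valued, Lebesgue measure) are represented by functions,
  without passing to the quotient by a.e. equality.\<close>

definition L2 :: "(real \<Rightarrow> complex) set" where
  "L2 = {f. f \<in> borel_measurable lebesgue \<and> integrable lebesgue (\<lambda>x. (norm (f x))\<^sup>2)}"

definition l2_inner :: "(real \<Rightarrow> complex) \<Rightarrow> (real \<Rightarrow> complex) \<Rightarrow> complex" where
  "l2_inner f g = (LINT x|lebesgue. f x * cnj (g x))"

definition l2_norm_on :: "real set \<Rightarrow> (real \<Rightarrow> complex) \<Rightarrow> real" where
  "l2_norm_on A f = sqrt (LINT x:A|lebesgue. (norm (f x))\<^sup>2)"

abbreviation l2_norm :: "(real \<Rightarrow> complex) \<Rightarrow> real" where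
  "l2_norm \<equiv> l2_norm_on UNIV"

definition nth_deriv :: "nat \<Rightarrow> (real \<Rightarrow> 'a::real_normed_vector) \<Rightarrow> real \<Rightarrow> 'a" where
  "nth_deriv n f = ((\<lambda>g x. vector_derivative g (at x)) ^^ n) f"

definition smooth :: "(real \<Rightarrow> 'a::real_normed_vector) \<Rightarrow> bool" where
  "smooth f \<longleftrightarrow> (\<forall>n x. nth_deriv n f differentiable (at x))"

definition schwartz :: "(real \<Rightarrow> complex) set" where
  "schwartz = {f. smooth f \<and> (\<forall>m n. \<exists>B. \<forall>x. \<bar>x\<bar> ^ m * norm (nth_deriv n f x) \<le> B)}"

definition test_function :: "(real \<Rightarrow> real) \<Rightarrow> bool" where
  "test_function \<psi> \<longleftrightarrow> smooth \<psi> \<and> (\<exists>R. \<forall>x. \<bar>x\<bar> > R \<longrightarrow> \<psi> x = 0)"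

definition locally_integrable :: "(real \<Rightarrow> real) \<Rightarrow> bool" where
  "locally_integrable f \<longleftrightarrow> (\<forall>a b. set_integrable lebesgue {a..b} f)"

definition has_weak_derivative :: "(real \<Rightarrow> real) \<Rightarrow> (real \<Rightarrow> real) \<Rightarrow> bool" where
  "has_weak_derivative f g \<longleftrightarrow> locally_integrable f \<and> locally_integrable g \<and>
     (\<forall>\<psi>. test_function \<psi> \<longrightarrow>
        (LINT x|lebesgue. f x * nth_deriv 1 \<psi> x) = - (LINT x|lebesgue. g x * \<psi> x))"

definition Linfty_loc :: "(real \<Rightarrow> real) set" where
  "Linfty_loc = {f. f \<in> borel_measurable lebesgue \<and>
     (\<forall>a b. \<exists>M. AE x in lebesgue. x \<in> {a..b} \<longrightarrow> \<bar>f x\<bar> \<le> M)}"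

definition jbr :: "real \<Rightarrow> real" where
  "jbr x = sqrt (1 + \<bar>x\<bar>\<^sup>2)"

text \<open>An unbounded operator on $L^2(\mathbb{R})$ is represented by its graph, a set of pairs of
  $L^2$-functions that is saturated under a.e. equality.  Linearity and saturation need not be
  required separately below: any graph of the form \<open>op_adjoint T\<close> has both properties, and it is
  single-valued up to a.e. equality if \<open>T\<close> is densely defined.\<close>

type_synonym l2_op = "((real \<Rightarrow> complex) \<times> (real \<Rightarrow> complex)) set"

definition densely_defined :: "l2_op \<Rightarrow> bool" where
  "densely_defined T \<longleftrightarrow> T \<subseteq> L2 \<times> L2 \<and>
     (\<forall>f\<in>L2. \<forall>\<epsilon>>0. \<exists>(g, h)\<in>T. l2_norm (\<lambda>x. f x - g x) < \<epsilon>)"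

definition op_adjoint :: "l2_op \<Rightarrow> l2_op" where
  "op_adjoint T = {(u, v). u \<in> L2 \<and> v \<in> L2 \<and> (\<forall>(f, g)\<in>T. l2_inner g u = l2_inner f v)}"

definition self_adjoint :: "l2_op \<Rightarrow> bool" where
  "self_adjoint T \<longleftrightarrow> densely_defined T \<and> op_adjoint T = T"

definition schroedinger_operator :: "(real \<Rightarrow> real) \<Rightarrow> l2_op \<Rightarrow> bool" where
  "schroedinger_operator V H \<longleftrightarrow> self_adjoint H \<and>
     (\<forall>f\<in>schwartz. (f, \<lambda>x. - nth_deriv 2 f x + complex_of_real (V x) * f x) \<in> H)"

definition orthonormal_basis :: "(nat \<Rightarrow> real \<Rightarrow> complex) \<Rightarrow> bool" where
  "orthonormal_basis e \<longleftrightarrow> (\<forall>k. e k \<in> L2) \<and>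
     (\<forall>j k. l2_inner (e j) (e k) = (if j = k then 1 else 0)) \<and>
     (\<forall>f\<in>L2. (\<lambda>n. l2_norm (\<lambda>x. f x - (\<Sum>k<n. l2_inner f (e k) * e k x))) \<longlonglongrightarrow> 0)"

text \<open>The eigenvalue of \<open>H\<close> belonging to \<open>e k\<close> is the square of \<open>ev k\<close>.\<close>

definition eigenbasis :: "l2_op \<Rightarrow> (nat \<Rightarrow> real \<Rightarrow> complex) \<Rightarrow> (nat \<Rightarrow> real) \<Rightarrow> bool" where
  "eigenbasis H e ev \<longleftrightarrow> orthonormal_basis e \<and>
     0 < ev 0 \<and> incseq ev \<and> filterlim ev at_top sequentially \<and>
     (\<forall>k. (e k, \<lambda>x. complex_of_real ((ev k)\<^sup>2) * e k x) \<in> H)"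

definition spectral_subspace ::
    "(nat \<Rightarrow> real \<Rightarrow> complex) \<Rightarrow> (nat \<Rightarrow> real) \<Rightarrow> real \<Rightarrow> (real \<Rightarrow> complex) set" where
  "spectral_subspace e ev \<mu> = {f. \<exists>S c. finite S \<and> S \<subseteq> {k. ev k \<le> \<mu>} \<and>
     (AE x in lebesgue. f x = (\<Sum>k\<in>S. c k * e k x))}"

end

theory Submission
  imports Defs "HOL-Complex_Analysis.Complex_Analysis"
begin

text \<open>Let
  $u = \sum c_k \phi_k$ with $\lambda_k \le \mu$.  The energy bound $\int V |u|^2 \le \mu^2 \|u\|^2$
  confines half of the mass to $|x| \lesssim \mu^{2/\beta_1}$, so some interval $[Ln, L(n+1)]$ in that range
  carries a non-negligible share.  Near it, $V \le m^2$ with $m \lesssim \mu^{\beta_2/\beta_1}$.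
  Let $w > 0$ solve $w'' = V w$ there, put $q = w'/w$, so that $0 \le q \le m$, and
  $$W(x + iy) = \sum c_k \bigl(\phi_k \cosh \lambda_k y + i (\phi_k' - q \phi_k) \lambda_k^{-1} \sinh \lambda_k y\bigr)$$
  (for real $c_k \phi_k$; real and imaginary parts are treated separately).  Then
  $2 \bar\partial W = q \overline{W}$, so $W = e^s h$ with $h$ holomorphic and $|s| \lesssim m$, and
  $W = u$ on the real axis.  Lagrange interpolation of $h$ at $N \sim m + \mu$ well separated points
  of $\Omega$ where $u$ is small, with the Schwarz lemma for the remainder, bounds $u$ on the whole
  interval; the loss is $(N / |\Omega \cap [Ln, L(n+1)]|)^N$, which is
  $\exp(C \mu^\zeta \log (\mu + 1))$ at most.\<close>

text \<open>As \<open>V\<close> is only bounded and measurable, the stream function built from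
  \<phi>_k' alone is not classically differentiable in x. Subtracting q \<phi>_k turns it into a
  Wronskian divided by w; in the Wronskian the two terms with V cancel, so it is C^1. The price is a
  zero-order coefficient q, of size sqrt(sup V) and not sup V: hence a cost exp(C m), which is the
  origin of the exponent \<beta>2/\<beta>1.

  No constant may depend on the number of eigenfunctions in u. Every pointwise bound is therefore
  stated for combinations with bounded multipliers (cosh, sinh / \<lambda>_k, \<lambda>_k^2), whose
  L^2 norm orthogonality controls, and is then raised from integral norms to sup norms by the
  equation.

  With b = \<beta>2/\<beta>1 and t = 2\<tau>/\<beta>1, the number of nodes is O(\<mu>^b), while the
  logarithm of 1 / |\<Omega> \<inter> [Ln, L(n+1)]| is O(\<mu>^t) for the relevant n. The logarithm
  of the loss is thus O(\<mu>^b log(\<mu>+1) + \<mu>^(b+t)), within the claimed bound because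
  \<zeta> = b + 2t.\<close>

section \<open>Integration by parts for absolutely continuous functions\<close>

text \<open>\<open>F\<close> is a primitive of a merely integrable \<open>f\<close>, so
  \<open>F * g\<close> need not be differentiable anywhere in particular. The defect
  \<open>D\<close> of the formula nevertheless has increments bounded by |y - x| times the integral
  of |f| over [x, y]. The second factor tends to 0, so \<open>D\<close> has derivative 0 at every
  point and is constant.\<close>

lemma integration_by_parts_primitive:
  fixes f F g g' :: "real \<Rightarrow> real"
  assumes ab: "a \<le> b"
    and F: "\<And>x y. a \<le> x \<Longrightarrow> x \<le> y \<Longrightarrow> y \<le> b \<Longrightarrow> (f has_integral (F y - F x)) {x..y}"
    and f: "f absolutely_integrable_on {a..b}"
    and g: "\<And>x. x \<in> {a..b} \<Longrightarrow> (g has_real_derivative g' x) (at x within {a..b})"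
    and g': "continuous_on {a..b} g'"
  shows "((\<lambda>t. f t * g t + F t * g' t) has_integral (F b * g b - F a * g a)) {a..b}"
proof -
  have cg: "continuous_on {a..b} g"
    using g by (meson DERIV_continuous_on)
  have Feq: "F x = F a + integral {a..x} f" if "x \<in> {a..b}" for x
    using F[of a x] that by (simp add: integral_unique)
  have fi: "f integrable_on {a..b}"
    using f absolutely_integrable_on_def by blast
  have cF: "continuous_on {a..b} F"
  proof -
    have "continuous_on {a..b} (\<lambda>x. F a + integral {a..x} f)"
      by (intro continuous_intros indefinite_integral_continuous_1 fi)
    then show ?thesis by (rule continuous_on_eq) (rule Feq[symmetric])
  qed
  define h where "h = (\<lambda>t. f t * g t + F t * g' t)"
  have fg: "(\<lambda>t. g t * f t) absolutely_integrable_on {a..b}"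
    using f cg by (intro absolutely_integrable_bounded_measurable_product_real)
       (auto intro!: continuous_imp_measurable_on_sets_lebesgue compact_imp_bounded
          compact_continuous_image)
  have hi: "h integrable_on {a..b}"
    unfolding h_def
    by (intro integrable_add)
       (use fg cF g' in \<open>auto simp: absolutely_integrable_on_def mult.commute
          intro!: integrable_continuous_real continuous_intros\<close>)
  obtain C where C: "C > 0" "\<And>x. x \<in> {a..b} \<Longrightarrow> \<bar>g' x\<bar> \<le> C"
  proof -
    have "bounded (g' ` {a..b})" using g' by (intro compact_imp_bounded compact_continuous_image) auto
    then obtain C where "C > 0" "\<forall>x\<in>g' ` {a..b}. norm x \<le> C" using bounded_pos by blast
    then show ?thesis using that by auto
  qed
  define Z where "Z = (\<lambda>x. integral {a..x} (\<lambda>t. \<bar>f t\<bar>))"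
  have afi: "(\<lambda>t. \<bar>f t\<bar>) integrable_on {a..b}"
    using f by (simp add: absolutely_integrable_on_def)
  have cZ: "continuous_on {a..b} Z" unfolding Z_def
    by (intro indefinite_integral_continuous_1 afi)
  define D where "D = (\<lambda>x. integral {a..x} h - F x * g x)"
  have key: "\<bar>D y - D x\<bar> \<le> 2 * C * \<bar>y - x\<bar> * \<bar>Z y - Z x\<bar>" if xy: "a \<le> x" "x \<le> y" "y \<le> b" for x y
  proof -
    have sub: "{x..y} \<subseteq> {a..b}" using xy by auto
    have i1: "f integrable_on {x..y}" "h integrable_on {x..y}" "(\<lambda>t. \<bar>f t\<bar>) integrable_on {x..y}"
      using fi hi afi sub integrable_on_subinterval by blast+
    have ig': "(g' has_integral (g y - g x)) {x..y}"
      by (rule fundamental_theorem_of_calculus)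
         (use xy in \<open>auto intro!: has_vector_derivative_within_subset[OF _ sub]
           g[unfolded has_real_derivative_iff_has_vector_derivative]\<close>)
    \<comment> \<open>Freezing \<open>g\<close> at \<open>y\<close> and \<open>F\<close> at
      \<open>x\<close> gives the increment of \<open>F * g\<close> exactly; each remaining term is a
      product of an integrand and a small difference.\<close>
    have Dd: "((\<lambda>t. f t * (g t - g y) + (F t - F x) * g' t) has_integral (D y - D x)) {x..y}"
    proof -
      have "integral {a..x} h + integral {x..y} h = integral {a..y} h"
        using xy hi integrable_on_subinterval[OF hi, of a y] by (intro Henstock_Kurzweil_Integration.integral_combine) auto
      then have "(h has_integral (integral {a..y} h - integral {a..x} h)) {x..y}"
        using integrable_integral[OF i1(2)] by (metis add_diff_cancel_left')
      from has_integral_diff[OF has_integral_diff[OF this has_integral_mult_left[OF F[OF xy], of "g y"]]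
          has_integral_mult_right[OF ig', of "F x"]]
      show ?thesis by (simp add: h_def D_def algebra_simps)
    qed
    have Zd: "((\<lambda>t. \<bar>f t\<bar>) has_integral (Z y - Z x)) {x..y}"
    proof -
      have "integral {a..x} (\<lambda>t. \<bar>f t\<bar>) + integral {x..y} (\<lambda>t. \<bar>f t\<bar>) = integral {a..y} (\<lambda>t. \<bar>f t\<bar>)"
        using xy integrable_on_subinterval[OF afi, of a y] by (intro Henstock_Kurzweil_Integration.integral_combine) auto
      then show ?thesis using integrable_integral[OF i1(3)] unfolding Z_def by (metis add_diff_cancel_left')
    qed
    have Zn: "0 \<le> Z y - Z x" by (rule has_integral_nonneg[OF Zd]) auto
    have gd: "\<bar>g t - g y\<bar> \<le> C * (y - x)" if t: "t \<in> {x..y}" for t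
    proof -
      have "norm (g t - g y) \<le> C * norm (t - y)"
        by (rule field_differentiable_bound[of "{a..b}" g g'])
           (use g C xy t in auto)
      also have "\<dots> \<le> C * (y - x)" using t C by auto
      finally show ?thesis by simp
    qed
    have Fd: "\<bar>F t - F x\<bar> \<le> Z y - Z x" if t: "t \<in> {x..y}" for t
    proof -
      have "F t - F x = integral {x..t} f" using F[of x t] xy t by (simp add: integral_unique)
      also have "\<bar>\<dots>\<bar> \<le> integral {x..t} (\<lambda>t. \<bar>f t\<bar>)"
        using integral_norm_bound_integral[of f "{x..t}" "\<lambda>t. \<bar>f t\<bar>"]
          integrable_on_subinterval[OF i1(1), of x t] integrable_on_subinterval[OF i1(3), of x t] t by auto
      also have "\<dots> \<le> integral {x..y} (\<lambda>t. \<bar>f t\<bar>)"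
        using integrable_on_subinterval[OF i1(3), of x t] i1(3) t by (intro integral_subset_le) auto
      also have "\<dots> = Z y - Z x" using Zd by (simp add: integral_unique)
      finally show ?thesis .
    qed
    have bnd: "((\<lambda>t. C * (y - x) * \<bar>f t\<bar> + C * (Z y - Z x)) has_integral
        (C * (y - x) * (Z y - Z x) + C * (Z y - Z x) * (y - x))) {x..y}"
      using has_integral_add[OF has_integral_mult_right[OF Zd, of "C * (y - x)"]
         has_integral_const_real[of "C * (Z y - Z x)" x y]] xy by (simp add: algebra_simps)
    have "norm (D y - D x) \<le> C * (y - x) * (Z y - Z x) + C * (Z y - Z x) * (y - x)"
    proof -
      have "norm (integral {x..y} (\<lambda>t. f t * (g t - g y) + (F t - F x) * g' t)) \<le>
          integral {x..y} (\<lambda>t. C * (y - x) * \<bar>f t\<bar> + C * (Z y - Z x))"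
      proof (rule integral_norm_bound_integral)
        show "(\<lambda>t. f t * (g t - g y) + (F t - F x) * g' t) integrable_on {x..y}" using Dd by blast
        show "(\<lambda>t. C * (y - x) * \<bar>f t\<bar> + C * (Z y - Z x)) integrable_on {x..y}" using bnd by blast
        fix t assume t: "t \<in> {x..y}"
        have "\<bar>f t * (g t - g y)\<bar> \<le> \<bar>f t\<bar> * (C * (y - x))"
          unfolding abs_mult using gd[OF t] by (intro mult_left_mono) auto
        moreover have "\<bar>(F t - F x) * g' t\<bar> \<le> (Z y - Z x) * C"
          unfolding abs_mult using Fd[OF t] C t sub Zn by (intro mult_mono) auto
        ultimately show "norm (f t * (g t - g y) + (F t - F x) * g' t) \<le> C * (y - x) * \<bar>f t\<bar> + C * (Z y - Z x)"
          by (simp add: algebra_simps)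
      qed
      then show "norm (D y - D x) \<le> C * (y - x) * (Z y - Z x) + C * (Z y - Z x) * (y - x)"
        using Dd bnd by (simp add: integral_unique)
    qed
    then show ?thesis using xy Zn by (simp add: algebra_simps)
  qed
  have key': "\<bar>D y - D x\<bar> \<le> 2 * C * \<bar>y - x\<bar> * \<bar>Z y - Z x\<bar>" if "x \<in> {a..b}" "y \<in> {a..b}" for x y
    using key[of x y] key[of y x] that by (cases "x \<le> y") (auto simp: abs_minus_commute)
  have "(D has_real_derivative 0) (at x within {a..b})" if x: "x \<in> {a..b}" for x
  proof -
    have "((\<lambda>y. 2 * C * \<bar>Z y - Z x\<bar>) \<longlongrightarrow> 2 * C * \<bar>Z x - Z x\<bar>) (at x within {a..b})"
      using cZ x by (intro tendsto_intros) (auto simp: continuous_on_def)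
    then have lim: "((\<lambda>y. 2 * C * \<bar>Z y - Z x\<bar>) \<longlongrightarrow> 0) (at x within {a..b})" by simp
    have "((\<lambda>y. (D y - D x) / (y - x)) \<longlongrightarrow> 0) (at x within {a..b})"
    proof (rule Lim_null_comparison[OF _ lim])
      show "\<forall>\<^sub>F y in at x within {a..b}. norm ((D y - D x) / (y - x)) \<le> 2 * C * \<bar>Z y - Z x\<bar>"
        unfolding eventually_at_filter
      proof (intro always_eventually allI impI)
        fix y assume y: "y \<noteq> x" "y \<in> {a..b}"
        then show "norm ((D y - D x) / (y - x)) \<le> 2 * C * \<bar>Z y - Z x\<bar>"
          using key'[OF x y(2)] by (simp add: abs_divide field_simps)
      qed
    qed
    then show ?thesis by (simp add: has_field_derivative_iff)
  qed
  then have "D b = D a"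
    using has_field_derivative_zero_constant[of "{a..b}" D] ab
    by (metis atLeastAtMost_iff convex_real_interval(5) order_refl)
  then have "integral {a..b} h = F b * g b - F a * g a" by (simp add: D_def)
  then show ?thesis using hi unfolding h_def by (metis integrable_integral)
qed

text \<open>Henstock's lemma bounds the sum of |measure k * f x - integral over k| on fine
  divisions. When all interval integrals vanish, this sum is the Riemann sum of |f|, so the integral
  of |f| is 0 without any appeal to Lebesgue differentiation.\<close>

lemma absolutely_integrable_null_on_intervals:
  fixes f :: "real \<Rightarrow> real"
  assumes f: "f absolutely_integrable_on {a..b}"
    and z: "\<And>x y. a \<le> x \<Longrightarrow> x \<le> y \<Longrightarrow> y \<le> b \<Longrightarrow> integral {x..y} f = 0"
  shows "AE x in lebesgue. x \<in> {a..b} \<longrightarrow> f x = 0"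
proof -
  have fi: "f integrable_on cbox a b" and nfi: "(\<lambda>x. norm (f x)) integrable_on cbox a b"
    using f by (auto simp: absolutely_integrable_on_def)
  define I where "I = integral (cbox a b) (\<lambda>x. norm (f x))"
  have "I < e" if e: "e > 0" for e
  proof -
    obtain \<gamma>1 where g1: "gauge \<gamma>1"
      and g1': "\<And>p. p tagged_partial_division_of (cbox a b) \<Longrightarrow> \<gamma>1 fine p \<Longrightarrow>
             sum (\<lambda>(x,k). norm(measure lborel k *\<^sub>R f x - integral k f)) p < e/2"
      using Henstock_lemma[OF fi, of "e/2"] e by auto
    obtain \<gamma>2 where g2: "gauge \<gamma>2"
      and g2': "\<And>p. p tagged_division_of (cbox a b) \<Longrightarrow> \<gamma>2 fine p \<Longrightarrow>
             norm ((\<Sum>(x,k)\<in>p. measure lborel k *\<^sub>R norm (f x)) - I) < e/2"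
      using integrable_integral[OF nfi] e unfolding has_integral I_def
      by (metis half_gt_zero)
    obtain p where p: "p tagged_division_of cbox a b" "(\<lambda>x. \<gamma>1 x \<inter> \<gamma>2 x) fine p"
      using fine_division_exists[OF gauge_Int[OF g1 g2]] by blast
    have fine: "\<gamma>1 fine p" "\<gamma>2 fine p" using p(2) by (auto simp: fine_Int)
    have "sum (\<lambda>(x,k). norm(measure lborel k *\<^sub>R f x - integral k f)) p = (\<Sum>(x,k)\<in>p. measure lborel k *\<^sub>R norm (f x))"
    proof (rule sum.cong, simp, clarify)
      fix x k assume xk: "(x,k) \<in> p"
      obtain c d where k: "k = cbox c d" using p(1) xk by blast
      have sub: "k \<subseteq> cbox a b" "x \<in> k" using p(1) xk by blast+
      have "integral k f = 0"
        using sub k z[of c d] by (cases "c \<le> d") auto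
      then show "norm (measure lborel k *\<^sub>R f x - integral k f) = measure lborel k *\<^sub>R norm (f x)"
        by (simp add: abs_mult)
    qed
    moreover have "sum (\<lambda>(x,k). norm(measure lborel k *\<^sub>R f x - integral k f)) p < e/2"
      using g1' p(1) fine(1) tagged_division_of_def by blast
    moreover have "norm ((\<Sum>(x,k)\<in>p. measure lborel k *\<^sub>R norm (f x)) - I) < e/2"
      using g2' p(1) fine(2) by blast
    ultimately show "I < e" unfolding real_norm_def by linarith
  qed
  then have "I \<le> 0" by (meson not_less_iff_gr_or_eq linorder_le_cases order_less_irrefl not_le_imp_less)
  moreover have "I \<ge> 0" unfolding I_def by (rule integral_nonneg[OF nfi]) auto
  ultimately have I0: "I = 0" by simp
  have ni: "(\<lambda>x. norm (f x)) absolutely_integrable_on {a..b}"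
    using f by (simp add: absolutely_integrable_on_def)
  have "set_lebesgue_integral lebesgue {a..b} (\<lambda>x. norm (f x)) = 0"
    using I0 set_lebesgue_integral_eq_integral(2)[OF ni] by (simp add: I_def)
  then have "AE x in lebesgue. indicator {a..b} x *\<^sub>R norm (f x) = 0"
    using ni unfolding set_lebesgue_integral_def set_integrable_def
    by (subst (asm) integral_nonneg_eq_0_iff_AE) (auto simp: indicator_def)
  then show ?thesis by eventually_elim (auto simp: indicator_def split: if_splits)
qed

section \<open>Test functions\<close>

lemma nth_deriv_Suc: "nth_deriv (Suc n) f = (\<lambda>x. vector_derivative (nth_deriv n f) (at x))"
  by (simp add: nth_deriv_def)

lemma nth_deriv_0 [simp]: "nth_deriv 0 f = f"
  by (simp add: nth_deriv_def)

lemma nth_deriv_Suc_shift: "nth_deriv (Suc n) f = nth_deriv n (nth_deriv 1 f)"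
  by (simp add: nth_deriv_def funpow_Suc_right del: funpow.simps(2))

lemma nth_deriv_1_eqI:
  assumes "\<And>x. (f has_vector_derivative g x) (at x)"
  shows "nth_deriv 1 f = g"
  using assms by (simp add: nth_deriv_def vector_derivative_at fun_eq_iff)

text \<open>Smoothness follows from membership in any set of functions closed under differentiation,
  so no formula for the n-th derivative has to be found.\<close>

lemma smooth_coinduct:
  assumes "f \<in> S" and S: "\<And>g. g \<in> S \<Longrightarrow> \<exists>g'\<in>S. \<forall>x. (g has_vector_derivative g' x) (at x)"
  shows "smooth f"
proof -
  have "\<forall>f\<in>S. nth_deriv n f \<in> S" for n
  proof (induction n)
    case (Suc n)
    show ?case
    proof
      fix f assume "f \<in> S"
      then obtain g where "g \<in> S" "\<forall>x. (f has_vector_derivative g x) (at x)" using S by blast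
      then show "nth_deriv (Suc n) f \<in> S"
        using Suc nth_deriv_1_eqI[of f g] unfolding nth_deriv_Suc_shift by auto
    qed
  qed simp
  then have "nth_deriv n f \<in> S" for n using assms(1) by blast
  then show ?thesis unfolding smooth_def
    using S differentiableI_vector by blast
qed

lemma smooth_has_derivative:
  assumes "smooth f" shows "(f has_vector_derivative nth_deriv 1 f x) (at x)"
proof -
  have "nth_deriv 0 f differentiable (at x)" using assms unfolding smooth_def by blast
  then show ?thesis by (simp add: nth_deriv_Suc vector_derivative_works)
qed

lemma smooth_nth_deriv_1: "smooth f \<Longrightarrow> smooth (nth_deriv 1 f)"
  unfolding smooth_def by (metis nth_deriv_Suc_shift)

lemma smooth_continuous_on: "smooth f \<Longrightarrow> continuous_on A f"
  by (meson continuous_at_imp_continuous_on has_vector_derivative_continuous smooth_has_derivative)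

lemma smooth_lincomb:
  fixes f g :: "real \<Rightarrow> real"
  assumes "smooth f" "smooth g" shows "smooth (\<lambda>x. f x + c * g x)"
    and "nth_deriv 1 (\<lambda>x. f x + c * g x) = (\<lambda>x. nth_deriv 1 f x + c * nth_deriv 1 g x)"
proof -
  have d: "((\<lambda>x. f x + c * g x) has_vector_derivative nth_deriv 1 f x + c * nth_deriv 1 g x) (at x)"
    if "smooth f" "smooth g" for f g :: "real \<Rightarrow> real" and x
    using smooth_has_derivative[OF that(1), of x] smooth_has_derivative[OF that(2), of x]
    by (auto simp flip: has_real_derivative_iff_has_vector_derivative intro!: derivative_eq_intros)
  show "smooth (\<lambda>x. f x + c * g x)"
  proof (rule smooth_coinduct[where S = "{h. \<exists>f g. smooth f \<and> smooth g \<and> h = (\<lambda>x. f x + c * g x)}"])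
    fix h assume "h \<in> {h. \<exists>f g. smooth f \<and> smooth g \<and> h = (\<lambda>x. f x + c * g x)}"
    then obtain f g where fg: "smooth f" "smooth g" "h = (\<lambda>x. f x + c * g x)" by blast
    then show "\<exists>g'\<in>{h. \<exists>f g. smooth f \<and> smooth g \<and> h = (\<lambda>x. f x + c * g x)}. \<forall>x. (h has_vector_derivative g' x) (at x)"
      by (intro bexI[where x = "\<lambda>x. nth_deriv 1 f x + c * nth_deriv 1 g x"])
         (use d smooth_nth_deriv_1 in blast)+
  qed (use assms in blast)
  show "nth_deriv 1 (\<lambda>x. f x + c * g x) = (\<lambda>x. nth_deriv 1 f x + c * nth_deriv 1 g x)"
    by (rule nth_deriv_1_eqI) (rule d[OF assms])
qed

lemma smooth_primitive:
  assumes "smooth g" "\<And>x. (h has_vector_derivative g x) (at x)"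
  shows "smooth h"
proof (rule smooth_coinduct[where S = "insert h {f. smooth f}"])
  fix f assume "f \<in> insert h {f. smooth f}"
  then consider "f = h" | "smooth f" by blast
  then show "\<exists>g'\<in>insert h {f. smooth f}. \<forall>x. (f has_vector_derivative g' x) (at x)"
  proof cases
    case 1
    then show ?thesis using assms by (intro bexI[of _ g]) auto
  next
    case 2
    then show ?thesis using smooth_has_derivative smooth_nth_deriv_1
      by (intro bexI[of _ "nth_deriv 1 f"]) auto
  qed
qed simp

text \<open>The non-strict inequality makes the function vanish at the endpoints of [-R, R], where
  boundary terms are evaluated.\<close>

lemma test_function_supportE:
  assumes "test_function f"
  obtains R where "R > 0" "\<And>x. \<bar>x\<bar> \<ge> R \<Longrightarrow> f x = 0"
proof -
  obtain R0 where "\<And>x. \<bar>x\<bar> > R0 \<Longrightarrow> f x = 0" using assms unfolding test_function_def by blast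
  then show ?thesis using that[of "max R0 0 + 1"] by auto
qed

lemma nth_deriv_1_eq_0_outside:
  fixes f :: "real \<Rightarrow> 'a::real_normed_vector"
  assumes R: "\<And>x. \<bar>x\<bar> > R \<Longrightarrow> f x = 0" and x: "\<bar>x\<bar> > R"
  shows "nth_deriv 1 f x = 0"
proof -
  have "open {y. \<bar>y\<bar> > R}" by (intro open_Collect_less continuous_intros)
  then have "(f has_vector_derivative 0) (at x)"
    using has_vector_derivative_transform_within_open[of "\<lambda>_. 0" 0 x "{y. \<bar>y\<bar> > R}" f] R x
    by auto
  then show ?thesis by (simp add: nth_deriv_def vector_derivative_at)
qed

lemma test_function_nth_deriv_1: "test_function f \<Longrightarrow> test_function (nth_deriv 1 f)"
  unfolding test_function_def using smooth_nth_deriv_1 nth_deriv_1_eq_0_outside by blast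

lemma test_function_lincomb:
  assumes "test_function f" "test_function g"
  shows "test_function (\<lambda>x. f x + c * g x)"
proof -
  obtain R S where "\<And>x. \<bar>x\<bar> \<ge> R \<Longrightarrow> f x = 0" "\<And>x. \<bar>x\<bar> \<ge> S \<Longrightarrow> g x = 0"
    using test_function_supportE assms by metis
  then have "\<forall>x. \<bar>x\<bar> > max R S \<longrightarrow> f x + c * g x = 0" by auto
  then show ?thesis using smooth_lincomb(1) assms unfolding test_function_def by blast
qed

lemma locally_integrable_times_compact_support:
  fixes f \<psi> :: "real \<Rightarrow> real"
  assumes \<psi>: "locally_integrable \<psi>" and f: "continuous_on UNIV f" and R: "\<And>x. \<bar>x\<bar> \<ge> R \<Longrightarrow> f x = 0"
  shows "integrable lebesgue (\<lambda>x. \<psi> x * f x)"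
    and "(LINT x|lebesgue. \<psi> x * f x) = integral {-R..R} (\<lambda>x. \<psi> x * f x)"
proof -
  have cf: "continuous_on {-R..R} f" using f continuous_on_subset by blast
  have a: "(\<lambda>x. f x * \<psi> x) absolutely_integrable_on {-R..R}"
    using \<psi> cf unfolding locally_integrable_def
    by (intro absolutely_integrable_bounded_measurable_product_real)
       (auto intro!: continuous_imp_measurable_on_sets_lebesgue compact_imp_bounded
          compact_continuous_image)
  have eq: "(\<lambda>x. indicator {-R..R} x *\<^sub>R (f x * \<psi> x)) = (\<lambda>x. \<psi> x * f x)"
  proof
    fix x
    have "f x = 0" if "x \<notin> {-R..R}" by (rule R) (use that in auto)
    then show "indicator {-R..R} x *\<^sub>R (f x * \<psi> x) = \<psi> x * f x"
      by (cases "x \<in> {-R..R}") auto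
  qed
  show "integrable lebesgue (\<lambda>x. \<psi> x * f x)"
    using a unfolding set_integrable_def eq .
  show "(LINT x|lebesgue. \<psi> x * f x) = integral {-R..R} (\<lambda>x. \<psi> x * f x)"
    using set_lebesgue_integral_eq_integral(2)[OF a] unfolding set_lebesgue_integral_def eq
    by (simp add: mult.commute)
qed

lemma locally_integrable_continuous:
  "continuous_on UNIV f \<Longrightarrow> locally_integrable f"
  unfolding locally_integrable_def
  by (meson absolutely_integrable_continuous_real continuous_on_subset top_greatest)

lemma locally_integrable_lincomb:
  "locally_integrable f \<Longrightarrow> locally_integrable g \<Longrightarrow> locally_integrable (\<lambda>x. f x + c * g x)"
  unfolding locally_integrable_def by (auto intro: set_integral_add)

lemma integral_compact_support:
  fixes f :: "real \<Rightarrow> real"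
  assumes f: "continuous_on UNIV f" and R: "\<And>x. \<bar>x\<bar> \<ge> R \<Longrightarrow> f x = 0"
  shows "integrable lebesgue f" "(LINT x|lebesgue. f x) = integral {-R..R} f"
  using locally_integrable_times_compact_support
    [OF locally_integrable_continuous[OF continuous_on_const[of _ 1]] assms]
  by simp_all

lemma LINT_derivative_compact_support:
  fixes h :: "real \<Rightarrow> real"
  assumes d: "\<And>x. (h has_vector_derivative g x) (at x)" and c: "continuous_on UNIV g"
    and R: "\<And>x. \<bar>x\<bar> \<ge> R \<Longrightarrow> h x = 0" "\<And>x. \<bar>x\<bar> \<ge> R \<Longrightarrow> g x = 0" and "R > 0"
  shows "(LINT x|lebesgue. g x) = 0"
proof -
  have "(g has_integral (h R - h (-R))) {-R..R}"
    using d \<open>R > 0\<close> by (intro fundamental_theorem_of_calculus) (auto intro: has_vector_derivative_at_within)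
  then show ?thesis using integral_compact_support(2)[OF c R(2)] R(1)[of R] R(1)[of "-R"] \<open>R > 0\<close>
    by (simp add: integral_unique)
qed

text \<open>The integral from -R is constant to the right of the support, with value the total
  integral; the zero mean is what makes the primitive compactly supported.\<close>

lemma test_function_primitive:
  assumes g: "test_function g" and z: "(LINT x|lebesgue. g x) = 0"
  obtains h where "test_function h" "nth_deriv 1 h = g"
proof -
  obtain R where R: "R > 0" "\<And>x. \<bar>x\<bar> \<ge> R \<Longrightarrow> g x = 0" using test_function_supportE[OF g] by blast
  have sm: "smooth g" using g by (simp add: test_function_def)
  have c: "continuous_on A g" for A by (rule smooth_continuous_on[OF sm])
  define h where "h = (\<lambda>x. integral {-R..x} g)"
  have h0: "h x = 0" if "x \<le> -R" for x
    using that unfolding h_def by (cases "x = -R") auto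
  have h1: "h x = 0" if "x \<ge> R" for x
  proof -
    have "integral {-R..R} g + integral {R..x} g = integral {-R..x} g"
      using that R(1) by (intro Henstock_Kurzweil_Integration.integral_combine integrable_continuous_real c) auto
    moreover have "integral {R..x} g = integral {R..x} (\<lambda>_. 0)"
      using R by (intro Henstock_Kurzweil_Integration.integral_cong) auto
    ultimately show ?thesis
      using integral_compact_support(2)[OF c R(2)] z by (simp add: h_def)
  qed
  have hd: "(h has_vector_derivative g x) (at x)" for x
  proof (cases "x > -R")
    case True
    have "((\<lambda>u. integral {-R..u} g) has_vector_derivative g x) (at x within {-R..x+1})"
      by (rule integral_has_vector_derivative) (use c True in auto)
    then have "(h has_vector_derivative g x) (at x within {-R<..<x+1})"
      unfolding h_def by (rule has_vector_derivative_within_subset) auto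
    then show ?thesis using True by (subst (asm) at_within_open) auto
  next
    case False
    show ?thesis
    proof (cases "x = -R")
      \<comment> \<open>At the left end of the support the integral only provides the derivative
        from the right; on the left \<open>h\<close> is constantly 0, and the two one-sided
        derivatives agree because \<open>g (-R) = 0\<close>.\<close>
      case True
      have "(h has_vector_derivative 0) (at x within {..x})"
        by (rule has_vector_derivative_transform[where f = "\<lambda>_. 0"]) (use h0 True in auto)
      moreover have "(h has_vector_derivative g x) (at x within {-R..x+1})" unfolding h_def
        by (rule integral_has_vector_derivative) (use c True in auto)
      then have "(h has_vector_derivative 0) (at x within {x..x+1})"
        using True R by auto
      ultimately have "(h has_vector_derivative 0) (at x within {..x} \<union> {x..x+1})"
        by (simp add: has_vector_derivative_def has_derivative_within Lim_within_Un)
      then have "(h has_vector_derivative 0) (at x within {..<x+1})"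
        by (rule has_vector_derivative_within_subset) auto
      then have "(h has_vector_derivative 0) (at x)" by (subst (asm) at_within_open) auto
      then show ?thesis using True R by simp
    next
      case F: False
      then have "(h has_vector_derivative 0) (at x)" using False h0
        by (intro has_vector_derivative_transform_within_open[of "\<lambda>_. 0" 0 x "{..<-R}" h]) auto
      then show ?thesis using False R by simp
    qed
  qed
  have "test_function h"
    unfolding test_function_def
    using smooth_primitive[OF sm hd] h0 h1
    by (metis abs_less_iff linorder_not_le minus_le_iff nle_le abs_if less_eq_real_def)
  then show ?thesis using that nth_deriv_1_eqI[OF hd] by blast
qed

section \<open>Bump functions made from the flat function exp(-1/x)\<close>

definition flat_exp :: "nat \<Rightarrow> real \<Rightarrow> real" where
  "flat_exp k x = (if x > 0 then inverse x ^ k * exp (- inverse x) else 0)"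

lemma flat_exp_tendsto_0: "(flat_exp k \<longlongrightarrow> 0) (at 0)"
proof -
  have "((\<lambda>x. inverse x ^ k / exp (inverse x)) \<longlongrightarrow> (0::real)) (at_right 0)"
    by (rule filterlim_compose[OF tendsto_power_div_exp_0 filterlim_inverse_at_top_right])
  then have "(flat_exp k \<longlongrightarrow> 0) (at_right 0)"
    by (rule Lim_transform_eventually)
       (auto simp: eventually_at_filter flat_exp_def exp_minus divide_inverse)
  moreover have "(flat_exp k \<longlongrightarrow> 0) (at_left 0)"
    by (rule Lim_transform_eventually[OF tendsto_const])
       (auto simp: eventually_at_filter flat_exp_def)
  ultimately show ?thesis by (simp add: filterlim_at_split)
qed

text \<open>The power index \<open>k\<close> is there to close the family under differentiation. At
  0 the difference quotient of the k-th function is the function with index k + 1, which tends to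
  0.\<close>

lemma flat_exp_has_derivative:
  "(flat_exp k has_real_derivative (flat_exp (k + 2) x - real k * flat_exp (k + 1) x)) (at x)"
proof (cases x "0::real" rule: linorder_cases)
  case less
  have "(flat_exp k has_real_derivative 0) (at x)"
    by (rule DERIV_cong_ev[THEN iffD1, OF refl _ refl DERIV_const[of 0]])
       (use less in \<open>auto simp: flat_exp_def eventually_nhds intro!: exI[of _ "{..<0}"]\<close>)
  then show ?thesis using less by (simp add: flat_exp_def)
next
  case equal
  have "((\<lambda>y. (flat_exp k y - flat_exp k 0) / (y - 0)) \<longlongrightarrow> 0) (at 0)"
    by (rule Lim_transform_eventually[OF flat_exp_tendsto_0[of "Suc k"]])
       (auto simp: eventually_at_filter flat_exp_def divide_inverse)
  then show ?thesis using equal by (simp add: has_field_derivative_iff flat_exp_def)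
next
  case greater
  have "((\<lambda>x. inverse x ^ k * exp (- inverse x)) has_real_derivative
      (flat_exp (k + 2) x - real k * flat_exp (k + 1) x)) (at x)"
  proof -
    have d1: "((\<lambda>x. inverse x) has_real_derivative - (inverse x * inverse x)) (at x)"
      using DERIV_inverse[of x UNIV] greater by simp
    have d3: "((\<lambda>x. exp (- inverse x)) has_real_derivative
        exp (- inverse x) * - (- (inverse x * inverse x))) (at x)"
      by (rule DERIV_fun_exp[OF DERIV_minus[OF d1]])
    show ?thesis
    proof (cases k)
      case 0
      then show ?thesis using greater
        by (auto intro!: DERIV_cong[OF d3] simp: flat_exp_def algebra_simps power2_eq_square)
    next
      case (Suc n)
      show ?thesis unfolding Suc
        by (rule DERIV_cong[OF DERIV_mult[OF DERIV_power_Suc[OF d1, of n] d3]])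
           (use greater in \<open>simp add: flat_exp_def algebra_simps power2_eq_square\<close>)
    qed
  qed
  then show ?thesis
    by (rule DERIV_cong_ev[THEN iffD1, OF refl _ refl, rotated])
       (use greater in \<open>auto simp: flat_exp_def eventually_nhds intro!: exI[of _ "{0<..}"]\<close>)
qed

text \<open>The algebra generated by the functions \<open>flat_exp k\<close> of affine arguments.
  The chain and product rules keep derivatives inside it, which is all that
  \<open>smooth_coinduct\<close> asks for.\<close>

inductive_set flat_algebra :: "(real \<Rightarrow> real) set" where
  base: "(\<lambda>x. flat_exp k (\<alpha> * x + \<beta>)) \<in> flat_algebra"
| scale: "f \<in> flat_algebra \<Longrightarrow> (\<lambda>x. c * f x) \<in> flat_algebra"
| add: "f \<in> flat_algebra \<Longrightarrow> g \<in> flat_algebra \<Longrightarrow> (\<lambda>x. f x + g x) \<in> flat_algebra"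
| mult: "f \<in> flat_algebra \<Longrightarrow> g \<in> flat_algebra \<Longrightarrow> (\<lambda>x. f x * g x) \<in> flat_algebra"

lemma flat_algebra_derivative:
  "f \<in> flat_algebra \<Longrightarrow> \<exists>f'\<in>flat_algebra. \<forall>x. (f has_real_derivative f' x) (at x)"
proof (induction rule: flat_algebra.induct)
  case (base k \<alpha> \<beta>)
  let ?g = "\<lambda>x. \<alpha> * (flat_exp (k + 2) (\<alpha> * x + \<beta>) + (- real k) * flat_exp (k + 1) (\<alpha> * x + \<beta>))"
  have "?g \<in> flat_algebra" by (intro flat_algebra.intros)
  moreover have "((\<lambda>x. flat_exp k (\<alpha> * x + \<beta>)) has_real_derivative ?g x) (at x)" for x
  proof -
    have "((\<lambda>x. \<alpha> * x + \<beta>) has_real_derivative \<alpha>) (at x)"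
      by (auto intro!: derivative_eq_intros)
    from DERIV_chain2[OF flat_exp_has_derivative this, of k] show ?thesis
      by (simp add: algebra_simps)
  qed
  ultimately show ?case by (intro bexI[of _ ?g]) auto
next
  case (scale f c)
  then obtain f' where f': "f' \<in> flat_algebra" "\<And>x. (f has_real_derivative f' x) (at x)" by blast
  have "((\<lambda>x. c * f x) has_real_derivative c * f' x) (at x)" for x
    using f' by (auto intro!: derivative_eq_intros)
  then show ?case using flat_algebra.scale[OF f'(1), of c] by (intro bexI) auto
next
  case (add f g)
  then obtain f' g' where f': "f' \<in> flat_algebra" "\<And>x. (f has_real_derivative f' x) (at x)"
    "g' \<in> flat_algebra" "\<And>x. (g has_real_derivative g' x) (at x)" by blast
  have "((\<lambda>x. f x + g x) has_real_derivative f' x + g' x) (at x)" for x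
    using f' by (auto intro!: derivative_eq_intros)
  then show ?case using flat_algebra.add[OF f'(1,3)] by (intro bexI) auto
next
  case (mult f g)
  then obtain f' g' where f': "f' \<in> flat_algebra" "\<And>x. (f has_real_derivative f' x) (at x)"
    "g' \<in> flat_algebra" "\<And>x. (g has_real_derivative g' x) (at x)" by blast
  have "((\<lambda>x. f x * g x) has_real_derivative f' x * g x + f x * g' x) (at x)" for x
    using f' by (auto intro!: derivative_eq_intros)
  moreover have "(\<lambda>x. f' x * g x + f x * g' x) \<in> flat_algebra"
    using f' mult by (intro flat_algebra.add flat_algebra.mult)
  ultimately show ?case by (intro bexI[of _ "\<lambda>x. f' x * g x + f x * g' x"]) auto
qed

lemma flat_algebra_smooth: "f \<in> flat_algebra \<Longrightarrow> smooth f"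
  by (rule smooth_coinduct[of _ flat_algebra])
     (simp_all add: flat_algebra_derivative flip: has_real_derivative_iff_has_vector_derivative)

text \<open>The functions exp(-1/((n+1)(x-a))) exp(-1/((n+1)(b-x))), cut off outside (a, b):
  rescaling by n + 1 drives both exponents to 0 at each fixed interior point.\<close>

lemma test_functions_approximating_indicator:
  fixes a b :: real
  obtains f where "\<And>n. test_function (f n)" "\<And>n x. 0 \<le> f n x" "\<And>n x. f n x \<le> indicator {a..b} x"
    "\<And>x. (\<lambda>n. f n x) \<longlonglongrightarrow> indicator {a<..<b} x"
proof -
  define f where "f = (\<lambda>n x. flat_exp 0 (real (Suc n) * (x - a)) * flat_exp 0 (real (Suc n) * (b - x)))"
  have "(\<lambda>x. flat_exp 0 (real (Suc n) * x + (- real (Suc n) * a)) *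
      flat_exp 0 (- real (Suc n) * x + real (Suc n) * b)) \<in> flat_algebra" for n
    by (intro flat_algebra.intros)
  also have "(\<lambda>x. flat_exp 0 (real (Suc n) * x + (- real (Suc n) * a)) *
      flat_exp 0 (- real (Suc n) * x + real (Suc n) * b)) = f n" for n
    by (simp add: f_def fun_eq_iff algebra_simps)
  finally have sm: "smooth (f n)" for n by (rule flat_algebra_smooth)
  have e: "0 \<le> flat_exp 0 x" "flat_exp 0 x \<le> 1" for x by (auto simp: flat_exp_def)
  have z: "f n x = 0" if "x \<notin> {a<..<b}" for n x
  proof -
    have "x - a \<le> 0 \<or> b - x \<le> 0" using that by auto
    then have "real (Suc n) * (x - a) \<le> 0 \<or> real (Suc n) * (b - x) \<le> 0"
      by (auto intro: mult_nonneg_nonpos)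
    then show ?thesis unfolding f_def flat_exp_def by auto
  qed
  show ?thesis
  proof
    show "test_function (f n)" for n
      unfolding test_function_def
    proof (intro conjI exI[of _ "max \<bar>a\<bar> \<bar>b\<bar>"] allI impI sm)
      show "f n x = 0" if "max \<bar>a\<bar> \<bar>b\<bar> < \<bar>x\<bar>" for x by (rule z) (use that in auto)
    qed
    show "0 \<le> f n x" for n x using e by (simp add: f_def)
    show "f n x \<le> indicator {a..b} x" for n x
    proof (cases "x \<in> {a<..<b}")
      case True
      have "f n x \<le> 1" unfolding f_def using e mult_le_one by blast
      then show ?thesis using True by (simp add: indicator_def)
    qed (simp add: z)
    show "(\<lambda>n. f n x) \<longlonglongrightarrow> indicator {a<..<b} x" for x
    proof (cases "x \<in> {a<..<b}")
      case True
      have lim: "(\<lambda>n. flat_exp 0 (real (Suc n) * c)) \<longlonglongrightarrow> 1" if "c > 0" for c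
      proof -
        have "(\<lambda>n. exp (- (inverse (real (Suc n)) * inverse c))) \<longlonglongrightarrow> exp (- (0 * inverse c))"
          by (intro tendsto_intros LIMSEQ_inverse_real_of_nat)
        then show ?thesis using that by (simp add: flat_exp_def)
      qed
      have "(\<lambda>n. f n x) \<longlonglongrightarrow> 1 * 1"
        unfolding f_def by (intro tendsto_mult lim) (use True in auto)
      then show ?thesis using True by simp
    qed (simp add: z)
  qed
qed

section \<open>Regularity of weak solutions of the eigenvalue equation\<close>

lemma locally_integrable_primitive:
  assumes "locally_integrable f"
  shows "\<exists>F. (\<forall>x y. x \<le> y \<longrightarrow> (f has_integral (F y - F x)) {x..y}) \<and> continuous_on UNIV F"
proof -
  have fi: "f integrable_on {x..y}" for x y
    using assms unfolding locally_integrable_def absolutely_integrable_on_def by blast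
  define F where "F = (\<lambda>x. if 0 \<le> x then integral {0..x} f else - integral {x..0} f)"
  have F: "(f has_integral (F y - F x)) {x..y}" if "x \<le> y" for x y
  proof -
    have "F y - F x = integral {x..y} f"
    proof -
      consider "0 \<le> x" | "x < 0" "0 \<le> y" | "y < 0" by linarith
      then show ?thesis
      proof cases
        case 1
        then show ?thesis
          using Henstock_Kurzweil_Integration.integral_combine[of 0 x y f] that fi by (auto simp: F_def)
      next
        case 2
        then show ?thesis
          using Henstock_Kurzweil_Integration.integral_combine[of x 0 y f] that fi by (auto simp: F_def)
      next
        case 3
        then show ?thesis
          using Henstock_Kurzweil_Integration.integral_combine[of x y 0 f] that fi by (auto simp: F_def)
      qed
    qed
    then show ?thesis using fi integrable_integral by metis
  qed
  moreover have "isCont F x" for x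
  proof -
    have "continuous_on {x-1..x+1} (\<lambda>y. F (x-1) + integral {x-1..y} f)"
      by (intro continuous_intros indefinite_integral_continuous_1 fi)
    then have "continuous_on {x-1..x+1} F"
      by (rule continuous_on_eq) (use integral_unique[OF F[of "x-1"]] in auto)
    then have "continuous_on {x-1<..<x+1} F" by (rule continuous_on_subset) auto
    then show ?thesis by (simp add: continuous_on_eq_continuous_at)
  qed
  then have "continuous_on UNIV F" by (simp add: continuous_at_imp_continuous_on)
  ultimately show ?thesis by blast
qed

lemma continuous_has_primitive:
  fixes f :: "real \<Rightarrow> real"
  assumes c: "continuous_on UNIV f"
  obtains F where "\<And>x. (F has_real_derivative f x) (at x)"
proof -
  obtain F where F: "\<And>x y. x \<le> y \<Longrightarrow> (f has_integral (F y - F x)) {x..y}" and "continuous_on UNIV F"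
    using locally_integrable_primitive[OF locally_integrable_continuous[OF c]] by blast
  have "(F has_real_derivative f x) (at x)" for x
  proof -
    have "((\<lambda>u. integral {x-1..u} f) has_vector_derivative f x) (at x within {x-1..x+1})"
      by (rule integral_has_vector_derivative) (auto intro: continuous_on_subset[OF c])
    then have "((\<lambda>u. F (x-1) + integral {x-1..u} f) has_vector_derivative f x) (at x within {x-1..x+1})"
      using has_vector_derivative_add[OF has_vector_derivative_const[of "F (x-1)"]] by fastforce
    then have "(F has_vector_derivative f x) (at x within {x-1..x+1})"
      by (rule has_vector_derivative_transform[rotated 2])
         (use integral_unique[OF F[of "x-1"]] in auto)
    then have "(F has_vector_derivative f x) (at x within {x-1<..<x+1})"
      by (rule has_vector_derivative_within_subset) auto
    then show ?thesis
      by (subst (asm) at_within_open) (auto simp: has_real_derivative_iff_has_vector_derivative)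
  qed
  then show ?thesis using that by blast
qed

lemma locally_integrable_null_on_intervals:
  assumes f: "locally_integrable f"
    and z: "\<And>x y. x \<le> y \<Longrightarrow> integral {x..y} f = 0"
  shows "AE x in lebesgue. f x = 0"
proof -
  have "AE x in lebesgue. \<forall>n::nat. x \<in> {- real n..real n} \<longrightarrow> f x = 0"
    unfolding AE_all_countable
    using f z unfolding locally_integrable_def
    by (intro allI absolutely_integrable_null_on_intervals) auto
  then show ?thesis
  proof eventually_elim
    case (elim x)
    obtain n where "\<bar>x\<bar> \<le> real n" using real_arch_simple by blast
    then show ?case using elim by (auto simp: abs_le_iff)
  qed
qed

text \<open>Testing with approximations of an indicator and dominated convergence show that all
  interval integrals of \<open>f\<close> vanish.\<close>

lemma fundamental_lemma_calculus_of_variations: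
  assumes f: "locally_integrable f"
    and z: "\<And>g. test_function g \<Longrightarrow> (LINT x|lebesgue. f x * g x) = 0"
  shows "AE x in lebesgue. f x = 0"
proof (rule locally_integrable_null_on_intervals[OF f])
  fix a b :: real assume ab: "a \<le> b"
  obtain g where g: "\<And>n. test_function (g n)" "\<And>n x. 0 \<le> g n x" "\<And>n x. g n x \<le> indicator {a..b} x"
    "\<And>x. (\<lambda>n. g n x) \<longlonglongrightarrow> indicator {a<..<b} x"
    using test_functions_approximating_indicator[of a b] by blast
  have fi: "f absolutely_integrable_on {a..b}" using f by (simp add: locally_integrable_def)
  have gm: "integrable lebesgue (\<lambda>x. f x * g n x)" for n
    using test_function_supportE[OF g(1)] locally_integrable_times_compact_support(1)[OF f smooth_continuous_on]
      g(1) unfolding test_function_def by metis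
  have fm: "(\<lambda>x. indicator {a..b} x *\<^sub>R f x) \<in> borel_measurable lebesgue"
    using fi unfolding set_integrable_def by auto
  have "(\<lambda>n. LINT x|lebesgue. f x * g n x) \<longlonglongrightarrow> (LINT x|lebesgue. f x * indicator {a<..<b} x)"
  proof (rule integral_dominated_convergence[where w = "\<lambda>x. \<bar>indicator {a..b} x *\<^sub>R f x\<bar>"])
    have "(\<lambda>x. indicator {a<..<b} x * (indicator {a..b} x *\<^sub>R f x)) \<in> borel_measurable lebesgue"
      by (intro borel_measurable_times fm borel_measurable_indicator) auto
    also have "(\<lambda>x. indicator {a<..<b} x * (indicator {a..b} x *\<^sub>R f x)) = (\<lambda>x. f x * indicator {a<..<b} x)"
      by (auto simp: indicator_def fun_eq_iff)
    finally show "(\<lambda>x. f x * indicator {a<..<b} x) \<in> borel_measurable lebesgue" .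
    show "integrable lebesgue (\<lambda>x. \<bar>indicator {a..b} x *\<^sub>R f x\<bar>)"
      using fi unfolding set_integrable_def by (rule integrable_abs)
    show "AE x in lebesgue. (\<lambda>n. f x * g n x) \<longlonglongrightarrow> f x * indicator {a<..<b} x"
      by (intro AE_I2 tendsto_intros g)
    show "AE x in lebesgue. norm (f x * g n x) \<le> \<bar>indicator {a..b} x *\<^sub>R f x\<bar>" for n
    proof (rule AE_I2)
      fix x
      have "\<bar>f x\<bar> * \<bar>g n x\<bar> \<le> \<bar>f x\<bar> * indicator {a..b} x"
        using g(2,3)[of n x] by (intro mult_left_mono) auto
      then show "norm (f x * g n x) \<le> \<bar>indicator {a..b} x *\<^sub>R f x\<bar>"
        by (simp add: abs_mult mult.commute)
    qed
  qed (use gm in auto)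
  then have "(LINT x|lebesgue. f x * indicator {a<..<b} x) = 0"
    using z g(1) by (simp add: LIMSEQ_const_iff)
  moreover have "(LINT x|lebesgue. f x * indicator {a<..<b} x) = integral {a..b} f"
  proof -
    have "f absolutely_integrable_on {a<..<b}"
      using fi absolutely_integrable_on_Icc_iff_Ioo by blast
    from set_lebesgue_integral_eq_integral(2)[OF this] show ?thesis
      by (simp add: set_lebesgue_integral_def mult.commute integral_open_interval_real)
  qed
  ultimately show "integral {a..b} f = 0" by simp
qed

lemma test_function_integrable: "test_function f \<Longrightarrow> integrable lebesgue f"
  using integral_compact_support(1) smooth_continuous_on test_function_supportE
  unfolding test_function_def by metis

text \<open>If every test function had mean 0, the fundamental lemma applied to the constant 1 would
  give 1 = 0 almost everywhere.\<close>

lemma exists_normalized_test_function: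
  obtains P where "test_function P" "(LINT x|lebesgue. P x) = 1"
proof -
  have "\<exists>P. test_function P \<and> (LINT x|lebesgue. P x) \<noteq> 0"
  proof (rule ccontr)
    assume "\<not> ?thesis"
    then have "AE x in lebesgue. (\<lambda>_. 1::real) (x::real) = 0"
      by (intro fundamental_lemma_calculus_of_variations locally_integrable_continuous) auto
    then have "AE x in (lebesgue :: real measure). False" by simp
    then have "negligible (UNIV :: real set)" unfolding eventually_ae_filter_negligible by (auto simp: top.extremum_unique)
    then show False by simp
  qed
  then obtain P where P: "test_function P" "(LINT x|lebesgue. P x) \<noteq> 0" by blast
  have z: "test_function (\<lambda>x. 0)"
    using test_function_lincomb[OF P(1) P(1), of "-1"] by simp
  show ?thesis
  proof
    show "test_function (\<lambda>x. 0 + inverse (LINT x|lebesgue. P x) * P x)"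
      by (rule test_function_lincomb[OF z P(1)])
    show "(LINT x|lebesgue. 0 + inverse (LINT x|lebesgue. P x) * P x) = 1"
      using P test_function_integrable[OF P(1)] by simp
  qed
qed

text \<open>Subtracting (integral of g) * P from \<open>g\<close> leaves mean 0, hence the
  derivative of a test function, which \<open>T\<close> kills. The constant is
  \<open>T P\<close>.\<close>

lemma functional_annihilating_derivatives:
  fixes T :: "(real \<Rightarrow> real) \<Rightarrow> real"
  assumes lin: "\<And>f g c. test_function f \<Longrightarrow> test_function g \<Longrightarrow> T (\<lambda>x. f x + c * g x) = T f + c * T g"
    and z: "\<And>h. test_function h \<Longrightarrow> T (nth_deriv 1 h) = 0"
  obtains c where "\<And>g. test_function g \<Longrightarrow> T g = c * (LINT x|lebesgue. g x)"
proof -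
  obtain P where P: "test_function P" "(LINT x|lebesgue. P x) = 1"
    using exists_normalized_test_function by blast
  show ?thesis
  proof (rule that)
    fix g assume g: "test_function g"
    define I where "I = (LINT x|lebesgue. g x)"
    have t: "test_function (\<lambda>x. g x + (-I) * P x)" by (rule test_function_lincomb[OF g P(1)])
    have "(LINT x|lebesgue. g x + (-I) * P x) = I + (-I) * 1"
      using P(2) test_function_integrable[OF g] test_function_integrable[OF P(1)]
      by (subst Bochner_Integration.integral_add) (auto simp: I_def)
    then obtain h where "test_function h" "nth_deriv 1 h = (\<lambda>x. g x + (-I) * P x)"
      using test_function_primitive[OF t] by auto
    then have "T (\<lambda>x. g x + (-I) * P x) = 0" using z by metis
    then show "T g = T P * I" using lin[OF g P(1), of "-I"] by simp
  qed
qed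

text \<open>The argument of du Bois-Reymond, applied twice.\<close>

lemma weak_second_derivative_zero:
  assumes f: "locally_integrable f"
    and z: "\<And>g. test_function g \<Longrightarrow> (LINT x|lebesgue. f x * nth_deriv 2 g x) = 0"
  obtains \<alpha> \<beta> where "AE x in lebesgue. f x = \<alpha> + \<beta> * x"
proof -
  have int: "integrable lebesgue (\<lambda>x. h x * g x)" if "locally_integrable h" "test_function g" for h g :: "real \<Rightarrow> real"
    using test_function_supportE[OF that(2)] locally_integrable_times_compact_support(1)[OF that(1) smooth_continuous_on]
      that(2) unfolding test_function_def by metis
  have lin: "(LINT x|lebesgue. k x * (g x + c * h x)) = (LINT x|lebesgue. k x * g x) + c * (LINT x|lebesgue. k x * h x)"
    if "locally_integrable k" "test_function g" "test_function h" for g h c and k :: "real \<Rightarrow> real"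
  proof -
    have "(LINT x|lebesgue. k x * (g x + c * h x)) = (LINT x|lebesgue. k x * g x + c * (k x * h x))"
      by (simp add: algebra_simps)
    also have "\<dots> = (LINT x|lebesgue. k x * g x) + c * (LINT x|lebesgue. k x * h x)"
      using int[OF that(1,2)] int[OF that(1,3)] by simp
    finally show ?thesis .
  qed
  define T where "T = (\<lambda>h. LINT x|lebesgue. f x * nth_deriv 1 h x)"
  have "\<exists>c. \<forall>g. test_function g \<longrightarrow> T g = c * (LINT x|lebesgue. g x)"
  proof (rule functional_annihilating_derivatives[of T])
    fix g h :: "real \<Rightarrow> real" and c assume t: "test_function g" "test_function h"
    have "nth_deriv 1 (\<lambda>x. g x + c * h x) = (\<lambda>x. nth_deriv 1 g x + c * nth_deriv 1 h x)"
      using smooth_lincomb(2) t unfolding test_function_def by blast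
    then show "T (\<lambda>x. g x + c * h x) = T g + c * T h"
      unfolding T_def using lin[OF f test_function_nth_deriv_1[OF t(1)] test_function_nth_deriv_1[OF t(2)]]
      by simp
  next
    fix h :: "real \<Rightarrow> real" assume "test_function h"
    moreover have "nth_deriv 1 (nth_deriv 1 h) = nth_deriv 2 h"
      by (metis nth_deriv_Suc_shift Suc_1)
    ultimately show "T (nth_deriv 1 h) = 0" unfolding T_def using z by simp
  qed blast
  then obtain c where c: "\<And>g. test_function g \<Longrightarrow> T g = c * (LINT x|lebesgue. g x)" by blast
  have xloc: "locally_integrable (\<lambda>x::real. x)" by (intro locally_integrable_continuous continuous_intros)
  \<comment> \<open>The integral of x h' is minus that of h, so adding c x to \<open>f\<close>
    cancels the constant just found, and the new function annihilates all derivatives.\<close>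
  have f2: "locally_integrable (\<lambda>x. f x + c * x)" by (rule locally_integrable_lincomb[OF f xloc])
  have "\<exists>d. \<forall>g. test_function g \<longrightarrow> (LINT x|lebesgue. (f x + c * x) * g x) = d * (LINT x|lebesgue. g x)"
  proof (rule functional_annihilating_derivatives[of "\<lambda>g. LINT x|lebesgue. (f x + c * x) * g x"])
    fix h :: "real \<Rightarrow> real" assume h: "test_function h"
    obtain R where R: "R > 0" "\<And>x. \<bar>x\<bar> \<ge> R \<Longrightarrow> h x = 0" "\<And>x. \<bar>x\<bar> \<ge> R \<Longrightarrow> nth_deriv 1 h x = 0"
    proof -
      obtain R1 R2 where "R1 > 0" "\<And>x. \<bar>x\<bar> \<ge> R1 \<Longrightarrow> h x = 0" "R2 > 0" "\<And>x. \<bar>x\<bar> \<ge> R2 \<Longrightarrow> nth_deriv 1 h x = 0"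
        using test_function_supportE[OF h] test_function_supportE[OF test_function_nth_deriv_1[OF h]] by metis
      then show ?thesis using that[of "max R1 R2"] by auto
    qed
    have sm: "smooth h" "smooth (nth_deriv 1 h)"
      using h test_function_nth_deriv_1[OF h] by (auto simp: test_function_def)
    have "(LINT x|lebesgue. h x + x * nth_deriv 1 h x) = 0"
    proof (rule LINT_derivative_compact_support[where h = "\<lambda>x. x * h x" and R = R])
      show "((\<lambda>x. x * h x) has_vector_derivative h x + x * nth_deriv 1 h x) (at x)" for x
        using smooth_has_derivative[OF sm(1), of x]
        by (auto simp flip: has_real_derivative_iff_has_vector_derivative intro!: derivative_eq_intros)
      show "continuous_on UNIV (\<lambda>x. h x + x * nth_deriv 1 h x)"
        using sm by (intro continuous_intros smooth_continuous_on)
    qed (use R in auto)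
    moreover have "(LINT x|lebesgue. h x + x * nth_deriv 1 h x) =
        (LINT x|lebesgue. h x) + (LINT x|lebesgue. x * nth_deriv 1 h x)"
      using int[OF xloc test_function_nth_deriv_1[OF h]] test_function_integrable[OF h] by simp
    moreover have "(LINT x|lebesgue. (f x + c * x) * nth_deriv 1 h x) =
        (LINT x|lebesgue. f x * nth_deriv 1 h x) + c * (LINT x|lebesgue. x * nth_deriv 1 h x)"
      using int[OF f test_function_nth_deriv_1[OF h]] int[OF xloc test_function_nth_deriv_1[OF h]]
      by (simp add: distrib_right mult.assoc)
    ultimately show "(LINT x|lebesgue. (f x + c * x) * nth_deriv 1 h x) = 0"
      using c[OF h] unfolding T_def by (metis distrib_left mult_zero_right)
  next
    fix g h :: "real \<Rightarrow> real" and k assume "test_function g" "test_function h"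
    then show "(LINT x|lebesgue. (f x + c * x) * (g x + k * h x)) =
      (LINT x|lebesgue. (f x + c * x) * g x) + k * (LINT x|lebesgue. (f x + c * x) * h x)"
      by (rule lin[OF f2])
  qed blast
  then obtain d where d: "\<And>g. test_function g \<Longrightarrow>
    (LINT x|lebesgue. (f x + c * x) * g x) = d * (LINT x|lebesgue. g x)" by blast
  have "AE x in lebesgue. (f x + c * x) + (-d) * 1 = 0"
  proof (rule fundamental_lemma_calculus_of_variations)
    show "locally_integrable (\<lambda>x. (f x + c * x) + (-d) * 1)"
      by (intro locally_integrable_lincomb[OF f2] locally_integrable_continuous continuous_intros)
    fix g :: "real \<Rightarrow> real" assume g: "test_function g"
    have "(LINT x|lebesgue. ((f x + c * x) + (-d) * 1) * g x) =
      (LINT x|lebesgue. (f x + c * x) * g x + (- d) * g x)"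
      by (simp add: algebra_simps)
    also have "\<dots> = (LINT x|lebesgue. (f x + c * x) * g x) + (- d) * (LINT x|lebesgue. g x)"
      using int[OF f2 g] test_function_integrable[OF g] by simp
    finally show "(LINT x|lebesgue. ((f x + c * x) + (-d) * 1) * g x) = 0" using d[OF g] by simp
  qed
  then have "AE x in lebesgue. f x = d + (-c) * x"
    by eventually_elim (simp add: algebra_simps)
  then show ?thesis using that by blast
qed

text \<open>Integrating Q \<theta> twice gives a function \<Theta> with the same weak second
  derivative as \<theta>, so the two differ by an affine function almost everywhere. The second
  derivative of \<open>p\<close> is only recorded in integrated form, since \<open>Q\<close> may be
  discontinuous.\<close>

lemma weak_solution_regularity:
  assumes \<theta>: "locally_integrable \<theta>" and Q\<theta>: "locally_integrable (\<lambda>x. Q x * \<theta> x)"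
    and weak: "\<And>g. test_function g \<Longrightarrow>
      (LINT x|lebesgue. \<theta> x * nth_deriv 2 g x) = (LINT x|lebesgue. Q x * \<theta> x * g x)"
  obtains p p' where "AE x in lebesgue. \<theta> x = p x" "\<And>x. (p has_real_derivative p' x) (at x)"
    "\<And>x y. x \<le> y \<Longrightarrow> ((\<lambda>t. Q t * p t) has_integral (p' y - p' x)) {x..y}"
proof -
  let ?G = "\<lambda>x. Q x * \<theta> x"
  obtain K where K: "\<And>x y. x \<le> y \<Longrightarrow> (?G has_integral (K y - K x)) {x..y}" and cK: "continuous_on UNIV K"
    using locally_integrable_primitive[OF Q\<theta>] by blast
  obtain \<Theta> where \<Theta>: "\<And>x. (\<Theta> has_real_derivative K x) (at x)"
    using continuous_has_primitive[OF cK] by blast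
  have c\<Theta>: "continuous_on A \<Theta>" for A
    using \<Theta> by (meson DERIV_continuous_on has_field_derivative_at_within)
  have l\<Theta>: "locally_integrable \<Theta>" by (rule locally_integrable_continuous[OF c\<Theta>])
  have "(LINT x|lebesgue. (\<theta> x + (-1) * \<Theta> x) * nth_deriv 2 g x) = 0" if g: "test_function g" for g
  proof -
    have d2: "nth_deriv 1 (nth_deriv 1 g) = nth_deriv 2 g" by (metis nth_deriv_Suc_shift Suc_1)
    have g1: "test_function (nth_deriv 1 g)" and g2: "test_function (nth_deriv 2 g)"
      using test_function_nth_deriv_1 g d2 by metis+
    obtain R where R: "R > 0" "\<And>x. \<bar>x\<bar> \<ge> R \<Longrightarrow> g x = 0" "\<And>x. \<bar>x\<bar> \<ge> R \<Longrightarrow> nth_deriv 1 g x = 0"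
        "\<And>x. \<bar>x\<bar> \<ge> R \<Longrightarrow> nth_deriv 2 g x = 0"
    proof -
      obtain R1 R2 R3 where "R1 > 0" "\<And>x. \<bar>x\<bar> \<ge> R1 \<Longrightarrow> g x = 0" "R2 > 0" "\<And>x. \<bar>x\<bar> \<ge> R2 \<Longrightarrow> nth_deriv 1 g x = 0"
         "R3 > 0" "\<And>x. \<bar>x\<bar> \<ge> R3 \<Longrightarrow> nth_deriv 2 g x = 0"
        using test_function_supportE[OF g] test_function_supportE[OF g1] test_function_supportE[OF g2] by metis
      then show ?thesis using that[of "max R1 (max R2 R3)"] by auto
    qed
    have sm: "smooth g" "smooth (nth_deriv 1 g)" "smooth (nth_deriv 2 g)"
      using g g1 g2 by (auto simp: test_function_def)
    have dg: "(g has_real_derivative nth_deriv 1 g x) (at x within A)"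
         "(nth_deriv 1 g has_real_derivative nth_deriv 2 g x) (at x within A)" for x A
      using smooth_has_derivative[OF sm(1)] smooth_has_derivative[OF sm(2)] d2
      by (auto simp: has_real_derivative_iff_has_vector_derivative has_vector_derivative_at_within)
    have i1: "((\<lambda>t. ?G t * g t + K t * nth_deriv 1 g t) has_integral (K R * g R - K (-R) * g (-R))) {-R..R}"
      using Q\<theta> R(1) by (intro integration_by_parts_primitive K dg smooth_continuous_on sm)
        (auto simp: locally_integrable_def)
    have i2: "((\<lambda>t. K t * nth_deriv 1 g t + \<Theta> t * nth_deriv 2 g t) has_integral
        (\<Theta> R * nth_deriv 1 g R - \<Theta> (-R) * nth_deriv 1 g (-R))) {-R..R}"
    proof -
      have "((\<lambda>t. \<Theta> t * nth_deriv 1 g t) has_vector_derivative (K x * nth_deriv 1 g x + \<Theta> x * nth_deriv 2 g x))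
          (at x within {-R..R})" for x
        using DERIV_mult[OF has_field_derivative_at_within[OF \<Theta>[of x], of "{-R..R}"] dg(2)[of x "{-R..R}"]]
        unfolding has_real_derivative_iff_has_vector_derivative by (simp add: mult.commute add.commute)
      then show ?thesis using R(1) by (intro fundamental_theorem_of_calculus) auto
    qed
    have "((\<lambda>t. \<Theta> t * nth_deriv 2 g t - ?G t * g t) has_integral 0) {-R..R}"
      using has_integral_diff[OF i2 i1] R(2,3)[of R] R(2,3)[of "-R"] R(1)
      by (simp add: algebra_simps)
    then have e0: "integral {-R..R} (\<lambda>t. \<Theta> t * nth_deriv 2 g t - ?G t * g t) = 0" by (rule integral_unique)
    note A = locally_integrable_times_compact_support[OF l\<Theta> smooth_continuous_on[OF sm(3)] R(4)]
      and B = locally_integrable_times_compact_support[OF Q\<theta> smooth_continuous_on[OF sm(1)] R(2)]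
      and C = locally_integrable_times_compact_support[OF \<theta> smooth_continuous_on[OF sm(3)] R(4)]
    have "(LINT x|lebesgue. \<Theta> x * nth_deriv 2 g x) - (LINT x|lebesgue. ?G x * g x)
        = (LINT x|lebesgue. (\<Theta> x * nth_deriv 2 g x - ?G x * g x) * 1)"
      using A(1) B(1) by simp
    also have "\<dots> = 0"
    proof -
      have "integral UNIV (\<lambda>x. \<Theta> x * nth_deriv 2 g x - ?G x * g x) = 0"
      proof (rule integral_unique, rule has_integral_on_superset)
        show "((\<lambda>t. \<Theta> t * nth_deriv 2 g t - ?G t * g t) has_integral 0) {-R..R}" by fact
        show "\<And>x. x \<notin> {- R..R} \<Longrightarrow> \<Theta> x * nth_deriv 2 g x - Q x * \<theta> x * g x = 0"
        proof -
          fix x assume "x \<notin> {- R..R}"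
          then have "\<bar>x\<bar> \<ge> R" by auto
          then show "\<Theta> x * nth_deriv 2 g x - Q x * \<theta> x * g x = 0" using R by simp
        qed
      qed auto
      then show ?thesis using A(1) B(1) by (simp add: integral_lebesgue)
    qed
    finally have "(LINT x|lebesgue. \<Theta> x * nth_deriv 2 g x) = (LINT x|lebesgue. \<theta> x * nth_deriv 2 g x)"
      using weak[OF g] by simp
    then show ?thesis using A(1) C(1) by (simp add: left_diff_distrib)
  qed
  then obtain \<alpha> \<beta> where ae: "AE x in lebesgue. \<theta> x + (-1) * \<Theta> x = \<alpha> + \<beta> * x"
    using weak_second_derivative_zero[OF locally_integrable_lincomb[OF \<theta> l\<Theta>]] by blast
  define p where "p = (\<lambda>x. \<Theta> x + \<alpha> + \<beta> * x)"
  have aep: "AE x in lebesgue. \<theta> x = p x" using ae by eventually_elim (simp add: p_def)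
  obtain N where N: "negligible N" "{x. \<theta> x \<noteq> p x} \<subseteq> N"
    using aep unfolding eventually_ae_filter_negligible by blast
  show ?thesis
  proof (rule that[of p "\<lambda>x. K x + \<beta>", OF aep])
    show "(p has_real_derivative K x + \<beta>) (at x)" for x
      unfolding p_def using \<Theta>[of x] by (auto intro!: derivative_eq_intros)
    \<comment> \<open>Replacing \<theta> by \<open>p\<close> under the integral changes the
      integrand only on a negligible set.\<close>
    show "((\<lambda>t. Q t * p t) has_integral (K y + \<beta> - (K x + \<beta>))) {x..y}" if "x \<le> y" for x y
    proof -
      have "p t = \<theta> t" if "t \<notin> N" for t using N(2) that by force
      then show ?thesis
        unfolding add_diff_cancel_right by (intro has_integral_spike[OF N(1) _ K[OF that]]) auto
    qed
  qed
qed

section \<open>The Cauchy-Pompeiu inequality\<close>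

text \<open>The Wirtinger derivatives: \<open>a\<close> stands for $\partial f(z)$ and \<open>b\<close> for $\bar\partial f(z)$.\<close>

definition has_wirtinger :: "(complex \<Rightarrow> complex) \<Rightarrow> complex \<Rightarrow> complex \<Rightarrow> complex \<Rightarrow> bool" where
  "has_wirtinger f a b z \<longleftrightarrow> (f has_derivative (\<lambda>h. a * h + b * cnj h)) (at z)"

lemma has_wirtinger_holomorphic: "(f has_field_derivative a) (at z) \<Longrightarrow> has_wirtinger f a 0 z"
  unfolding has_wirtinger_def has_field_derivative_def by simp

lemma has_wirtinger_cnj: "has_wirtinger cnj 0 1 z"
  unfolding has_wirtinger_def by (auto intro!: derivative_eq_intros)

lemma has_wirtinger_add:
  "has_wirtinger f a b z \<Longrightarrow> has_wirtinger g a' b' z \<Longrightarrow> has_wirtinger (\<lambda>z. f z + g z) (a + a') (b + b') z"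
  unfolding has_wirtinger_def by (auto intro!: derivative_eq_intros simp: algebra_simps)

lemma has_wirtinger_diff:
  "has_wirtinger f a b z \<Longrightarrow> has_wirtinger g a' b' z \<Longrightarrow> has_wirtinger (\<lambda>z. f z - g z) (a - a') (b - b') z"
  unfolding has_wirtinger_def by (auto intro!: derivative_eq_intros simp: algebra_simps)

lemma has_wirtinger_mult:
  "has_wirtinger f a b z \<Longrightarrow> has_wirtinger g a' b' z \<Longrightarrow>
    has_wirtinger (\<lambda>z. f z * g z) (a * g z + f z * a') (b * g z + f z * b') z"
  unfolding has_wirtinger_def by (auto intro!: derivative_eq_intros simp: algebra_simps)

lemma has_wirtinger_compose_holomorphic:
  assumes "has_wirtinger f a b z" "(g has_field_derivative d) (at (f z))"
  shows "has_wirtinger (\<lambda>z. g (f z)) (d * a) (d * b) z"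
  using has_derivative_compose[OF assms(1)[unfolded has_wirtinger_def] assms(2)[unfolded has_field_derivative_def]]
  unfolding has_wirtinger_def by (simp add: algebra_simps)

lemma has_wirtinger_curve:
  assumes "has_wirtinger f a b (g t)" "(g has_vector_derivative v) (at t within A)"
  shows "((\<lambda>t. f (g t)) has_vector_derivative (a * v + b * cnj v)) (at t within A)"
  using has_derivative_compose[OF assms(2)[unfolded has_vector_derivative_def] assms(1)[unfolded has_wirtinger_def]]
  unfolding has_vector_derivative_def by (simp add: algebra_simps)

lemma has_wirtinger_continuous_on:
  "(\<And>z. z \<in> A \<Longrightarrow> has_wirtinger f (a z) (b z) z) \<Longrightarrow> continuous_on A f"
  unfolding has_wirtinger_def
  by (meson continuous_at_imp_continuous_on has_derivative_continuous)

text \<open>The circle is contracted to \<open>w\<close> along \<open>w + t * (\<zeta> - w)\<close>; the derivative in \<open>t\<close> of the Cauchy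
  integral only sees $\bar\partial S$, because $\oint \partial S\,d\zeta = - \oint \bar\partial S\,d\bar\zeta$
  on a closed curve.\<close>

lemma cauchy_pompeiu_bound:
  assumes r: "r > 0" and S: "\<And>z. z \<in> cball c r \<Longrightarrow> has_wirtinger S (a z) (b z) z"
    and ca: "continuous_on (cball c r) a" and cb: "continuous_on (cball c r) b"
    and \<beta>: "\<And>z. z \<in> cball c r \<Longrightarrow> norm (b z) \<le> \<beta>" and w: "w \<in> ball c r"
  shows "norm (contour_integral (circlepath c r) (\<lambda>u. S u / (u - w)) - 2 * of_real pi * \<i> * S w) \<le> 4 * pi * r * \<beta>"
proof -
  have \<beta>0: "0 \<le> \<beta>" using order_trans[OF norm_ge_zero \<beta>[of c]] r by simp
  define \<zeta> where "\<zeta> = circlepath c r"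
  define v where "v = (\<lambda>x::real. 2 * of_real pi * \<i> * of_real r * exp (2 * of_real pi * \<i> * of_real x))"
  have \<zeta>v: "(\<zeta> has_vector_derivative v x) (at x within A)" for x A
    using has_vector_derivative_circlepath[of c r x A] unfolding \<zeta>_def v_def by (simp add: mult_ac)
  have c\<zeta>: "continuous_on A \<zeta>" for A
    using \<zeta>v by (meson continuous_on_vector_derivative)
  have cv: "continuous_on A v" for A unfolding v_def by (intro continuous_intros)
  have nv: "norm (v x) = 2 * pi * r" for x using r by (simp add: v_def norm_mult)
  have \<zeta>s: "\<zeta> x \<in> sphere c r" for x
    using r by (simp add: \<zeta>_def circlepath dist_norm norm_mult)
  have ne: "\<zeta> x - w \<noteq> 0" for x using \<zeta>s[of x] w by auto
  define p where "p = (\<lambda>t x. w + of_real t * (\<zeta> x - w))"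
  have pin: "p t x \<in> cball c r" if "t \<in> {0..1}" for t x
  proof -
    have "w + t *\<^sub>R (\<zeta> x - w) \<in> cball c r"
      using convexD_alt[of "cball c r" w "\<zeta> x" t] w \<zeta>s[of x] that
      by (simp add: algebra_simps)
    then show ?thesis by (simp add: p_def scaleR_conv_of_real)
  qed
  have cS: "continuous_on (cball c r) S" using S by (rule has_wirtinger_continuous_on)
  define F where "F = (\<lambda>t x. S (p t x) * v x / (\<zeta> x - w))"
  define F' where "F' = (\<lambda>t x. (a (p t x) * (\<zeta> x - w) + b (p t x) * cnj (\<zeta> x - w)) * v x / (\<zeta> x - w))"
  \<comment> \<open>\<open>J 1\<close> is the Cauchy integral over the circle. \<open>J 0\<close> is
    2 pi i S(w), because \<open>p 0\<close> is constantly \<open>w\<close>. The lemma estimates the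
    difference through the derivative in t.\<close>
  define J where "J = (\<lambda>t. integral (cbox 0 1) (F t))"
  have cp: "continuous_on ({0..1} \<times> cbox 0 1) (\<lambda>(t, x). p t x)"
    unfolding p_def case_prod_unfold
    by (intro continuous_intros continuous_on_compose2[OF c\<zeta>[of UNIV]]) auto
  have cp1: "continuous_on (cbox 0 1) (p t)" for t
    unfolding p_def by (intro continuous_intros c\<zeta>)
  have Fint: "F t integrable_on cbox 0 1" if t: "t \<in> {0..1}" for t
    unfolding F_def
    by (intro integrable_continuous continuous_intros cv c\<zeta> continuous_on_compose2[OF cS cp1])
       (use pin[OF t] ne in auto)
  have cF': "continuous_on ({0..1} \<times> cbox 0 1) (\<lambda>(t, x). F' t x)"
  proof -
    have 1: "continuous_on ({0..1} \<times> cbox 0 1) (\<lambda>z. a (p (fst z) (snd z)))"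
      "continuous_on ({0..1} \<times> cbox 0 1) (\<lambda>z. b (p (fst z) (snd z)))"
      by (rule continuous_on_compose2[OF ca cp[unfolded case_prod_unfold]]
          continuous_on_compose2[OF cb cp[unfolded case_prod_unfold]]; use pin in auto)+
    have 2: "continuous_on ({0..1} \<times> cbox 0 1) (\<lambda>z. \<zeta> (snd z))" "continuous_on ({0..1} \<times> cbox 0 1) (\<lambda>z. v (snd z))"
      by (rule continuous_on_compose2[OF c\<zeta>[of UNIV]] continuous_on_compose2[OF cv[of UNIV]]; auto intro!: continuous_intros)+
    show ?thesis unfolding F'_def case_prod_unfold
      by (intro continuous_intros 1 2) (use ne in auto)
  qed
  have Jd: "(J has_vector_derivative integral (cbox 0 1) (F' t)) (at t within {0..1})" if t: "t \<in> {0..1}" for t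
    unfolding J_def
  proof (rule leibniz_rule_vector_derivative[OF _ Fint cF' t])
    fix t x :: real assume t: "t \<in> {0..1}" and x: "x \<in> cbox 0 1"
    have "((\<lambda>t. p t x) has_vector_derivative (\<zeta> x - w)) (at t within {0..1})"
      unfolding p_def by (auto intro!: derivative_eq_intros)
    from has_wirtinger_curve[OF S[OF pin[OF t]] this]
    have "((\<lambda>t. S (p t x)) has_vector_derivative a (p t x) * (\<zeta> x - w) + b (p t x) * cnj (\<zeta> x - w))
        (at t within {0..1})" .
    from has_vector_derivative_mult_left[OF this, of "v x / (\<zeta> x - w)"]
    show "((\<lambda>t. F t x) has_vector_derivative F' t x) (at t within {0..1})"
      by (simp add: F_def F'_def)
  qed auto
  \<comment> \<open>The value t = 0 is left out because the closed-curve identity below carries a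
    factor t that is divided away; the mean value estimate only uses interior t.\<close>
  have bound: "norm (integral (cbox 0 1) (F' t)) \<le> 4 * pi * r * \<beta>" if t: "t \<in> {0<..1}" for t
  proof -
    have t': "t \<in> {0..1}" using t by auto
    have ca1: "continuous_on (cbox 0 1) (\<lambda>x. a (p t x))" "continuous_on (cbox 0 1) (\<lambda>x. b (p t x))"
      by (rule continuous_on_compose2[OF ca cp1] continuous_on_compose2[OF cb cp1]; use pin[OF t'] in auto)+
    have "((\<lambda>x. S (p t x)) has_vector_derivative
        a (p t x) * (of_real t * v x) + b (p t x) * cnj (of_real t * v x)) (at x within {0..1})" for x
    proof (rule has_wirtinger_curve[where g = "p t" and t = x, OF S[OF pin[OF t']]])
      show "(p t has_vector_derivative complex_of_real t * v x) (at x within {0..1})"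
        unfolding p_def by (auto intro!: derivative_eq_intros \<zeta>v)
    qed
    then have "((\<lambda>x. a (p t x) * (of_real t * v x) + b (p t x) * cnj (of_real t * v x)) has_integral
        (S (p t 1) - S (p t 0))) {0..1}"
      by (intro fundamental_theorem_of_calculus) auto
    moreover have "p t 1 = p t 0" unfolding p_def \<zeta>_def by (simp add: circlepath)
    ultimately have "((\<lambda>x. a (p t x) * (of_real t * v x) + b (p t x) * cnj (of_real t * v x)) has_integral 0) (cbox 0 1)"
      by simp
    from has_integral_mult_right[OF this, of "1 / of_real t"]
    have z: "((\<lambda>x. a (p t x) * v x + b (p t x) * cnj (v x)) has_integral 0) (cbox 0 1)"
    proof -
      have "1 / complex_of_real t * (a (p t x) * (of_real t * v x) + b (p t x) * cnj (of_real t * v x)) =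
          a (p t x) * v x + b (p t x) * cnj (v x)" for x
        using t by (simp add: field_simps)
      then show ?thesis using \<open>(_ has_integral 1 / complex_of_real t * 0) _\<close> by (simp only: mult_zero_right)
    qed
    have iF: "F' t integrable_on cbox 0 1"
      unfolding F'_def by (intro integrable_continuous continuous_intros ca1 c\<zeta> cv) (use ne in auto)
    \<comment> \<open>Subtracting the vanishing integral removes every occurrence of
      \<open>a\<close>; what remains is \<open>b\<close> times two terms of modulus at most 2 pi r
      each.\<close>
    have eq: "F' t x - (a (p t x) * v x + b (p t x) * cnj (v x)) =
        b (p t x) * (cnj (\<zeta> x - w) * v x / (\<zeta> x - w) - cnj (v x))" for x
      using ne[of x] by (simp add: F'_def field_simps)
    have "((\<lambda>x. b (p t x) * (cnj (\<zeta> x - w) * v x / (\<zeta> x - w) - cnj (v x))) has_integral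
        integral (cbox 0 1) (F' t)) (cbox 0 1)"
      using has_integral_diff[OF integrable_integral[OF iF] z] unfolding eq by simp
    moreover have "norm (b (p t x) * (cnj (\<zeta> x - w) * v x / (\<zeta> x - w) - cnj (v x))) \<le> \<beta> * (4 * pi * r)" for x
    proof -
      have "norm (cnj (\<zeta> x - w) * v x / (\<zeta> x - w) - cnj (v x)) \<le>
          norm (cnj (\<zeta> x - w) * v x / (\<zeta> x - w)) + norm (cnj (v x))"
        by (rule norm_triangle_ineq4)
      also have "norm (cnj (\<zeta> x - w) * v x / (\<zeta> x - w)) = norm (v x)"
        using ne[of x] complex_mod_cnj[of "\<zeta> x - w"] by (simp add: norm_mult norm_divide del: complex_mod_cnj complex_cnj_diff)
      finally have "norm (cnj (\<zeta> x - w) * v x / (\<zeta> x - w) - cnj (v x)) \<le> 4 * pi * r"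
        using nv[of x] by simp
      then show ?thesis unfolding norm_mult[of "b (p t x)"]
        by (intro mult_mono \<beta>[OF pin[OF t']] \<beta>0) auto
    qed
    moreover have "0 \<le> \<beta> * (4 * pi * r)"
      using r \<beta>0 by simp
    ultimately have "norm (integral (cbox 0 1) (F' t)) \<le> \<beta> * (4 * pi * r) * measure lborel (cbox (0::real) 1)"
      by (intro has_integral_bound) auto
    then show ?thesis by (simp add: mult_ac)
  qed
  have "norm (J 1 - J 0) \<le> 4 * pi * r * \<beta> * 1 - 4 * pi * r * \<beta> * 0"
  proof (rule differentiable_bound_general[where f' = "\<lambda>t. integral (cbox 0 1) (F' t)" and \<phi>' = "\<lambda>_. 4 * pi * r * \<beta>"])
    show "continuous_on {0..1} J" by (rule continuous_on_vector_derivative[OF Jd])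
    show "(J has_vector_derivative integral (cbox 0 1) (F' t)) (at t)" if "0 < t" "t < 1" for t
      using Jd[of t] that at_within_interior[of t "{0..1}"] by simp
    show "continuous_on {0..1} (\<lambda>t. 4 * pi * r * \<beta> * t)" by (intro continuous_intros)
    show "((\<lambda>t. 4 * pi * r * \<beta> * t) has_vector_derivative 4 * pi * r * \<beta>) (at t)" for t
      by (auto intro!: derivative_eq_intros)
    show "norm (integral (cbox 0 1) (F' t)) \<le> 4 * pi * r * \<beta>" if "0 < t" "t < 1" for t
      by (rule bound) (use that in auto)
  qed simp
  moreover have "J 1 = contour_integral (circlepath c r) (\<lambda>u. S u / (u - w))"
  proof -
    have "vector_derivative (circlepath c r) (at x) = v x" for x
      using \<zeta>v[of x UNIV] unfolding \<zeta>_def by (simp add: vector_derivative_at)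
    then show ?thesis
      unfolding contour_integral_integral J_def F_def p_def \<zeta>_def by simp
  qed
  moreover have "J 0 = 2 * of_real pi * \<i> * S w"
  proof -
    have vd: "vector_derivative (circlepath c r) (at x) = v x" for x
      using \<zeta>v[of x UNIV] unfolding \<zeta>_def by (simp add: vector_derivative_at)
    have "((\<lambda>u. S w / (u - w)) has_contour_integral (2 * of_real pi * \<i> * S w)) (circlepath c r)"
      using Cauchy_integral_circlepath_simple[of "\<lambda>_. S w" c r w] w by (auto simp: dist_norm norm_minus_commute)
    then have "contour_integral (circlepath c r) (\<lambda>u. S w / (u - w)) = 2 * of_real pi * \<i> * S w"
      by (rule contour_integral_unique)
    then show ?thesis
      unfolding contour_integral_integral vd J_def F_def p_def \<zeta>_def by simp
  qed
  ultimately show ?thesis by simp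
qed

lemma holomorphic_cauchy_transform:
  assumes "continuous_on (sphere c r) S" and "r > 0"
  shows "(\<lambda>w. contour_integral (circlepath c r) (\<lambda>u. S u / (u - w))) holomorphic_on ball c r"
proof -
  have pi: "path_image (circlepath c r) = sphere c r" using assms by simp
  have int: "((\<lambda>u. S u / (u - w) ^ 1) has_contour_integral contour_integral (circlepath c r) (\<lambda>u. S u / (u - w)))
     (circlepath c r)" if "w \<in> ball c r" for w
  proof -
    have "(\<lambda>u. S u / (u - w)) contour_integrable_on circlepath c r"
      by (intro contour_integrable_continuous_circlepath continuous_intros)
         (use assms that in \<open>auto simp: pi\<close>)
    then show ?thesis by (simp add: has_contour_integral_integral)
  qed
  then have "\<exists>d. ((\<lambda>w. contour_integral (circlepath c r) (\<lambda>u. S u / (u - w))) has_field_derivative d) (at w)"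
    if "w \<in> ball c r" for w
    using Cauchy_next_derivative_circlepath(2)[OF assms(1)[folded pi] int one_neq_zero that] by blast
  then show ?thesis
    by (intro holomorphic_onI) (meson field_differentiable_def field_differentiable_at_within)
qed

text \<open>The holomorphic function is the Cauchy integral of \<open>S\<close> over the circle.
  Used in two ways: to correct a solution of a d-bar equation by a holomorphic function so that it
  becomes small, and to replace a function with small d-bar derivative by a holomorphic one.\<close>

lemma near_holomorphic:
  assumes r: "r > 0" and S: "\<And>z. z \<in> cball c r \<Longrightarrow> has_wirtinger S (a z) (b z) z"
    and ca: "continuous_on (cball c r) a" and cb: "continuous_on (cball c r) b"
    and \<beta>: "\<And>z. z \<in> cball c r \<Longrightarrow> norm (b z) \<le> \<beta>"
  shows "\<exists>K. K holomorphic_on ball c r \<and> (\<forall>w\<in>ball c r. norm (S w - K w) \<le> 2 * r * \<beta>)"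
proof (intro exI conjI ballI)
  let ?I = "\<lambda>w. contour_integral (circlepath c r) (\<lambda>u. S u / (u - w))"
  have "continuous_on (cball c r) S" using S by (rule has_wirtinger_continuous_on)
  then have "continuous_on (sphere c r) S" by (rule continuous_on_subset) auto
  then show "(\<lambda>w. ?I w / (2 * of_real pi * \<i>)) holomorphic_on ball c r"
    using r by (intro holomorphic_intros holomorphic_cauchy_transform) auto
  fix w assume w: "w \<in> ball c r"
  have "S w - ?I w / (2 * of_real pi * \<i>) = - (?I w - 2 * of_real pi * \<i> * S w) / (2 * of_real pi * \<i>)"
    by (simp add: field_simps)
  also have "norm \<dots> = norm (?I w - 2 * of_real pi * \<i> * S w) / (2 * pi)"
    by (simp add: norm_divide norm_mult norm_minus_commute)
  also have "\<dots> \<le> 4 * pi * r * \<beta> / (2 * pi)"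
    by (intro divide_right_mono cauchy_pompeiu_bound[OF r S ca cb \<beta> w]) auto
  finally show "norm (S w - ?I w / (2 * of_real pi * \<i>)) \<le> 2 * r * \<beta>" by (simp add: mult_ac)
qed

section \<open>The similarity principle\<close>

text \<open>Polynomials in \<open>z\<close> and \<open>cnj z\<close> are represented by bivariate polynomials evaluated at
  \<open>(z, cnj z)\<close>.\<close>

definition bipoly_eval :: "complex poly poly \<Rightarrow> complex \<Rightarrow> complex" where
  "bipoly_eval P z = poly (poly P [:cnj z:]) z"

lemma bipoly_eval_simps:
  "bipoly_eval (P + Q) z = bipoly_eval P z + bipoly_eval Q z"
  "bipoly_eval (P * Q) z = bipoly_eval P z * bipoly_eval Q z"
  "bipoly_eval [:[:c:]:] z = c"
  "bipoly_eval [:[:0, 1:]:] z = z"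
  "bipoly_eval [:0, 1:] z = cnj z"
  "bipoly_eval 0 z = 0"
  "bipoly_eval (pCons p P) z = poly p z + cnj z * bipoly_eval P z"
  by (simp_all add: bipoly_eval_def)

lemma real_polynomial_function_bipoly:
  fixes f :: "complex \<Rightarrow> real"
  assumes "real_polynomial_function f"
  shows "\<exists>P. \<forall>z. of_real (f z) = bipoly_eval P z"
  using assms
proof (induction rule: real_polynomial_function.induct)
  case (linear f)
  interpret bounded_linear f by fact
  obtain \<alpha> \<beta> where f: "\<And>z. f z = Re z * \<alpha> + Im z * \<beta>"
  proof (rule that)
    fix z
    have "z = Re z *\<^sub>R 1 + Im z *\<^sub>R \<i>" by (simp add: complex_eq_iff)
    then have "f z = f (Re z *\<^sub>R 1 + Im z *\<^sub>R \<i>)" by (rule arg_cong)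
    also have "\<dots> = Re z * f 1 + Im z * f \<i>" unfolding add scaleR by simp
    finally show "f z = Re z * f 1 + Im z * f \<i>" .
  qed
  have "of_real (f z) = (of_real \<alpha> - \<i> * of_real \<beta>) / 2 * z + (of_real \<alpha> + \<i> * of_real \<beta>) / 2 * cnj z" for z
    unfolding f by (simp add: complex_eq_iff field_simps)
  then have "of_real (f z) = bipoly_eval ([:[:(of_real \<alpha> - \<i> * of_real \<beta>) / 2:]:] * [:[:0, 1:]:]
      + [:[:(of_real \<alpha> + \<i> * of_real \<beta>) / 2:]:] * [:0, 1:]) z" for z
    by (simp add: bipoly_eval_simps mult.commute)
  then show ?case by blast
next
  case (const c)
  then show ?case using bipoly_eval_simps(3) by metis
next
  case (add f g)
  then show ?case using bipoly_eval_simps(1) by (metis of_real_add)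
next
  case (mult f g)
  then show ?case using bipoly_eval_simps(2) by (metis of_real_mult)
qed

text \<open>Integration in conj z, one coefficient at a time, with z held fixed. The factor
  \<open>cnj z ^ k\<close> is the generalization that lets the induction shift the degree in conj
  z.\<close>

lemma bipoly_antiholomorphic_primitive:
  "\<exists>S a. continuous_on UNIV a \<and> (\<forall>z. has_wirtinger S (a z) (cnj z ^ k * bipoly_eval P z) z)"
proof (induction P arbitrary: k)
  case 0
  have "has_wirtinger (\<lambda>z. 0) 0 0 z" for z by (rule has_wirtinger_holomorphic) auto
  then show ?case
    by (intro exI[of _ "\<lambda>z. 0"]) (auto simp: bipoly_eval_simps)
next
  case (pCons p P)
  obtain S a where Sa: "continuous_on UNIV a" "\<And>z. has_wirtinger S (a z) (cnj z ^ Suc k * bipoly_eval P z) z"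
    using pCons.IH by blast
  have "((\<lambda>w. w ^ Suc k / of_nat (Suc k)) has_field_derivative w ^ k) (at w)" for w :: complex
  proof (rule DERIV_cong[OF DERIV_cdivide[OF DERIV_power_Suc[OF DERIV_ident]]])
    have ne: "(1 + of_nat k :: complex) \<noteq> 0" by (metis of_nat_Suc of_nat_neq_0)
    show "(1 + of_nat k) * (1 * w ^ k) / of_nat (Suc k) = w ^ k"
      by (simp only: mult_1 of_nat_Suc nonzero_mult_div_cancel_left[OF ne])
  qed
  from has_wirtinger_compose_holomorphic[OF has_wirtinger_cnj this]
  have 1: "has_wirtinger (\<lambda>z. cnj z ^ Suc k / of_nat (Suc k)) 0 (cnj z ^ k) z" for z by simp
  have 2: "has_wirtinger (poly p) (poly (pderiv p) z) 0 z" for z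
    by (rule has_wirtinger_holomorphic) (rule poly_DERIV)
  let ?a = "\<lambda>z. poly (pderiv p) z * (cnj z ^ Suc k / of_nat (Suc k)) + a z"
  have "has_wirtinger (\<lambda>z. poly p z * (cnj z ^ Suc k / of_nat (Suc k)) + S z) (?a z)
      (cnj z ^ k * bipoly_eval (pCons p P) z) z" for z
    using has_wirtinger_add[OF has_wirtinger_mult[OF 2 1] Sa(2), of z]
    by (simp add: bipoly_eval_simps algebra_simps)
  moreover have "continuous_on UNIV ?a"
    by (intro continuous_intros Sa(1)) (simp del: of_nat_Suc)
  ultimately show ?case by blast
qed

text \<open>By Stone-Weierstrass \<open>g\<close> is close on \<open>A\<close> to a polynomial in z
  and conj z, for which the d-bar equation is solved exactly and explicitly. This avoids the Cauchy
  transform of a function that is only continuous.\<close>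

lemma approximate_antiholomorphic_primitive:
  assumes A: "compact A" and g: "continuous_on A (g :: complex \<Rightarrow> complex)" and d: "\<delta> > 0"
  shows "\<exists>S a p. continuous_on UNIV a \<and> continuous_on UNIV p \<and> (\<forall>z. has_wirtinger S (a z) (p z) z) \<and>
     (\<forall>z\<in>A. norm (g z - p z) \<le> \<delta>)"
proof -
  obtain u where u: "real_polynomial_function u" "\<And>z. z \<in> A \<Longrightarrow> \<bar>Re (g z) - u z\<bar> < \<delta> / 2"
    by (rule Stone_Weierstrass_real_polynomial_function[OF A, of "\<lambda>z. Re (g z)" "\<delta> / 2"])
       (use g d in \<open>auto intro: continuous_intros\<close>)
  obtain v where v: "real_polynomial_function v" "\<And>z. z \<in> A \<Longrightarrow> \<bar>Im (g z) - v z\<bar> < \<delta> / 2"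
    by (rule Stone_Weierstrass_real_polynomial_function[OF A, of "\<lambda>z. Im (g z)" "\<delta> / 2"])
       (use g d in \<open>auto intro: continuous_intros\<close>)
  obtain P Q where PQ: "\<And>z. of_real (u z) = bipoly_eval P z" "\<And>z. of_real (v z) = bipoly_eval Q z"
    using real_polynomial_function_bipoly u(1) v(1) by metis
  define p where "p = (\<lambda>z. complex_of_real (u z) + \<i> * of_real (v z))"
  have peq: "p z = cnj z ^ 0 * bipoly_eval (P + [:[:\<i>:]:] * Q) z" for z
    unfolding bipoly_eval_simps p_def PQ by simp
  obtain S a where "continuous_on UNIV a" "\<And>z. has_wirtinger S (a z) (p z) z"
    using bipoly_antiholomorphic_primitive[of 0 "P + [:[:\<i>:]:] * Q"] unfolding peq by blast
  moreover have "continuous_on UNIV p"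
    unfolding p_def using u(1) v(1)
    by (intro continuous_intros continuous_on_polymonial_function) (simp_all add: real_polynomial_function_eq)
  moreover have "norm (g z - p z) \<le> \<delta>" if "z \<in> A" for z
  proof -
    have "norm (g z - p z) \<le> \<bar>Re (g z - p z)\<bar> + \<bar>Im (g z - p z)\<bar>" by (rule cmod_le)
    then show ?thesis using u(2)[OF that] v(2)[OF that] by (simp add: p_def)
  qed
  ultimately show ?thesis by blast
qed

text \<open>The similarity principle of Bers and Vekua for $\bar\partial W = k \overline{W}$, up to an
  arbitrarily small error.  The quotient \<open>cnj W / W\<close> is regularized to a continuous function
  which is then approximated by a polynomial.\<close>

lemma approximate_similarity_principle:
  assumes r: "0 < r" "r < R" and W: "\<And>z. z \<in> cball c R \<Longrightarrow> has_wirtinger W (a z) (k z * cnj (W z)) z"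
    and ca: "continuous_on (cball c R) a" and ck: "continuous_on (cball c R) k"
    and m: "\<And>z. z \<in> cball c R \<Longrightarrow> norm (k z) \<le> m" and \<eta>: "\<eta> > 0"
  shows "\<exists>s H. H holomorphic_on ball c r \<and>
    (\<forall>z\<in>ball c r. norm (s z) \<le> 2 * R * m + 1 \<and> norm (W z * exp (- s z) - H z) \<le> \<eta>)"
proof -
  have R: "R > 0" using r by simp
  have m0: "m \<ge> 0" using order_trans[OF norm_ge_zero m[of c]] R by simp
  have cW: "continuous_on (cball c R) W" using W by (rule has_wirtinger_continuous_on)
  then have "bounded (W ` cball c R)" by (intro compact_imp_bounded compact_continuous_image) auto
  then obtain B where B: "B > 0" "\<And>z. z \<in> cball c R \<Longrightarrow> norm (W z) \<le> B"
    unfolding bounded_pos by auto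
  \<comment> \<open>The final bound for |s|: 2 R m from the size of the right-hand side, and 1 for
    the approximation error, by 2 R \<delta> \<le> 1.\<close>
  define \<sigma> where "\<sigma> = 2 * R * m + 1"
  \<comment> \<open>Chosen so that exp \<sigma> times 2 \<theta> is \<eta> / (2 R); then
    \<open>near_holomorphic\<close> returns an error of at most \<eta>.\<close>
  define \<theta> where "\<theta> = \<eta> / (4 * R * exp \<sigma>)"
  have \<theta>: "\<theta> > 0" using \<eta> R by (simp add: \<theta>_def)
  define \<epsilon> where "\<epsilon> = \<theta> / (m + 1)"
  have \<epsilon>: "\<epsilon> > 0" "m * \<epsilon> \<le> \<theta>" using \<theta> m0 by (auto simp: \<epsilon>_def field_simps)
  \<comment> \<open>The first entry pays for the summand 1 in \<sigma>; the second makes the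
    approximation error times |W| at most \<theta>.\<close>
  define \<delta> where "\<delta> = min (1 / (2 * R)) (\<theta> / B)"
  have \<delta>: "\<delta> > 0" "\<delta> * B \<le> \<theta>" "2 * R * \<delta> \<le> 1"
    using \<theta> B(1) R by (auto simp: \<delta>_def min_def field_simps)
  \<comment> \<open>Away from the zeros of W this is close to k conj(W) / W; the term \<epsilon>^2
    keeps it continuous at the zeros without raising its modulus above that of k.\<close>
  define g where "g = (\<lambda>z. k z * (cnj (W z))\<^sup>2 / of_real ((norm (W z))\<^sup>2 + \<epsilon>\<^sup>2))"
  have pos: "(norm (W z))\<^sup>2 + \<epsilon>\<^sup>2 > 0" for z using \<epsilon>(1) by (simp add: add_nonneg_pos)
  have cg: "continuous_on (cball c R) g"
  proof -
    have "complex_of_real ((norm (W z))\<^sup>2 + \<epsilon>\<^sup>2) \<noteq> 0" for z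
      using pos[of z] by (metis less_irrefl of_real_eq_0_iff)
    then show ?thesis unfolding g_def by (intro continuous_intros cW ck) blast
  qed
  have gm: "norm (g z) \<le> m" if "z \<in> cball c R" for z
  proof -
    have "norm (g z) = norm (k z) * ((norm (W z))\<^sup>2 / ((norm (W z))\<^sup>2 + \<epsilon>\<^sup>2))"
      using pos[of z] unfolding g_def norm_divide norm_mult norm_of_real by (simp add: norm_power)
    also have "\<dots> \<le> m * 1"
      using pos[of z] m[OF that] m0 by (intro mult_mono) auto
    finally show ?thesis by simp
  qed
  have gW: "norm (k z * cnj (W z) - W z * g z) \<le> \<theta>" if z: "z \<in> cball c R" for z
  proof -
    let ?w = "norm (W z)"
    have "k z * cnj (W z) - W z * g z = k z * cnj (W z) * of_real (\<epsilon>\<^sup>2 / (?w\<^sup>2 + \<epsilon>\<^sup>2))"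
    proof -
      have ne: "complex_of_real (?w\<^sup>2 + \<epsilon>\<^sup>2) \<noteq> 0" using pos[of z] by (metis less_irrefl of_real_eq_0_iff)
      have "W z * (cnj (W z))\<^sup>2 = cnj (W z) * of_real (?w\<^sup>2)"
        unfolding power2_eq_square[of "cnj (W z)"] complex_norm_square by (simp add: mult_ac)
      then have "W z * g z = k z * cnj (W z) * (of_real (?w\<^sup>2) / of_real (?w\<^sup>2 + \<epsilon>\<^sup>2))"
        unfolding g_def by (simp add: mult_ac)
      moreover have "of_real (?w\<^sup>2) / of_real (?w\<^sup>2 + \<epsilon>\<^sup>2) = 1 - complex_of_real (\<epsilon>\<^sup>2 / (?w\<^sup>2 + \<epsilon>\<^sup>2))"
        using ne by (simp add: field_simps)
      ultimately have "W z * g z = k z * cnj (W z) * (1 - complex_of_real (\<epsilon>\<^sup>2 / (?w\<^sup>2 + \<epsilon>\<^sup>2)))"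
        by (simp only:)
      then show ?thesis by (simp only: right_diff_distrib mult_1_right) simp
    qed
    then have "norm (k z * cnj (W z) - W z * g z) = norm (k z) * ?w * \<bar>\<epsilon>\<^sup>2 / (?w\<^sup>2 + \<epsilon>\<^sup>2)\<bar>"
      by (simp only: norm_mult norm_of_real complex_mod_cnj)
    also have "\<dots> = norm (k z) * (?w * \<epsilon>\<^sup>2 / (?w\<^sup>2 + \<epsilon>\<^sup>2))"
      using pos[of z] by simp
    also have "\<dots> \<le> m * \<epsilon>"
    proof (intro mult_mono m z m0)
      have "?w * \<epsilon> \<le> ?w\<^sup>2 + \<epsilon>\<^sup>2"
      proof -
        have "0 \<le> ?w * \<epsilon>" using \<epsilon>(1) by simp
        moreover have "2 * (?w * \<epsilon>) \<le> ?w\<^sup>2 + \<epsilon>\<^sup>2" using sum_squares_bound[of ?w \<epsilon>] by (simp add: mult.assoc)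
        ultimately show ?thesis by linarith
      qed
      then have "?w * \<epsilon> * \<epsilon> \<le> \<epsilon> * (?w\<^sup>2 + \<epsilon>\<^sup>2)" using \<epsilon>(1) by (simp add: mult.commute)
      then show "?w * \<epsilon>\<^sup>2 / (?w\<^sup>2 + \<epsilon>\<^sup>2) \<le> \<epsilon>"
        using pos[of z] by (simp add: divide_le_eq power2_eq_square mult.assoc)
    qed (use pos[of z] in auto)
    finally show ?thesis using \<epsilon>(2) by linarith
  qed
  obtain S aS p where S: "continuous_on UNIV aS" "continuous_on UNIV p" "\<And>z. has_wirtinger S (aS z) (p z) z"
    and p: "\<And>z. z \<in> cball c R \<Longrightarrow> norm (g z - p z) \<le> \<delta>"
    using approximate_antiholomorphic_primitive[OF compact_cball cg \<delta>(1)] by blast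
  have pm: "norm (p z) \<le> m + \<delta>" if "z \<in> cball c R" for z
    using norm_triangle_sub[of "p z" "g z"] p[OF that] gm[OF that] by (simp add: norm_minus_commute)
  obtain K where K: "K holomorphic_on ball c R" "\<And>z. z \<in> ball c R \<Longrightarrow> norm (S z - K z) \<le> 2 * R * (m + \<delta>)"
    using near_holomorphic[OF R S(3) _ _ pm] S(1,2) continuous_on_subset by blast
  \<comment> \<open>Subtracting the holomorphic \<open>K\<close> leaves the d-bar derivative
    \<open>p\<close> unchanged and brings in the bound \<sigma>.\<close>
  define s where "s = (\<lambda>z. S z - K z)"
  have s\<sigma>: "norm (s z) \<le> \<sigma>" if "z \<in> ball c R" for z
    using K(2)[OF that] \<delta>(3) by (simp add: s_def \<sigma>_def algebra_simps)
  have sub: "cball c r \<subseteq> ball c R" "cball c r \<subseteq> cball c R" using r by auto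
  define h where "h = (\<lambda>z. W z * exp (- s z))"
  define ah where "ah = (\<lambda>z. a z * exp (- s z) + W z * (- exp (- s z) * (aS z - deriv K z)))"
  define bh where "bh = (\<lambda>z. k z * cnj (W z) * exp (- s z) + W z * (- exp (- s z) * (p z - 0)))"
  have dK: "(K has_field_derivative deriv K z) (at z)" if "z \<in> ball c R" for z
    using K(1) that holomorphic_derivI open_ball by blast
  have hw: "has_wirtinger h (ah z) (bh z) z" if z: "z \<in> cball c r" for z
  proof -
    have zR: "z \<in> ball c R" "z \<in> cball c R" using z sub by auto
    have sw: "has_wirtinger s (aS z - deriv K z) (p z - 0) z"
      unfolding s_def by (rule has_wirtinger_diff[OF S(3) has_wirtinger_holomorphic[OF dK[OF zR(1)]]])
    have "((\<lambda>w. exp (- w)) has_field_derivative - exp (- w)) (at w)" for w :: complex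
      by (auto intro!: derivative_eq_intros)
    from has_wirtinger_mult[OF W[OF zR(2)] has_wirtinger_compose_holomorphic[OF sw this]]
    show ?thesis unfolding h_def ah_def bh_def .
  qed
  have cs: "continuous_on (cball c r) s"
    unfolding s_def using K(1) S(3) sub(1)
    by (intro continuous_intros) (auto intro: has_wirtinger_continuous_on holomorphic_on_imp_continuous_on holomorphic_on_subset)
  have cdK: "continuous_on (cball c r) (deriv K)"
    using holomorphic_deriv[OF K(1) open_ball] sub(1)
    by (auto intro: holomorphic_on_imp_continuous_on holomorphic_on_subset)
  note cc = continuous_on_subset[OF cW sub(2)] continuous_on_subset[OF ca sub(2)]
    continuous_on_subset[OF ck sub(2)] continuous_on_subset[OF S(1) subset_UNIV] continuous_on_subset[OF S(2) subset_UNIV]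
  \<comment> \<open>The d-bar derivative of W exp(-s) is exp(-s) (k conj(W) - W p): one \<theta> for
    the regularization, one for the polynomial approximation.\<close>
  have bhb: "norm (bh z) \<le> \<eta> / (2 * R)" if z: "z \<in> cball c r" for z
  proof -
    have zR: "z \<in> ball c R" "z \<in> cball c R" using z sub by auto
    have "bh z = exp (- s z) * ((k z * cnj (W z) - W z * g z) + W z * (g z - p z))"
      by (simp add: bh_def algebra_simps)
    then have "norm (bh z) = norm (exp (- s z)) * norm ((k z * cnj (W z) - W z * g z) + W z * (g z - p z))"
      by (simp add: norm_mult)
    also have "\<dots> \<le> exp \<sigma> * (\<theta> + \<theta>)"
    proof (intro mult_mono)
      show "norm (exp (- s z)) \<le> exp \<sigma>"
        using s\<sigma>[OF zR(1)] abs_Re_le_cmod[of "s z"] by simp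
      have "norm (W z * (g z - p z)) \<le> B * \<delta>"
        unfolding norm_mult using B p zR(2) by (intro mult_mono) auto
      then show "norm ((k z * cnj (W z) - W z * g z) + W z * (g z - p z)) \<le> \<theta> + \<theta>"
        using gW[OF zR(2)] \<delta>(2) by (intro norm_triangle_mono) (auto simp: mult.commute)
    qed auto
    also have "\<dots> = \<eta> / (2 * R)" using R by (simp add: \<theta>_def field_simps)
    finally show ?thesis .
  qed
  have cah: "continuous_on (cball c r) ah"
    unfolding ah_def by (intro continuous_intros cc cs cdK)
  have cbh: "continuous_on (cball c r) bh"
    unfolding bh_def by (intro continuous_intros cc cs cdK)
  obtain H where H: "H holomorphic_on ball c r" "\<And>z. z \<in> ball c r \<Longrightarrow> norm (h z - H z) \<le> 2 * r * (\<eta> / (2 * R))"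
    using near_holomorphic[OF r(1) hw cah cbh bhb] by blast
  have "2 * r * (\<eta> / (2 * R)) \<le> \<eta>" using r R \<eta> by (simp add: field_simps)
  then have "norm (W z * exp (- s z) - H z) \<le> \<eta>" if "z \<in> ball c r" for z
    using H(2)[OF that] unfolding h_def by linarith
  moreover have "norm (s z) \<le> 2 * R * m + 1" if "z \<in> ball c r" for z
    using s\<sigma>[of z] that r unfolding \<sigma>_def by auto
  ultimately show ?thesis using H(1) by blast
qed

section \<open>Lagrange interpolation at separated nodes\<close>

lemma holomorphic_factor_finite_zeros:
  assumes "finite E" "open U" "H holomorphic_on U" "E \<subseteq> U" "\<And>e. e \<in> E \<Longrightarrow> H e = 0"
  shows "\<exists>K. K holomorphic_on U \<and> (\<forall>z\<in>U. H z = (\<Prod>e\<in>E. z - e) * K z)"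
  using assms
proof (induction E arbitrary: H)
  case empty
  then show ?case by auto
next
  case (insert e E)
  define G where "G = (\<lambda>z. if z = e then deriv H e else H z / (z - e))"
  have G: "G holomorphic_on U"
    by (rule pole_theorem_open_0[OF insert.prems(2,1), of e]) (use insert.prems in \<open>auto simp: G_def\<close>)
  have HG: "H z = (z - e) * G z" for z using insert.prems by (auto simp: G_def)
  have "G x = 0" if "x \<in> E" for x using that insert HG[of x] by auto
  then obtain K where K: "K holomorphic_on U" "\<And>z. z \<in> U \<Longrightarrow> G z = (\<Prod>e\<in>E. z - e) * K z"
    using insert.IH[OF insert.prems(1) G] insert.prems by auto
  then show ?case using insert.hyps HG by (intro exI[of _ K]) (auto simp: mult_ac)
qed

text \<open>For |u - c| \<le> 5\<rho> the factors of the Lagrange basis are at most 6\<rho>/d, so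
  the interpolant \<open>Q\<close> is at most \<open>q\<close>. The remainder H - Q vanishes at the
  nodes; divided by the node polynomial it is bounded through the circle of radius 5\<rho>, where
  each factor has modulus at least 4\<rho>. On the small disc each factor is at most 2\<rho>, so
  every node gains a factor 1/2.\<close>

lemma holomorphic_small_on_separated_nodes:
  assumes \<rho>: "\<rho> > 0" "5 * \<rho> < r" and H: "H holomorphic_on ball c r"
    and E: "finite E" "E \<subseteq> cball c \<rho>" "card E = N" and sep: "\<And>x y. x \<in> E \<Longrightarrow> y \<in> E \<Longrightarrow> x \<noteq> y \<Longrightarrow> d \<le> dist x y"
    and d: "d > 0" and \<epsilon>: "\<And>x. x \<in> E \<Longrightarrow> norm (H x) \<le> \<epsilon>" and B: "\<And>z. z \<in> ball c r \<Longrightarrow> norm (H z) \<le> B"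
    and z: "z \<in> cball c \<rho>" and \<epsilon>0: "\<epsilon> \<ge> 0"
  shows "norm (H z) \<le> 2 * real N * \<epsilon> * (6 * \<rho> / d) ^ (N - 1) + B / 2 ^ N"
proof -
  define Q where "Q = (\<lambda>z. \<Sum>x\<in>E. H x * (\<Prod>y\<in>E - {x}. (z - y) / (x - y)))"
  define q where "q = real N * \<epsilon> * (6 * \<rho> / d) ^ (N - 1)"
  have QE: "Q x = H x" if x: "x \<in> E" for x
  proof -
    have "Q x = (\<Sum>y\<in>E. if y = x then H x else 0)"
      unfolding Q_def
    proof (rule sum.cong[OF refl])
      fix y assume y: "y \<in> E"
      show "H y * (\<Prod>e\<in>E - {y}. (x - e) / (y - e)) = (if y = x then H x else 0)"
      proof (cases "y = x")
        case True
        have "(\<Prod>e\<in>E - {x}. (x - e) / (x - e)) = (\<Prod>e\<in>E - {x}. 1)" by (intro prod.cong) auto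
        then show ?thesis using True by simp
      next
        case False
        then have "(\<Prod>e\<in>E - {y}. (x - e) / (y - e)) = 0"
          using E x by (intro prod_zero) auto
        then show ?thesis using False by simp
      qed
    qed
    then show ?thesis using E x by simp
  qed
  have Qq: "norm (Q u) \<le> q" if u: "u \<in> cball c (5 * \<rho>)" for u
  proof -
    have "norm (Q u) \<le> (\<Sum>x\<in>E. norm (H x * (\<Prod>y\<in>E - {x}. (u - y) / (x - y))))"
      unfolding Q_def by (rule norm_sum)
    also have "\<dots> \<le> (\<Sum>x\<in>E. \<epsilon> * (6 * \<rho> / d) ^ (N - 1))"
    proof (rule sum_mono)
      fix x assume x: "x \<in> E"
      have "norm (\<Prod>y\<in>E - {x}. (u - y) / (x - y)) = (\<Prod>y\<in>E - {x}. norm ((u - y) / (x - y)))"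
        by (rule prod_norm[symmetric])
      also have "\<dots> \<le> (\<Prod>y\<in>E - {x}. 6 * \<rho> / d)"
      proof (rule prod_mono)
        fix y assume y: "y \<in> E - {x}"
        have "norm (u - y) \<le> 6 * \<rho>"
          using u E(2) y dist_triangle[of u y c] by (auto simp: dist_norm norm_minus_commute)
        moreover have "d \<le> norm (x - y)" using sep[of x y] x y by (auto simp: dist_norm)
        ultimately show "0 \<le> norm ((u - y) / (x - y)) \<and> norm ((u - y) / (x - y)) \<le> 6 * \<rho> / d"
          using d \<rho> by (auto simp: norm_divide intro: frac_le)
      qed
      also have "\<dots> = (6 * \<rho> / d) ^ (N - 1)" using E x by simp
      finally show "norm (H x * (\<Prod>y\<in>E - {x}. (u - y) / (x - y))) \<le> \<epsilon> * (6 * \<rho> / d) ^ (N - 1)"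
        unfolding norm_mult using \<epsilon>[OF x] \<epsilon>0 by (intro mult_mono) auto
    qed
    finally show ?thesis using E by (simp add: q_def)
  qed
  have hQ: "Q holomorphic_on A" for A unfolding Q_def by (intro holomorphic_intros) auto
  have Eb: "E \<subseteq> ball c r" using E(2) \<rho> by auto
  obtain K where K: "K holomorphic_on ball c r" "\<And>z. z \<in> ball c r \<Longrightarrow> H z - Q z = (\<Prod>e\<in>E. z - e) * K z"
    using holomorphic_factor_finite_zeros[OF E(1) open_ball holomorphic_on_diff[OF H hQ] Eb] QE by auto
  have Kb: "norm (K u) \<le> (B + q) / (4 * \<rho>) ^ N" if u: "u \<in> cball c (5 * \<rho>)" for u
  proof (rule maximum_modulus_frontier[of K "cball c (5 * \<rho>)"])
    have sub: "cball c (5 * \<rho>) \<subseteq> ball c r" using \<rho> by auto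
    show "K holomorphic_on interior (cball c (5 * \<rho>))"
      using K(1) sub by (meson holomorphic_on_subset interior_subset order_trans)
    show "continuous_on (closure (cball c (5 * \<rho>))) K"
      using K(1) sub by (metis closed_cball closure_closed holomorphic_on_imp_continuous_on holomorphic_on_subset)
    fix v assume "v \<in> frontier (cball c (5 * \<rho>))"
    then have v: "dist c v = 5 * \<rho>" using \<rho> by (simp add: frontier_cball)
    then have vb: "v \<in> ball c r" "v \<in> cball c (5 * \<rho>)" using \<rho> by auto
    have "(4 * \<rho>) ^ N = (\<Prod>e\<in>E. 4 * \<rho>)" using E by simp
    also have "\<dots> \<le> (\<Prod>e\<in>E. norm (v - e))"
    proof (rule prod_mono)
      fix e assume "e \<in> E"
      then have "dist c e \<le> \<rho>" using E by auto
      then show "0 \<le> 4 * \<rho> \<and> 4 * \<rho> \<le> norm (v - e)"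
        using v dist_triangle[of c v e] \<rho> by (auto simp: dist_norm norm_minus_commute)
    qed
    also have "\<dots> = norm (\<Prod>e\<in>E. v - e)" by (rule prod_norm)
    finally have P: "(4 * \<rho>) ^ N \<le> norm (\<Prod>e\<in>E. v - e)" .
    have "norm (\<Prod>e\<in>E. v - e) * norm (K v) = norm (H v - Q v)" using K(2)[OF vb(1)] by (simp add: norm_mult)
    also have "\<dots> \<le> B + q" using B[OF vb(1)] Qq[OF vb(2)] norm_triangle_ineq4[of "H v" "Q v"] by linarith
    finally have "(4 * \<rho>) ^ N * norm (K v) \<le> B + q"
      using mult_right_mono[OF P norm_ge_zero[of "K v"]] by linarith
    then show "norm (K v) \<le> (B + q) / (4 * \<rho>) ^ N"
      using \<rho> by (simp add: field_simps)
  qed (use u in auto)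
  have zb: "z \<in> ball c r" "z \<in> cball c (5 * \<rho>)" using z \<rho> by auto
  have "norm (\<Prod>e\<in>E. z - e) = (\<Prod>e\<in>E. norm (z - e))" by (rule prod_norm[symmetric])
  also have "\<dots> \<le> (\<Prod>e\<in>E. 2 * \<rho>)"
  proof (rule prod_mono)
    fix e assume "e \<in> E"
    then have "dist c e \<le> \<rho>" using E by auto
    then show "0 \<le> norm (z - e) \<and> norm (z - e) \<le> 2 * \<rho>"
      using z dist_triangle[of z e c] by (auto simp: dist_norm norm_minus_commute)
  qed
  also have "\<dots> = (2 * \<rho>) ^ N" using E by simp
  finally have P: "norm (\<Prod>e\<in>E. z - e) \<le> (2 * \<rho>) ^ N" .
  have q0: "0 \<le> q" "0 \<le> B" using Qq[OF zb(2)] B[OF zb(1)] norm_ge_zero order_trans by blast+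
  have "norm (H z) \<le> norm (Q z) + norm (H z - Q z)" by (metis norm_triangle_sub)
  also have "\<dots> \<le> q + (2 * \<rho>) ^ N * ((B + q) / (4 * \<rho>) ^ N)"
    unfolding K(2)[OF zb(1)] norm_mult
    by (intro add_mono Qq zb mult_mono P Kb) (use \<rho> in auto)
  also have "(2 * \<rho>) ^ N * ((B + q) / (4 * \<rho>) ^ N) = (B + q) / 2 ^ N"
  proof -
    have "(4 * \<rho>) ^ N = (2 * (2 * \<rho>)) ^ N" by simp
    also have "\<dots> = 2 ^ N * (2 * \<rho>) ^ N" by (rule power_mult_distrib)
    finally show ?thesis using \<rho> by simp
  qed
  also have "q + (B + q) / 2 ^ N \<le> 2 * q + B / 2 ^ N"
    using q0 divide_left_mono[of 1 "2 ^ N" q] by (simp add: add_divide_distrib)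
  finally show ?thesis by (simp add: q_def)
qed

section \<open>A positive solution and the Wronskian\<close>

lemma absolutely_integrable_bounded_times_continuous:
  fixes V f :: "real \<Rightarrow> real"
  assumes V: "V \<in> borel_measurable lebesgue" and bV: "\<And>x. x \<in> {a..b} \<Longrightarrow> \<bar>V x\<bar> \<le> M"
    and f: "continuous_on {a..b} f"
  shows "(\<lambda>x. V x * f x) absolutely_integrable_on {a..b}"
proof (rule absolutely_integrable_bounded_measurable_product_real)
  show "V \<in> borel_measurable (lebesgue_on {a..b})" using V by (rule measurable_restrict_space1)
  show "bounded (V ` {a..b})" unfolding bounded_iff using bV by (intro exI[of _ M]) auto
  show "f absolutely_integrable_on {a..b}" using f by (rule absolutely_integrable_continuous_real)
qed auto

lemma has_integral_from_left:
  fixes f :: "real \<Rightarrow> real"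
  assumes "f integrable_on {a..b}" "a \<le> x" "x \<le> y" "y \<le> b"
  shows "(f has_integral (integral {a..y} f - integral {a..x} f)) {x..y}"
proof -
  have i: "f integrable_on {x..y}" "f integrable_on {a..y}"
    using assms by (auto intro: integrable_on_subinterval)
  have "integral {a..x} f + integral {x..y} f = integral {a..y} f"
    using assms i by (intro Henstock_Kurzweil_Integration.integral_combine) auto
  then show ?thesis using integrable_integral[OF i(1)] by (metis add_diff_cancel_left')
qed

text \<open>The solution is the limit of the increasing Picard iterates, which start at the constant \<open>1\<close>
  and stay below \<open>exp (m * (x - a))\<close>.\<close>

lemma positive_solution_exists:
  fixes V :: "real \<Rightarrow> real"
  assumes ab: "a \<le> b" and V: "V \<in> borel_measurable lebesgue"
    and V0: "\<And>x. x \<in> {a..b} \<Longrightarrow> 0 \<le> V x" and VM: "\<And>x. x \<in> {a..b} \<Longrightarrow> V x \<le> m\<^sup>2" and m: "m > 0"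
  shows "\<exists>w w'. (\<forall>x\<in>{a..b}. (w has_real_derivative w' x) (at x within {a..b})) \<and> continuous_on {a..b} w' \<and>
    (\<forall>x\<in>{a..b}. 1 \<le> w x \<and> 0 \<le> w' x \<and> w' x \<le> m * w x) \<and>
    (\<forall>x y. a \<le> x \<longrightarrow> x \<le> y \<longrightarrow> y \<le> b \<longrightarrow> ((\<lambda>t. V t * w t) has_integral (w' y - w' x)) {x..y})"
proof -
  have bV: "\<bar>V x\<bar> \<le> m\<^sup>2" if "x \<in> {a..b}" for x using V0 VM that by simp
  define g where "g = (\<lambda>(f::real \<Rightarrow> real) s. integral {a..s} (\<lambda>t. V t * f t))"
  define T where "T = (\<lambda>f x. 1 + integral {a..x} (g f))"
  have Vf: "(\<lambda>t. V t * f t) integrable_on {a..s}" if "continuous_on {a..b} f" "s \<le> b" for f s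
  proof -
    have "(\<lambda>t. V t * f t) absolutely_integrable_on {a..b}"
      by (rule absolutely_integrable_bounded_times_continuous[OF V bV that(1)])
    then have "(\<lambda>t. V t * f t) integrable_on {a..b}" by (simp add: absolutely_integrable_on_def)
    then show ?thesis by (rule integrable_on_subinterval) (use that in auto)
  qed
  have cg: "continuous_on {a..b} (g f)" if "continuous_on {a..b} f" for f
    unfolding g_def by (intro indefinite_integral_continuous_1 Vf that order_refl)
  have gi: "g f integrable_on {a..s}" if "continuous_on {a..b} f" "s \<le> b" for f s
    using cg[OF that(1)] that(2) by (intro integrable_continuous_real) (auto intro: continuous_on_subset)
  have cT: "continuous_on {a..b} (T f)" if "continuous_on {a..b} f" for f
    unfolding T_def by (intro continuous_intros indefinite_integral_continuous_1 gi that order_refl)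
  have g_mono: "g f s \<le> g h s" if "continuous_on {a..b} f" "continuous_on {a..b} h"
    "\<And>x. x \<in> {a..b} \<Longrightarrow> f x \<le> h x" "s \<in> {a..b}" for f h s
    unfolding g_def using that V0 by (intro integral_le Vf mult_left_mono) auto
  have T_mono: "T f s \<le> T h s" if "continuous_on {a..b} f" "continuous_on {a..b} h"
    "\<And>x. x \<in> {a..b} \<Longrightarrow> f x \<le> h x" "s \<in> {a..b}" for f h s
    unfolding T_def using that g_mono[OF that(1-3)] by (intro add_left_mono integral_le gi) auto
  have g_nonneg: "0 \<le> g f s" if "continuous_on {a..b} f" "\<And>x. x \<in> {a..b} \<Longrightarrow> 0 \<le> f x" "s \<in> {a..b}" for f s
    unfolding g_def using that V0 by (intro integral_nonneg Vf mult_nonneg_nonneg) auto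
  let ?e = "\<lambda>x. exp (m * (x - a))"
  have ce: "continuous_on A ?e" for A by (intro continuous_intros)
  \<comment> \<open>The exponential e solves e'' = m^2 e, so a function below e has its source
    integral below m e - m, hence below m e. This is the invariant of the iteration, and also the
    dominating function for its limit.\<close>
  have gub: "g f s \<le> m * ?e s" if f: "continuous_on {a..b} f" "\<And>x. x \<in> {a..b} \<Longrightarrow> f x \<le> ?e x" "\<And>x. x \<in> {a..b} \<Longrightarrow> 0 \<le> f x" and s: "s \<in> {a..b}" for f s
  proof -
    have i: "((\<lambda>t. m\<^sup>2 * ?e t) has_integral (m * ?e s - m * ?e a)) {a..s}"
      using s by (intro fundamental_theorem_of_calculus)
        (auto simp flip: has_real_derivative_iff_has_vector_derivative intro!: derivative_eq_intros simp: power2_eq_square)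
    have "g f s \<le> integral {a..s} (\<lambda>t. m\<^sup>2 * ?e t)"
      unfolding g_def
    proof (rule integral_le)
      show "(\<lambda>t. V t * f t) integrable_on {a..s}" using Vf f s by auto
      show "(\<lambda>t. m\<^sup>2 * ?e t) integrable_on {a..s}" using i by blast
      show "V t * f t \<le> m\<^sup>2 * ?e t" if "t \<in> {a..s}" for t
        using that s V0 VM f by (intro mult_mono) auto
    qed
    also have "\<dots> = m * ?e s - m * ?e a" using i by (rule integral_unique)
    finally show ?thesis using m by simp
  qed
  have Tub: "T f x \<le> ?e x" if f: "continuous_on {a..b} f" "\<And>x. x \<in> {a..b} \<Longrightarrow> f x \<le> ?e x" "\<And>x. x \<in> {a..b} \<Longrightarrow> 0 \<le> f x" and x: "x \<in> {a..b}" for f x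
  proof -
    have i: "((\<lambda>t. m * ?e t) has_integral (?e x - ?e a)) {a..x}"
      using x by (intro fundamental_theorem_of_calculus)
        (auto simp flip: has_real_derivative_iff_has_vector_derivative intro!: derivative_eq_intros)
    have "integral {a..x} (g f) \<le> integral {a..x} (\<lambda>t. m * ?e t)"
      using x i by (intro integral_le gi f gub) auto
    also have "\<dots> = ?e x - ?e a" using i by (rule integral_unique)
    finally show ?thesis unfolding T_def by simp
  qed
  have T1: "1 \<le> T f x" if f: "continuous_on {a..b} f" "\<And>x. x \<in> {a..b} \<Longrightarrow> 0 \<le> f x" and x: "x \<in> {a..b}" for f x
  proof -
    have "0 \<le> integral {a..x} (g f)"
      using x g_nonneg[OF f] by (intro integral_nonneg gi f) auto
    then show ?thesis by (simp add: T_def)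
  qed
  define F where "F = (\<lambda>n. (T ^^ n) (\<lambda>_. 1))"
  have F_Suc: "F (Suc n) = T (F n)" for n by (simp add: F_def)
  have F0: "F 0 = (\<lambda>_. 1)" by (simp add: F_def)
  have F: "continuous_on {a..b} (F n) \<and> (\<forall>x\<in>{a..b}. 1 \<le> F n x \<and> F n x \<le> ?e x)" for n
  proof (induction n)
    case 0
    then show ?case using m by (simp add: F0)
  next
    case (Suc n)
    then have F0: "\<And>x. x \<in> {a..b} \<Longrightarrow> 0 \<le> F n x" by fastforce
    show ?case unfolding F_Suc using Suc F0 cT Tub T1 by blast
  qed
  have cF: "continuous_on {a..b} (F n)" and F1: "\<And>x. x \<in> {a..b} \<Longrightarrow> 1 \<le> F n x"
    and Fe: "\<And>x. x \<in> {a..b} \<Longrightarrow> F n x \<le> ?e x" for n using F by auto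
  have F00: "0 \<le> F n x" if "x \<in> {a..b}" for n x using F1[OF that, of n] by simp
  have Fstep: "\<forall>x\<in>{a..b}. F n x \<le> F (Suc n) x" for n
  proof (induction n)
    case 0
    then show ?case using F1[of _ "Suc 0"] by (simp add: F0)
  next
    case (Suc n)
    then show ?case using T_mono[OF cF cF] F_Suc by metis
  qed
  have inc: "incseq (\<lambda>n. F n x)" if "x \<in> {a..b}" for x
    using Fstep that by (intro incseq_SucI) auto
  define w where "w = (\<lambda>x. lim (\<lambda>n. F n x))"
  have Fw: "(\<lambda>n. F n x) \<longlonglongrightarrow> w x" if x: "x \<in> {a..b}" for x
  proof -
    have "Bseq (\<lambda>n. F n x)"
      by (rule BseqI'[of _ "?e x"]) (use F00[OF x] Fe[OF x] in auto)
    then have "convergent (\<lambda>n. F n x)"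
      using inc[OF x] by (intro Bseq_monoseq_convergent) (auto simp: monoseq_iff)
    then show ?thesis unfolding w_def by (simp add: convergent_LIMSEQ_iff)
  qed
  have em: "?e x \<le> ?e b" if "x \<in> {a..b}" for x using that m by simp
  have Vw: "(\<lambda>t. V t * w t) integrable_on {a..s}" "(\<lambda>n. g (F n) s) \<longlonglongrightarrow> g w s" if s: "s \<in> {a..b}" for s
  proof -
    have 1: "(\<lambda>t. V t * F n t) integrable_on {a..s}" for n using Vf[OF cF] s by auto
    have 2: "(\<lambda>t. m\<^sup>2 * ?e b) integrable_on {a..s}" by auto
    have 3: "norm (V t * F n t) \<le> m\<^sup>2 * ?e b" if "t \<in> {a..s}" for n t
    proof -
      have t: "t \<in> {a..b}" using that s by auto
      show ?thesis unfolding real_norm_def abs_mult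
        using bV[OF t] F00[OF t, of n] order_trans[OF Fe[OF t, of n] em[OF t]] by (intro mult_mono) auto
    qed
    have 4: "(\<lambda>n. V t * F n t) \<longlonglongrightarrow> V t * w t" if "t \<in> {a..s}" for t
      using that s by (intro tendsto_intros Fw) auto
    show "(\<lambda>t. V t * w t) integrable_on {a..s}" "(\<lambda>n. g (F n) s) \<longlonglongrightarrow> g w s"
      unfolding g_def using dominated_convergence[OF 1 2 3 4] by auto
  qed
  have cgw: "continuous_on {a..b} (g w)"
    unfolding g_def by (intro indefinite_integral_continuous_1 Vw) (use ab in auto)
  have wT: "w x = 1 + integral {a..x} (g w)" if x: "x \<in> {a..b}" for x
  proof -
    have 1: "g (F n) integrable_on {a..x}" for n using gi[OF cF] x by auto
    have 3: "norm (g (F n) t) \<le> m * ?e b" if "t \<in> {a..x}" for n t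
    proof -
      have t: "t \<in> {a..b}" using that x by auto
      have "g (F n) t \<le> m * ?e t" by (rule gub[OF cF Fe F00 t])
      also have "\<dots> \<le> m * ?e b" using em[OF t] m by simp
      finally show ?thesis using g_nonneg[OF cF F00 t, of n] by simp
    qed
    have "(\<lambda>n. integral {a..x} (g (F n))) \<longlonglongrightarrow> integral {a..x} (g w)"
      by (rule dominated_convergence(2)[OF 1 _ 3 Vw(2)]) (use x in auto)
    then have "(\<lambda>n. F (Suc n) x) \<longlonglongrightarrow> 1 + integral {a..x} (g w)"
      unfolding F_Suc T_def by (intro tendsto_intros)
    then show ?thesis using LIMSEQ_Suc[OF Fw[OF x]] LIMSEQ_unique by blast
  qed
  have w1: "1 \<le> w x" if "x \<in> {a..b}" for x
    using LIMSEQ_le_const[OF Fw[OF that]] F1[OF that] by blast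
  have wd: "(w has_real_derivative g w x) (at x within {a..b})" if x: "x \<in> {a..b}" for x
  proof -
    have "((\<lambda>u. integral {a..u} (g w)) has_real_derivative g w x) (at x within {a..b})"
      by (rule integral_has_real_derivative[OF cgw x])
    then have "((\<lambda>u. 1 + integral {a..u} (g w)) has_real_derivative g w x) (at x within {a..b})"
      by (auto intro!: derivative_eq_intros)
    then show ?thesis by (rule has_field_derivative_transform_within[OF _ zero_less_one x]) (simp add: wT)
  qed
  have cw: "continuous_on {a..b} w" using wd by (rule DERIV_continuous_on)
  have hi: "((\<lambda>t. V t * w t) has_integral (g w y - g w x)) {x..y}" if "a \<le> x" "x \<le> y" "y \<le> b" for x y
    unfolding g_def by (rule has_integral_from_left[OF Vf[OF cw order_refl] that])
  have gw0: "0 \<le> g w x" if "x \<in> {a..b}" for x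
    by (rule g_nonneg[OF cw _ that]) (use w1 in force)
  \<comment> \<open>(w' - m w) exp(m t) has the almost-everywhere derivative (V - m^2) w exp(m t)
    \<le> 0 and is not positive at \<open>a\<close>, where w' = 0. Both products are integrated
    separately, by parts and by the fundamental theorem.\<close>
  have gwm: "g w x \<le> m * w x" if x: "x \<in> {a..b}" for x
  proof -
    have sub: "{a..x} \<subseteq> {a..b}" using x by auto
    let ?E = "\<lambda>t. exp (m * t)"
    have "((\<lambda>t. (V t * w t) * ?E t + g w t * (m * ?E t)) has_integral (g w x * ?E x - g w a * ?E a)) {a..x}"
    proof (rule integration_by_parts_primitive)
      show "(\<lambda>t. V t * w t) absolutely_integrable_on {a..x}"
        by (rule absolutely_integrable_bounded_times_continuous[OF V, where M = "m\<^sup>2"])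
           (use bV sub continuous_on_subset[OF cw sub] in auto)
    qed (use x hi in \<open>auto intro!: derivative_eq_intros continuous_intros\<close>)
    moreover have "((\<lambda>t. g w t * ?E t + w t * (m * ?E t)) has_integral (w x * ?E x - w a * ?E a)) {a..x}"
    proof (rule fundamental_theorem_of_calculus)
      fix t assume t: "t \<in> {a..x}"
      have "(w has_real_derivative g w t) (at t within {a..x})"
        using DERIV_subset[OF wd sub] t sub by blast
      then show "((\<lambda>t. w t * ?E t) has_vector_derivative (g w t * ?E t + w t * (m * ?E t))) (at t within {a..x})"
        unfolding has_real_derivative_iff_has_vector_derivative[symmetric]
        by (auto intro!: derivative_eq_intros)
    qed (use x in auto)
    ultimately have "((\<lambda>t. ((V t * w t) * ?E t + g w t * (m * ?E t)) - m * (g w t * ?E t + w t * (m * ?E t))) has_integral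
        ((g w x * ?E x - g w a * ?E a) - m * (w x * ?E x - w a * ?E a))) {a..x}"
      by (intro has_integral_diff has_integral_mult_right)
    then have "(g w x * ?E x - g w a * ?E a) - m * (w x * ?E x - w a * ?E a) \<le> 0"
    proof (rule has_integral_le[OF _ has_integral_0])
      fix t assume "t \<in> {a..x}"
      then have t: "t \<in> {a..b}" using sub by auto
      have "((V t * w t) * ?E t + g w t * (m * ?E t)) - m * (g w t * ?E t + w t * (m * ?E t)) = (V t - m\<^sup>2) * (w t * ?E t)"
        by (simp add: algebra_simps power2_eq_square)
      also have "\<dots> \<le> 0" using VM[OF t] w1[OF t] by (intro mult_nonpos_nonneg) auto
      finally show "((V t * w t) * ?E t + g w t * (m * ?E t)) - m * (g w t * ?E t + w t * (m * ?E t)) \<le> 0" .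
    qed
    moreover have "g w a = 0" by (simp add: g_def)
    moreover have "0 \<le> m * (w a * ?E a)" using m w1[of a] ab by simp
    ultimately have "g w x * ?E x \<le> (m * w x) * ?E x"
      by (simp only: right_diff_distrib mult.assoc mult_zero_left diff_0_right)
    then show ?thesis by simp
  qed
  show ?thesis
    by (intro exI[of _ w] exI[of _ "g w"] conjI ballI allI impI) (rule wd cgw w1 gw0 gwm hi; assumption)+
qed

text \<open>The Wronskian \<open>w * f' - w' * f\<close> is differentiable in the classical sense, because the
  discontinuous \<open>V\<close> cancels.\<close>

lemma logarithmic_correction_derivative:
  fixes V f f' w w' :: "real \<Rightarrow> real"
  assumes V: "V \<in> borel_measurable lebesgue" "\<And>x. x \<in> {a..b} \<Longrightarrow> \<bar>V x\<bar> \<le> M"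
    and w: "\<And>x. x \<in> {a..b} \<Longrightarrow> (w has_real_derivative w' x) (at x within {a..b})" "continuous_on {a..b} w'"
      "\<And>x. x \<in> {a..b} \<Longrightarrow> w x > 0"
      "\<And>x y. a \<le> x \<Longrightarrow> x \<le> y \<Longrightarrow> y \<le> b \<Longrightarrow> ((\<lambda>t. V t * w t) has_integral (w' y - w' x)) {x..y}"
    and f: "\<And>x. x \<in> {a..b} \<Longrightarrow> (f has_real_derivative f' x) (at x within {a..b})" "continuous_on {a..b} f'"
      "\<And>x y. a \<le> x \<Longrightarrow> x \<le> y \<Longrightarrow> y \<le> b \<Longrightarrow> ((\<lambda>t. (V t - \<Lambda>) * f t) has_integral (f' y - f' x)) {x..y}"
    and x: "x \<in> {a..b}"
  shows "((\<lambda>x. f' x - w' x / w x * f x) has_real_derivative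
    (- \<Lambda> * f x - w' x / w x * (f' x - w' x / w x * f x))) (at x within {a..b})"
proof -
  have cw: "continuous_on {a..b} w" and cf: "continuous_on {a..b} f"
    by (rule DERIV_continuous_on, rule w(1), assumption) (rule DERIV_continuous_on, rule f(1), assumption)
  define D where "D = (\<lambda>x. w x * f' x - w' x * f x)"
  \<comment> \<open>Two integrations by parts, of f' against w and of w' against f. In the
    difference V w f and w' f' cancel and a continuous integrand remains.\<close>
  have D: "D u = D a + (- \<Lambda>) * integral {a..u} (\<lambda>t. w t * f t)" if u: "u \<in> {a..b}" for u
  proof -
    have sub: "{a..u} \<subseteq> {a..b}" using u by auto
    have cu: "continuous_on {a..u} w" "continuous_on {a..u} f" "continuous_on {a..u} w'" "continuous_on {a..u} f'"
      using cw cf w(2) f(2) sub continuous_on_subset by blast+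
    have d: "(w has_real_derivative w' t) (at t within {a..u})" "(f has_real_derivative f' t) (at t within {a..u})"
      if "t \<in> {a..u}" for t
      using DERIV_subset[OF w(1) sub] DERIV_subset[OF f(1) sub] that sub by blast+
    have "((\<lambda>t. ((V t - \<Lambda>) * f t) * w t + f' t * w' t) has_integral (f' u * w u - f' a * w a)) {a..u}"
    proof (rule integration_by_parts_primitive)
      have "(\<lambda>t. (V t - \<Lambda>)) \<in> borel_measurable lebesgue" using V(1) by measurable
      moreover have "\<bar>V t - \<Lambda>\<bar> \<le> M + \<bar>\<Lambda>\<bar>" if "t \<in> {a..u}" for t using V(2)[of t] that sub by auto
      ultimately show "(\<lambda>t. (V t - \<Lambda>) * f t) absolutely_integrable_on {a..u}"
        using cu(2) by (rule absolutely_integrable_bounded_times_continuous)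
    qed (use u f(3) d cu in auto)
    moreover have "((\<lambda>t. (V t * w t) * f t + w' t * f' t) has_integral (w' u * f u - w' a * f a)) {a..u}"
    proof (rule integration_by_parts_primitive)
      show "(\<lambda>t. V t * w t) absolutely_integrable_on {a..u}"
        by (rule absolutely_integrable_bounded_times_continuous[OF V(1) _ cu(1)]) (use V(2) sub in blast)
    qed (use u w(4) d cu in auto)
    ultimately have "((\<lambda>t. (((V t - \<Lambda>) * f t) * w t + f' t * w' t) - ((V t * w t) * f t + w' t * f' t)) has_integral
        ((f' u * w u - f' a * w a) - (w' u * f u - w' a * f a))) {a..u}"
      by (rule has_integral_diff)
    also have "(\<lambda>t. (((V t - \<Lambda>) * f t) * w t + f' t * w' t) - ((V t * w t) * f t + w' t * f' t)) = (\<lambda>t. (- \<Lambda>) * (w t * f t))"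
      by (simp add: algebra_simps fun_eq_iff)
    finally have "(f' u * w u - f' a * w a) - (w' u * f u - w' a * f a) = (- \<Lambda>) * integral {a..u} (\<lambda>t. w t * f t)"
      by (metis integral_mult_right integral_unique)
    then show ?thesis by (simp add: D_def algebra_simps)
  qed
  have "((\<lambda>u. integral {a..u} (\<lambda>t. w t * f t)) has_real_derivative w x * f x) (at x within {a..b})"
    by (rule integral_has_real_derivative[OF _ x]) (intro continuous_intros cw cf)
  then have "((\<lambda>u. D a + (- \<Lambda>) * integral {a..u} (\<lambda>t. w t * f t)) has_real_derivative (- \<Lambda>) * (w x * f x)) (at x within {a..b})"
    by (auto intro!: derivative_eq_intros)
  then have Dd: "(D has_real_derivative (- \<Lambda>) * (w x * f x)) (at x within {a..b})"
    by (rule has_field_derivative_transform_within[OF _ zero_less_one x]) (rule D[symmetric])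
  have wx: "w x \<noteq> 0" using w(3)[OF x] by simp
  have "((\<lambda>u. D u / w u) has_real_derivative ((- \<Lambda>) * (w x * f x) * w x - D x * w' x) / (w x * w x)) (at x within {a..b})"
    by (rule DERIV_divide[OF Dd w(1)[OF x] wx])
  moreover have "((- \<Lambda>) * (w x * f x) * w x - D x * w' x) / (w x * w x) = - \<Lambda> * f x - w' x / w x * (f' x - w' x / w x * f x)"
    using wx by (simp add: D_def field_simps)
  ultimately have "((\<lambda>u. D u / w u) has_real_derivative - \<Lambda> * f x - w' x / w x * (f' x - w' x / w x * f x)) (at x within {a..b})"
    by (simp only:)
  then show ?thesis
    by (rule has_field_derivative_transform_within[OF _ zero_less_one x])
       (use w(3) in \<open>force simp: D_def field_simps\<close>)
qed

text \<open>In each outer third of the interval some point has |g| \<le> 3 A1 / (b - a). These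
  points are at least (b - a)/3 apart, so by the mean value theorem |g'| \<le> 18 A1 / (b - a)^2
  somewhere between them. Integrating the second derivative \<open>q\<close> spreads this to all of
  the interval, and one more integration bounds g.\<close>

lemma sup_bound_from_integrals:
  fixes g g' q :: "real \<Rightarrow> real"
  assumes ab: "a < b" and g: "\<And>x. x \<in> {a..b} \<Longrightarrow> (g has_real_derivative g' x) (at x within {a..b})"
    and q: "\<And>x y. a \<le> x \<Longrightarrow> x \<le> y \<Longrightarrow> y \<le> b \<Longrightarrow> (q has_integral (g' y - g' x)) {x..y}"
    and qa: "q absolutely_integrable_on {a..b}"
    and A1: "integral {a..b} (\<lambda>x. \<bar>g x\<bar>) \<le> A1" and A2: "integral {a..b} (\<lambda>x. \<bar>q x\<bar>) \<le> A2"
    and x: "x \<in> {a..b}"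
  shows "\<bar>g' x\<bar> \<le> 18 * A1 / (b - a)\<^sup>2 + A2"
    and "\<bar>g x\<bar> \<le> 3 * A1 / (b - a) + (b - a) * (18 * A1 / (b - a)\<^sup>2 + A2)"
proof -
  define l where "l = b - a"
  have l: "l > 0" using ab by (simp add: l_def)
  have cg: "continuous_on {a..b} g" using g by (rule DERIV_continuous_on)
  have ex: "\<exists>u\<in>{c..c + l / 3}. \<bar>g u\<bar> \<le> 3 * A1 / l" if c: "{c..c + l / 3} \<subseteq> {a..b}" for c
  proof -
    have c1: "continuous_on {c..c + l / 3} (\<lambda>x. \<bar>g x\<bar>)" using cg c by (intro continuous_intros) (rule continuous_on_subset)
    obtain u where u: "u \<in> {c..c + l / 3}" "\<And>y. y \<in> {c..c + l / 3} \<Longrightarrow> \<bar>g u\<bar> \<le> \<bar>g y\<bar>"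
      using continuous_attains_inf[OF _ _ c1] l by auto
    have "\<bar>g u\<bar> * (l / 3) = integral {c..c + l / 3} (\<lambda>_. \<bar>g u\<bar>)" using l by simp
    also have "\<dots> \<le> integral {c..c + l / 3} (\<lambda>x. \<bar>g x\<bar>)"
      by (intro integral_le integrable_continuous_real c1 u(2) continuous_intros)
    also have "\<dots> \<le> integral {a..b} (\<lambda>x. \<bar>g x\<bar>)"
      by (intro integral_subset_le c integrable_continuous_real c1) (auto intro!: continuous_intros cg)
    finally have "\<bar>g u\<bar> * (l / 3) \<le> A1" using A1 by simp
    then show ?thesis using u(1) l by (intro bexI[of _ u]) (auto simp: field_simps)
  qed
  obtain x1 where x1: "x1 \<in> {a..a + l / 3}" "\<bar>g x1\<bar> \<le> 3 * A1 / l"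
  proof -
    have "{a..a + l / 3} \<subseteq> {a..b}" using l by (auto simp: l_def field_simps)
    from ex[OF this] show ?thesis using that by blast
  qed
  obtain x2 where x2: "x2 \<in> {b - l / 3..b}" "\<bar>g x2\<bar> \<le> 3 * A1 / l"
  proof -
    have "{b - l / 3..b - l / 3 + l / 3} \<subseteq> {a..b}" using l by (auto simp: l_def field_simps)
    from ex[OF this] show ?thesis using that by auto
  qed
  have "b = a + l" by (simp add: l_def)
  then have x12: "l / 3 \<le> x2 - x1" "x1 < x2"
    using x1(1) x2(1) l unfolding atLeastAtMost_iff by linarith+
  have in12: "x1 \<in> {a..b}" "x2 \<in> {a..b}"
    using x1(1) x2(1) l \<open>b = a + l\<close> unfolding atLeastAtMost_iff by linarith+
  have "\<exists>\<xi>\<in>{x1<..<x2}. g x2 - g x1 = (\<lambda>h. h * g' \<xi>) (x2 - x1)"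
  proof (rule mvt_simple[OF x12(2)])
    fix y assume y: "x1 \<le> y" "y \<le> x2"
    have "(g has_real_derivative g' y) (at y within {x1..x2})"
      by (rule DERIV_subset[OF g]) (use y in12 in auto)
    then show "(g has_derivative (\<lambda>h. h * g' y)) (at y within {x1..x2})"
      by (simp add: has_field_derivative_def mult_commute_abs)
  qed
  then obtain \<xi> where \<xi>: "\<xi> \<in> {x1<..<x2}" "g x2 - g x1 = (x2 - x1) * g' \<xi>" by auto
  have \<xi>ab: "\<xi> \<in> {a..b}" using \<xi>(1) in12 by auto
  have "\<bar>g' \<xi>\<bar> * (l / 3) \<le> \<bar>g' \<xi>\<bar> * (x2 - x1)" using x12 by (intro mult_left_mono) auto
  also have "\<dots> = \<bar>g x2 - g x1\<bar>" using \<xi>(2) x12 by (simp add: abs_mult mult.commute)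
  also have "\<dots> \<le> 6 * A1 / l" using x1(2) x2(2) by linarith
  finally have g\<xi>: "\<bar>g' \<xi>\<bar> \<le> 18 * A1 / l\<^sup>2" using l by (simp add: field_simps power2_eq_square)
  have diff: "\<bar>g' v - g' u\<bar> \<le> A2" if uv: "a \<le> u" "u \<le> v" "v \<le> b" for u v
  proof -
    have qi: "q integrable_on {a..b}" "(\<lambda>x. \<bar>q x\<bar>) integrable_on {a..b}"
      using qa by (auto simp: absolutely_integrable_on_def)
    have i: "q integrable_on {u..v}" "(\<lambda>x. \<bar>q x\<bar>) integrable_on {u..v}"
      using uv by (auto intro: integrable_on_subinterval[OF qi(1)] integrable_on_subinterval[OF qi(2)])
    have "g' v - g' u = integral {u..v} q" using q[OF uv] by (simp add: integral_unique)
    also have "\<bar>\<dots>\<bar> \<le> integral {u..v} (\<lambda>x. \<bar>q x\<bar>)"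
      using integral_norm_bound_integral[OF i] by simp
    also have "\<dots> \<le> integral {a..b} (\<lambda>x. \<bar>q x\<bar>)"
      using uv by (intro integral_subset_le i qi) auto
    finally show ?thesis using A2 by linarith
  qed
  have bound: "\<bar>g' y\<bar> \<le> 18 * A1 / l\<^sup>2 + A2" if y: "y \<in> {a..b}" for y
  proof (cases "y \<le> \<xi>")
    case True
    then show ?thesis using diff[of y \<xi>] g\<xi> y \<xi>ab by auto
  next
    case False
    then show ?thesis using diff[of \<xi> y] g\<xi> y \<xi>ab by auto
  qed
  then show "\<bar>g' x\<bar> \<le> 18 * A1 / (b - a)\<^sup>2 + A2" using x by (simp add: l_def)
  have "norm (g x - g x1) \<le> (18 * A1 / l\<^sup>2 + A2) * norm (x - x1)"
    by (rule field_differentiable_bound[of "{a..b}" g g']) (use g bound x in12 in auto)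
  also have "\<dots> \<le> (18 * A1 / l\<^sup>2 + A2) * l"
    using x in12 order_trans[OF abs_ge_zero bound[OF x]]
    by (intro mult_left_mono) (auto simp: l_def)
  finally show "\<bar>g x\<bar> \<le> 3 * A1 / (b - a) + (b - a) * (18 * A1 / (b - a)\<^sup>2 + A2)"
    using x1(2) unfolding l_def[symmetric] real_norm_def by (simp add: mult.commute)
qed

section \<open>Local propagation of smallness\<close>

text \<open>The two coefficients are (d/dx - i d/dy)/2 and (d/dx + i d/dy)/2 of a product u(x) v(y),
  the form of all terms of the extension \<open>W\<close>.\<close>

lemma has_wirtinger_separated:
  assumes u: "(u has_real_derivative u') (at (Re z))" and v: "(v has_real_derivative v') (at (Im z))"
  shows "has_wirtinger (\<lambda>z. of_real (u (Re z)) * of_real (v (Im z)))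
    ((of_real (u' * v (Im z)) - \<i> * of_real (u (Re z) * v')) / 2)
    ((of_real (u' * v (Im z)) + \<i> * of_real (u (Re z) * v')) / 2) z"
proof -
  have 1: "((\<lambda>z. u (Re z)) has_derivative (\<lambda>h. u' * Re h)) (at z)"
    using has_derivative_compose[OF has_derivative_Re[OF has_derivative_ident] u[unfolded has_field_derivative_def]] by simp
  have 2: "((\<lambda>z. v (Im z)) has_derivative (\<lambda>h. v' * Im h)) (at z)"
    using has_derivative_compose[OF has_derivative_Im[OF has_derivative_ident] v[unfolded has_field_derivative_def]] by simp
  have "((\<lambda>z. complex_of_real (u (Re z)) * of_real (v (Im z))) has_derivative
      (\<lambda>h. of_real (u (Re z)) * of_real (v' * Im h) + of_real (u' * Re h) * of_real (v (Im z)))) (at z)"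
    by (rule has_derivative_mult[OF has_derivative_of_real[OF 1] has_derivative_of_real[OF 2]])
  moreover have "(\<lambda>h. complex_of_real (u (Re z)) * of_real (v' * Im h) + of_real (u' * Re h) * of_real (v (Im z))) =
     (\<lambda>h. ((of_real (u' * v (Im z)) - \<i> * of_real (u (Re z) * v')) / 2) * h +
        ((of_real (u' * v (Im z)) + \<i> * of_real (u (Re z) * v')) / 2) * cnj h)"
    by (auto simp: fun_eq_iff complex_eq_iff field_simps)
  ultimately show ?thesis unfolding has_wirtinger_def by simp
qed

lemma has_wirtinger_cmult: "has_wirtinger f a b z \<Longrightarrow> has_wirtinger (\<lambda>z. c * f z) (c * a) (c * b) z"
  unfolding has_wirtinger_def by (auto intro!: derivative_eq_intros simp: algebra_simps)

lemma has_wirtinger_sum: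
  assumes "\<And>k. k \<in> S \<Longrightarrow> has_wirtinger (f k) (a k) (b k) z"
  shows "has_wirtinger (\<lambda>z. \<Sum>k\<in>S. f k z) (\<Sum>k\<in>S. a k) (\<Sum>k\<in>S. b k) z"
  using has_derivative_sum[of S f "\<lambda>k h. a k * h + b k * cnj h" "at z"] assms
  unfolding has_wirtinger_def by (simp add: sum.distrib sum_distrib_right)

lemma sinh_le_mult_cosh:
  fixes t :: real assumes "t \<ge> 0" shows "sinh t \<le> t * cosh t"
proof -
  have "0 * cosh 0 - sinh 0 \<le> t * cosh t - sinh (t::real)"
  proof (rule DERIV_nonneg_imp_nondecreasing[OF assms])
    fix x :: real assume "0 \<le> x"
    then show "\<exists>y. ((\<lambda>t. t * cosh t - sinh t) has_real_derivative y) (at x) \<and> 0 \<le> y"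
      by (intro exI[of _ "x * sinh x"]) (auto intro!: derivative_eq_intros)
  qed
  then show ?thesis by simp
qed

lemma cosh_le_exp_abs: "cosh (x::real) \<le> exp \<bar>x\<bar>"
proof -
  have "exp x \<le> exp \<bar>x\<bar>" "exp (- x) \<le> exp \<bar>x\<bar>" by simp_all
  then show ?thesis by (simp add: cosh_field_def del: exp_le_cancel_iff)
qed

text \<open>Keeps the stream function, which divides by the eigenvalue parameter, bounded uniformly
  for small \<open>c\<close>.\<close>

lemma abs_sinh_div_le:
  fixes c y :: real
  assumes "c > 0" shows "\<bar>sinh (c * y) / c\<bar> \<le> \<bar>y\<bar> * exp (c * \<bar>y\<bar>)"
proof -
  have "\<bar>sinh (c * y)\<bar> = sinh (c * \<bar>y\<bar>)"
  proof -
    have "\<bar>sinh t\<bar> = sinh \<bar>t\<bar>" for t :: real by (cases "t \<ge> 0") (auto simp: abs_if)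
    from this[of "c * y"] show ?thesis using assms by (simp add: abs_mult)
  qed
  also have "\<dots> \<le> (c * \<bar>y\<bar>) * cosh (c * \<bar>y\<bar>)" using assms by (intro sinh_le_mult_cosh) auto
  also have "\<dots> \<le> (c * \<bar>y\<bar>) * exp (c * \<bar>y\<bar>)"
    using assms cosh_le_exp_abs[of "c * \<bar>y\<bar>"] by (intro mult_left_mono) auto
  finally show ?thesis using assms by (simp add: field_simps)
qed

text \<open>Assumption \<open>A\<close> replaces any bound on the single f_k: it controls all
  combinations with multipliers bounded by X at once, so the estimates below do not see the number
  of eigenfunctions. In the application it comes from orthonormality and the Cauchy-Schwarz
  inequality.\<close>

locale eigenfunctions_on_interval =
  fixes V :: "real \<Rightarrow> real" and S :: "'i set" and f f' :: "'i \<Rightarrow> real \<Rightarrow> real" and ev :: "'i \<Rightarrow> real"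
    and a b m \<mu> A :: real
  assumes ab: "a < b" and S: "finite S" and m: "m > 0"
    and V: "V \<in> borel_measurable lebesgue" "\<And>x. x \<in> {a..b} \<Longrightarrow> 0 \<le> V x" "\<And>x. x \<in> {a..b} \<Longrightarrow> V x \<le> m\<^sup>2"
    and ev: "\<And>k. k \<in> S \<Longrightarrow> 0 < ev k" "\<And>k. k \<in> S \<Longrightarrow> ev k \<le> \<mu>"
    and f: "\<And>k x. k \<in> S \<Longrightarrow> x \<in> {a..b} \<Longrightarrow> (f k has_real_derivative f' k x) (at x within {a..b})"
      "\<And>k. k \<in> S \<Longrightarrow> continuous_on {a..b} (f' k)"
      "\<And>k x y. k \<in> S \<Longrightarrow> a \<le> x \<Longrightarrow> x \<le> y \<Longrightarrow> y \<le> b \<Longrightarrow>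
        ((\<lambda>t. (V t - (ev k)\<^sup>2) * f k t) has_integral (f' k y - f' k x)) {x..y}"
    and A: "\<And>\<alpha> X. 0 \<le> X \<Longrightarrow> (\<And>k. k \<in> S \<Longrightarrow> \<bar>\<alpha> k\<bar> \<le> X) \<Longrightarrow>
        integral {a..b} (\<lambda>x. \<bar>\<Sum>k\<in>S. \<alpha> k * f k x\<bar>) \<le> X * A"
    and \<mu>: "\<mu> \<ge> 0"
begin

lemma continuous_f: "k \<in> S \<Longrightarrow> continuous_on {a..b} (f k)"
  by (rule DERIV_continuous_on) (rule f(1))

text \<open>The factors of X A in \<open>sup_bound_from_integrals\<close> when the integral of |g|
  is at most X A and that of |g''| at most X A (m^2 + \<mu>^2): \<open>\<kappa>1\<close> for g',
  \<open>\<kappa>0\<close> for g.\<close>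

definition \<kappa>1 where "\<kappa>1 = 18 / (b - a)\<^sup>2 + m\<^sup>2 + \<mu>\<^sup>2"
definition \<kappa>0 where "\<kappa>0 = 3 / (b - a) + (b - a) * \<kappa>1"

text \<open>The second derivative of the combination g is V g minus the combination with multipliers
  \<alpha>_k ev_k^2. The latter are bounded by X \<mu>^2, so \<open>A\<close> applies to it
  again.\<close>

lemma combination_sup_bounds:
  assumes X: "0 \<le> X" and \<alpha>: "\<And>k. k \<in> S \<Longrightarrow> \<bar>\<alpha> k\<bar> \<le> X" and x: "x \<in> {a..b}"
  shows "\<bar>\<Sum>k\<in>S. \<alpha> k * f' k x\<bar> \<le> X * A * \<kappa>1" "\<bar>\<Sum>k\<in>S. \<alpha> k * f k x\<bar> \<le> X * A * \<kappa>0"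
proof -
  define g where "g = (\<lambda>x. \<Sum>k\<in>S. \<alpha> k * f k x)"
  define g' where "g' = (\<lambda>x. \<Sum>k\<in>S. \<alpha> k * f' k x)"
  define q where "q = (\<lambda>t. \<Sum>k\<in>S. \<alpha> k * ((V t - (ev k)\<^sup>2) * f k t))"
  have qg: "q t = V t * g t - (\<Sum>k\<in>S. (\<alpha> k * (ev k)\<^sup>2) * f k t)" for t
    by (simp add: q_def g_def sum_distrib_left sum_subtractf[symmetric] algebra_simps)
  have gd: "(g has_real_derivative g' x) (at x within {a..b})" if "x \<in> {a..b}" for x
    unfolding g_def g'_def by (intro DERIV_sum DERIV_cmult f(1) that)
  have qi: "(q has_integral (g' y - g' x)) {x..y}" if "a \<le> x" "x \<le> y" "y \<le> b" for x y
  proof -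
    have "(q has_integral (\<Sum>k\<in>S. \<alpha> k * (f' k y - f' k x))) {x..y}"
      unfolding q_def by (intro has_integral_sum S has_integral_mult_right f(3) that)
    then show ?thesis by (simp add: g'_def sum_subtractf right_diff_distrib)
  qed
  have cg: "continuous_on {a..b} g" "continuous_on {a..b} (\<lambda>t. \<Sum>k\<in>S. (\<alpha> k * (ev k)\<^sup>2) * f k t)"
    unfolding g_def by (intro continuous_intros continuous_f; assumption)+
  have bV: "\<bar>V x\<bar> \<le> m\<^sup>2" if "x \<in> {a..b}" for x using V that by simp
  have Vg: "(\<lambda>t. V t * g t) absolutely_integrable_on {a..b}"
    by (rule absolutely_integrable_bounded_times_continuous[OF V(1) bV cg(1)])
  have qa: "q absolutely_integrable_on {a..b}"
    unfolding qg by (intro set_integral_diff(1) Vg absolutely_integrable_continuous_real cg)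
  have A1: "integral {a..b} (\<lambda>x. \<bar>g x\<bar>) \<le> X * A" unfolding g_def by (rule A[OF X \<alpha>])
  have B1: "integral {a..b} (\<lambda>t. \<bar>\<Sum>k\<in>S. (\<alpha> k * (ev k)\<^sup>2) * f k t\<bar>) \<le> (X * \<mu>\<^sup>2) * A"
  proof (rule A)
    fix k assume k: "k \<in> S"
    have "\<bar>\<alpha> k\<bar> * (ev k)\<^sup>2 \<le> X * \<mu>\<^sup>2"
      using \<alpha>[OF k] ev[OF k] X by (intro mult_mono power_mono) auto
    then show "\<bar>\<alpha> k * (ev k)\<^sup>2\<bar> \<le> X * \<mu>\<^sup>2" by (simp add: abs_mult)
  qed (use X in simp)
  have A2: "integral {a..b} (\<lambda>x. \<bar>q x\<bar>) \<le> X * A * (m\<^sup>2 + \<mu>\<^sup>2)"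
  proof -
    have i: "(\<lambda>x. m\<^sup>2 * \<bar>g x\<bar>) integrable_on {a..b}" "(\<lambda>t. \<bar>\<Sum>k\<in>S. (\<alpha> k * (ev k)\<^sup>2) * f k t\<bar>) integrable_on {a..b}"
      using cg by (auto intro!: integrable_continuous_real continuous_intros)
    have "integral {a..b} (\<lambda>x. \<bar>q x\<bar>) \<le> integral {a..b} (\<lambda>x. m\<^sup>2 * \<bar>g x\<bar> + \<bar>\<Sum>k\<in>S. (\<alpha> k * (ev k)\<^sup>2) * f k x\<bar>)"
    proof (rule integral_le)
      show "(\<lambda>x. \<bar>q x\<bar>) integrable_on {a..b}" using qa by (simp add: absolutely_integrable_on_def)
      show "(\<lambda>x. m\<^sup>2 * \<bar>g x\<bar> + \<bar>\<Sum>k\<in>S. (\<alpha> k * (ev k)\<^sup>2) * f k x\<bar>) integrable_on {a..b}"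
        by (intro integrable_add i)
      fix x assume "x \<in> {a..b}"
      then have "\<bar>V x * g x\<bar> \<le> m\<^sup>2 * \<bar>g x\<bar>" unfolding abs_mult using bV by (intro mult_right_mono) auto
      then show "\<bar>q x\<bar> \<le> m\<^sup>2 * \<bar>g x\<bar> + \<bar>\<Sum>k\<in>S. (\<alpha> k * (ev k)\<^sup>2) * f k x\<bar>" unfolding qg by linarith
    qed
    also have "\<dots> = m\<^sup>2 * integral {a..b} (\<lambda>x. \<bar>g x\<bar>) + integral {a..b} (\<lambda>t. \<bar>\<Sum>k\<in>S. (\<alpha> k * (ev k)\<^sup>2) * f k t\<bar>)"
      using i by (subst Henstock_Kurzweil_Integration.integral_add) auto
    also have "\<dots> \<le> m\<^sup>2 * (X * A) + (X * \<mu>\<^sup>2) * A"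
      by (intro add_mono mult_left_mono A1 B1) auto
    finally show ?thesis by (simp add: algebra_simps)
  qed
  have 1: "18 * (X * A) / (b - a)\<^sup>2 + X * A * (m\<^sup>2 + \<mu>\<^sup>2) = X * A * \<kappa>1"
    by (simp add: \<kappa>1_def algebra_simps)
  have 2: "3 * (X * A) / (b - a) + (b - a) * (X * A * \<kappa>1) = X * A * \<kappa>0"
    by (simp add: \<kappa>0_def algebra_simps)
  show "\<bar>\<Sum>k\<in>S. \<alpha> k * f' k x\<bar> \<le> X * A * \<kappa>1"
    using sup_bound_from_integrals(1)[OF ab gd qi qa A1 A2 x] unfolding 1 g'_def .
  show "\<bar>\<Sum>k\<in>S. \<alpha> k * f k x\<bar> \<le> X * A * \<kappa>0"
    using sup_bound_from_integrals(2)[OF ab gd qi qa A1 A2 x] unfolding 1 2 g_def .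
qed

text \<open>The harmonic extension \<open>\<Phi> = \<Sum> f\<^sub>k cosh (ev\<^sub>k y)\<close> and its stream function combine into
  \<open>W = \<Phi> + \<i> \<Psi>\<close>, with $2 \bar\partial W = q \overline{W}$ for \<open>q = w' / w\<close>.  The stream function
  vanishes on the real axis, where \<open>W\<close> is \<open>\<Sum> f\<^sub>k\<close>.\<close>

lemma first_order_system:
  assumes Y: "Y > 0"
  shows "\<exists>W k a'. (\<forall>z. a < Re z \<and> Re z < b \<longrightarrow> has_wirtinger W (a' z) (k z * cnj (W z)) z) \<and>
    continuous_on {z. a \<le> Re z \<and> Re z \<le> b} a' \<and> continuous_on {z. a \<le> Re z \<and> Re z \<le> b} k \<and>
    (\<forall>z. a \<le> Re z \<and> Re z \<le> b \<longrightarrow> norm (k z) \<le> m / 2) \<and>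
    (\<forall>x. W (of_real x) = of_real (\<Sum>k\<in>S. f k x)) \<and>
    (\<forall>z. a \<le> Re z \<and> Re z \<le> b \<and> \<bar>Im z\<bar> \<le> Y \<longrightarrow>
       norm (W z) \<le> exp (\<mu> * Y) * A * (\<kappa>0 + Y * \<kappa>1 + Y * m * \<kappa>0))"
proof -
  have bV: "\<bar>V x\<bar> \<le> m\<^sup>2" if "x \<in> {a..b}" for x using V that by simp
  obtain w w' where w: "\<And>x. x \<in> {a..b} \<Longrightarrow> (w has_real_derivative w' x) (at x within {a..b})"
    "continuous_on {a..b} w'" "\<And>x. x \<in> {a..b} \<Longrightarrow> 1 \<le> w x" "\<And>x. x \<in> {a..b} \<Longrightarrow> 0 \<le> w' x"
    "\<And>x. x \<in> {a..b} \<Longrightarrow> w' x \<le> m * w x"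
    "\<And>x y. a \<le> x \<Longrightarrow> x \<le> y \<Longrightarrow> y \<le> b \<Longrightarrow> ((\<lambda>t. V t * w t) has_integral (w' y - w' x)) {x..y}"
    using positive_solution_exists[OF less_imp_le[OF ab] V m] by blast
  have w0: "w x > 0" if "x \<in> {a..b}" for x using w(3)[OF that] by simp
  have cw: "continuous_on {a..b} w" by (rule DERIV_continuous_on) (rule w(1))
  define q where "q = (\<lambda>x. w' x / w x)"
  have cq: "continuous_on {a..b} q"
    unfolding q_def by (intro continuous_intros w(2) cw) (use w0 in force)
  have qm: "0 \<le> q x" "q x \<le> m" if "x \<in> {a..b}" for x
    using w(4,5)[OF that] w0[OF that] by (auto simp: q_def field_simps)
  \<comment> \<open>The logarithmically corrected derivative, equal to the Wronskian of w and f_k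
    divided by w; \<open>Bf'\<close> is its classical derivative.\<close>
  define Bf where "Bf = (\<lambda>k x. f' k x - q x * f k x)"
  define Bf' where "Bf' = (\<lambda>k x. - (ev k)\<^sup>2 * f k x - q x * Bf k x)"
  have cB: "continuous_on {a..b} (Bf k)" "continuous_on {a..b} (Bf' k)" if "k \<in> S" for k
    unfolding Bf'_def Bf_def by (intro continuous_intros cq continuous_f f(2) that)+
  have Bd: "(Bf k has_real_derivative Bf' k x) (at x within {a..b})" if k: "k \<in> S" and x: "x \<in> {a..b}" for k x
    using logarithmic_correction_derivative[OF V(1) bV w(1) w(2) w0 w(6) f(1)[OF k] f(2)[OF k] f(3)[OF k] x]
    unfolding Bf'_def Bf_def q_def by simp
  have inter: "at x within {a..b} = at x" if "a < x" "x < b" for x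
    using that by (intro at_within_interior) auto
  define W where "W = (\<lambda>z. \<Sum>k\<in>S. of_real (f k (Re z)) * of_real (cosh (ev k * Im z)) +
      \<i> * (of_real (Bf k (Re z)) * of_real (sinh (ev k * Im z) / ev k)))"
  define a' where "a' = (\<lambda>z. \<Sum>k\<in>S.
      (of_real (f' k (Re z) * cosh (ev k * Im z)) - \<i> * of_real (f k (Re z) * (ev k * sinh (ev k * Im z)))) / 2 +
      \<i> * ((of_real (Bf' k (Re z) * (sinh (ev k * Im z) / ev k)) - \<i> * of_real (Bf k (Re z) * cosh (ev k * Im z))) / 2))"
  define K where "K = (\<lambda>z. complex_of_real (q (Re z) / 2))"
  have hw: "has_wirtinger W (a' z) (K z * cnj (W z)) z" if z: "a < Re z" "Re z < b" for z
  proof -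
    have xin: "Re z \<in> {a..b}" using z by auto
    have t: "has_wirtinger (\<lambda>z. of_real (f k (Re z)) * of_real (cosh (ev k * Im z)) +
        \<i> * (of_real (Bf k (Re z)) * of_real (sinh (ev k * Im z) / ev k)))
      ((of_real (f' k (Re z) * cosh (ev k * Im z)) - \<i> * of_real (f k (Re z) * (ev k * sinh (ev k * Im z)))) / 2 +
        \<i> * ((of_real (Bf' k (Re z) * (sinh (ev k * Im z) / ev k)) - \<i> * of_real (Bf k (Re z) * cosh (ev k * Im z))) / 2))
      ((of_real (f' k (Re z) * cosh (ev k * Im z)) + \<i> * of_real (f k (Re z) * (ev k * sinh (ev k * Im z)))) / 2 +
        \<i> * ((of_real (Bf' k (Re z) * (sinh (ev k * Im z) / ev k)) + \<i> * of_real (Bf k (Re z) * cosh (ev k * Im z))) / 2)) z"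
      if k: "k \<in> S" for k
    proof (intro has_wirtinger_add has_wirtinger_cmult has_wirtinger_separated)
      show "(f k has_real_derivative f' k (Re z)) (at (Re z))"
        using f(1)[OF k xin] inter[OF z] by simp
      show "(Bf k has_real_derivative Bf' k (Re z)) (at (Re z))"
        using Bd[OF k xin] inter[OF z] by simp
      show "((\<lambda>y. cosh (ev k * y)) has_real_derivative ev k * sinh (ev k * Im z)) (at (Im z))"
        by (auto intro!: derivative_eq_intros)
      show "((\<lambda>y. sinh (ev k * y) / ev k) has_real_derivative cosh (ev k * Im z)) (at (Im z))"
        using ev(1)[OF k] by (auto intro!: derivative_eq_intros)
    qed
    \<comment> \<open>Twice the left side has real part (f' - Bf) cosh = q f cosh and imaginary part
      (ev f + Bf' / ev) sinh = - q Bf sinh / ev: the correction was chosen so that both carry the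
      same factor q.\<close>
    have b: "(of_real (f' k (Re z) * cosh (ev k * Im z)) + \<i> * of_real (f k (Re z) * (ev k * sinh (ev k * Im z)))) / 2 +
        \<i> * ((of_real (Bf' k (Re z) * (sinh (ev k * Im z) / ev k)) + \<i> * of_real (Bf k (Re z) * cosh (ev k * Im z))) / 2)
      = K z * cnj (of_real (f k (Re z)) * of_real (cosh (ev k * Im z)) +
        \<i> * (of_real (Bf k (Re z)) * of_real (sinh (ev k * Im z) / ev k)))" if k: "k \<in> S" for k
      using ev(1)[OF k] unfolding K_def Bf'_def Bf_def
      by (simp add: complex_eq_iff field_simps power2_eq_square)
    have "K z * cnj (W z) = (\<Sum>k\<in>S. K z * cnj (of_real (f k (Re z)) * of_real (cosh (ev k * Im z)) +
        \<i> * (of_real (Bf k (Re z)) * of_real (sinh (ev k * Im z) / ev k))))"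
      unfolding W_def cnj_sum sum_distrib_left ..
    also have "\<dots> = (\<Sum>k\<in>S. (of_real (f' k (Re z) * cosh (ev k * Im z)) + \<i> * of_real (f k (Re z) * (ev k * sinh (ev k * Im z)))) / 2 +
        \<i> * ((of_real (Bf' k (Re z) * (sinh (ev k * Im z) / ev k)) + \<i> * of_real (Bf k (Re z) * cosh (ev k * Im z))) / 2))"
      by (rule sum.cong[OF refl]) (rule b[symmetric])
    finally show ?thesis using has_wirtinger_sum[OF t] unfolding W_def a'_def by simp
  qed
  let ?Z = "{z. a \<le> Re z \<and> Re z \<le> b}"
  have cRe: "continuous_on ?Z (\<lambda>z. h (Re z))" if "continuous_on {a..b} h" for h :: "real \<Rightarrow> real"
    by (rule continuous_on_compose2[OF that]) (auto intro!: continuous_intros)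
  have ca': "continuous_on ?Z a'"
    unfolding a'_def
    by (intro continuous_intros cRe continuous_f f(2) cB) (use ev in force)+
  have cK: "continuous_on ?Z K"
    unfolding K_def by (intro continuous_intros cRe cq) auto
  have Km: "norm (K z) \<le> m / 2" if "a \<le> Re z" "Re z \<le> b" for z
    using qm[of "Re z"] that by (simp add: K_def)
  have Wx: "W (of_real x) = of_real (\<Sum>k\<in>S. f k x)" for x
    by (simp add: W_def)
  have WB: "norm (W z) \<le> exp (\<mu> * Y) * A * (\<kappa>0 + Y * \<kappa>1 + Y * m * \<kappa>0)"
    if z: "a \<le> Re z" "Re z \<le> b" "\<bar>Im z\<bar> \<le> Y" for z
  proof -
    have xin: "Re z \<in> {a..b}" using z by auto
    let ?c = "\<lambda>k. cosh (ev k * Im z)" and ?s = "\<lambda>k. sinh (ev k * Im z) / ev k"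
    have e: "exp (ev k * \<bar>Im z\<bar>) \<le> exp (\<mu> * Y)" if "k \<in> S" for k
      using ev[OF that] z(3) by (simp add: mult_mono)
    have c: "\<bar>?c k\<bar> \<le> exp (\<mu> * Y)" if k: "k \<in> S" for k
      using order_trans[OF cosh_le_exp_abs[of "ev k * Im z"]] ev(1)[OF k] e[OF k]
      by (simp add: abs_mult del: exp_le_cancel_iff)
    have s: "\<bar>?s k\<bar> \<le> Y * exp (\<mu> * Y)" if k: "k \<in> S" for k
    proof -
      have "\<bar>?s k\<bar> \<le> \<bar>Im z\<bar> * exp (ev k * \<bar>Im z\<bar>)" by (rule abs_sinh_div_le[OF ev(1)[OF k]])
      also have "\<dots> \<le> Y * exp (\<mu> * Y)" using e[OF k] z(3) Y by (intro mult_mono) auto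
      finally show ?thesis .
    qed
    \<comment> \<open>Both parts of W(z) are combinations of f_k and f_k' at Re z, with multipliers
      depending only on Im z, so \<open>combination_sup_bounds\<close> applies.\<close>
    have Re: "Re (W z) = (\<Sum>k\<in>S. ?c k * f k (Re z))" by (simp add: W_def mult.commute)
    have Im: "Im (W z) = (\<Sum>k\<in>S. ?s k * f' k (Re z)) - q (Re z) * (\<Sum>k\<in>S. ?s k * f k (Re z))"
      by (simp add: W_def Bf_def sum_distrib_left sum_subtractf[symmetric] algebra_simps)
    have "0 \<le> Y * exp (\<mu> * Y)" using Y by simp
    note sb = combination_sup_bounds[where \<alpha> = ?s, OF this s xin]
    have "\<bar>q (Re z) * (\<Sum>k\<in>S. ?s k * f k (Re z))\<bar> \<le> m * (Y * exp (\<mu> * Y) * A * \<kappa>0)"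
      unfolding abs_mult using qm[OF xin] m sb(2) by (intro mult_mono) auto
    then have "\<bar>Im (W z)\<bar> \<le> Y * exp (\<mu> * Y) * A * \<kappa>1 + m * (Y * exp (\<mu> * Y) * A * \<kappa>0)"
      unfolding Im using sb(1) by linarith
    moreover have "\<bar>Re (W z)\<bar> \<le> exp (\<mu> * Y) * A * \<kappa>0"
      unfolding Re by (rule combination_sup_bounds(2)[OF _ c xin]) auto
    ultimately have "norm (W z) \<le> exp (\<mu> * Y) * A * \<kappa>0 + (Y * exp (\<mu> * Y) * A * \<kappa>1 + m * (Y * exp (\<mu> * Y) * A * \<kappa>0))"
      using cmod_le[of "W z"] by linarith
    then show ?thesis by (simp add: algebra_simps)
  qed
  show ?thesis
    using hw ca' cK Km Wx WB by (intro exI[of _ W] exI[of _ K] exI[of _ a']) blast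
qed

end

text \<open>Nested radii: nodes and target in radius l, interpolation on radius 5 l, H holomorphic
  in radius 6 l, similarity principle in radius 7 l, equation on half-width 8 l. The coefficient of
  the d-bar equation is q/2, so |s| \<le> 2 (7 l) (m/2) + 1 = \<sigma>. One factor exp \<sigma>
  arises in passing from W to H and one in passing back.\<close>

lemma local_propagation_of_smallness:
  assumes loc: "eigenfunctions_on_interval V S f f' ev (x0 - 8 * l) (x0 + 8 * l) m \<mu> A" and l: "l > 0"
    and E: "finite E" "E \<subseteq> {x0 - l..x0 + l}" "card E = N"
    and sep: "\<And>x y. x \<in> E \<Longrightarrow> y \<in> E \<Longrightarrow> x \<noteq> y \<Longrightarrow> d \<le> \<bar>x - y\<bar>" and d: "d > 0"
    and \<epsilon>: "\<And>x. x \<in> E \<Longrightarrow> \<bar>\<Sum>k\<in>S. f k x\<bar> \<le> \<epsilon>" "\<epsilon> \<ge> 0"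
    and x: "x \<in> {x0 - l..x0 + l}"
    and \<sigma>: "\<sigma> = 7 * l * m + 1"
    and \<kappa>1: "\<kappa>1 = 18 / (16 * l)\<^sup>2 + m\<^sup>2 + \<mu>\<^sup>2" and \<kappa>0: "\<kappa>0 = 3 / (16 * l) + 16 * l * \<kappa>1"
    and B: "B = exp (\<mu> * (7 * l)) * A * (\<kappa>0 + 7 * l * \<kappa>1 + 7 * l * m * \<kappa>0)"
  shows "\<bar>\<Sum>k\<in>S. f k x\<bar> \<le> exp (2 * \<sigma>) * (2 * real N * \<epsilon> * (6 * l / d) ^ (N - 1) + B / 2 ^ N)"
proof -
  interpret eigenfunctions_on_interval V S f f' ev "x0 - 8 * l" "x0 + 8 * l" m \<mu> A by (rule loc)
  have \<kappa>eq: "local.\<kappa>1 = \<kappa>1" "local.\<kappa>0 = \<kappa>0"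
    unfolding local.\<kappa>0_def local.\<kappa>1_def \<kappa>1 \<kappa>0 by simp_all
  define c where "c = complex_of_real x0"
  have "7 * l > 0" using l by simp
  note fos = first_order_system[OF this, unfolded \<kappa>eq, folded B]
  obtain W k a' where W:
    "\<forall>z. x0 - 8 * l < Re z \<and> Re z < x0 + 8 * l \<longrightarrow> has_wirtinger W (a' z) (k z * cnj (W z)) z"
    "continuous_on {z. x0 - 8 * l \<le> Re z \<and> Re z \<le> x0 + 8 * l} a'"
    "continuous_on {z. x0 - 8 * l \<le> Re z \<and> Re z \<le> x0 + 8 * l} k"
    "\<forall>z. x0 - 8 * l \<le> Re z \<and> Re z \<le> x0 + 8 * l \<longrightarrow> norm (k z) \<le> m / 2"
    "\<forall>x. W (of_real x) = of_real (\<Sum>k\<in>S. f k x)"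
    "\<forall>z. x0 - 8 * l \<le> Re z \<and> Re z \<le> x0 + 8 * l \<and> \<bar>Im z\<bar> \<le> 7 * l \<longrightarrow> norm (W z) \<le> B"
    using fos by blast
  note W = W[rule_format]
  have re: "x0 - 7 * l \<le> Re z \<and> Re z \<le> x0 + 7 * l \<and> \<bar>Im z\<bar> \<le> 7 * l" if "z \<in> cball c (7 * l)" for z
    using that abs_Re_le_cmod[of "z - c"] abs_Im_le_cmod[of "z - c"] by (auto simp: c_def dist_norm norm_minus_commute)
  have sub: "cball c (7 * l) \<subseteq> {z. x0 - 8 * l \<le> Re z \<and> Re z \<le> x0 + 8 * l}" using re l by force
  have B0: "0 \<le> B" using W(6)[of c] l by (auto simp: c_def intro: order_trans[OF norm_ge_zero])
  \<comment> \<open>Collects everything multiplied by the similarity error \<eta>; it does not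
    depend on \<eta>, so the terms disappear as \<eta> tends to 0.\<close>
  define C where "C = exp \<sigma> * (2 * real N * (6 * l / d) ^ (N - 1) + 1 / 2 ^ N) + exp \<sigma>"
  have "\<bar>\<Sum>k\<in>S. f k x\<bar> \<le> exp (2 * \<sigma>) * (2 * real N * \<epsilon> * (6 * l / d) ^ (N - 1) + B / 2 ^ N) + \<eta> * C" if \<eta>: "\<eta> > 0" for \<eta>
  proof -
    obtain s H where H: "H holomorphic_on ball c (6 * l)"
      "\<And>z. z \<in> ball c (6 * l) \<Longrightarrow> norm (s z) \<le> 2 * (7 * l) * (m / 2) + 1"
      "\<And>z. z \<in> ball c (6 * l) \<Longrightarrow> norm (W z * exp (- s z) - H z) \<le> \<eta>"
    proof -
      have "\<exists>s H. H holomorphic_on ball c (6 * l) \<and>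
        (\<forall>z\<in>ball c (6 * l). norm (s z) \<le> 2 * (7 * l) * (m / 2) + 1 \<and> norm (W z * exp (- s z) - H z) \<le> \<eta>)"
      proof (rule approximate_similarity_principle[OF _ _ _ _ _ _ \<eta>])
        show "has_wirtinger W (a' z) (k z * cnj (W z)) z" if "z \<in> cball c (7 * l)" for z
          using re[OF that] l by (intro W(1)) auto
        show "continuous_on (cball c (7 * l)) a'" "continuous_on (cball c (7 * l)) k"
          using W(2,3) sub continuous_on_subset by blast+
        show "norm (k z) \<le> m / 2" if "z \<in> cball c (7 * l)" for z
          using re[OF that] l by (intro W(4)) auto
      qed (use l in auto)
      then show ?thesis using that by blast
    qed
    have s: "norm (s z) \<le> \<sigma>" if "z \<in> ball c (6 * l)" for z using H(2)[OF that] by (simp add: \<sigma>)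
    have es: "norm (exp (- s z)) \<le> exp \<sigma>" "norm (exp (s z)) \<le> exp \<sigma>" if "z \<in> ball c (6 * l)" for z
      using s[OF that] abs_Re_le_cmod[of "s z"] by auto
    have HW: "norm (H z) \<le> exp \<sigma> * norm (W z) + \<eta>" if z: "z \<in> ball c (6 * l)" for z
    proof -
      have "norm (H z) \<le> norm (W z * exp (- s z)) + norm (W z * exp (- s z) - H z)"
        by (metis norm_minus_commute norm_triangle_sub add.commute)
      also have "norm (W z * exp (- s z)) \<le> norm (W z) * exp \<sigma>"
        unfolding norm_mult by (intro mult_left_mono es z) auto
      finally show ?thesis using H(3)[OF z] by (simp add: mult.commute)
    qed
    have xs: "of_real y \<in> cball c l" "of_real y \<in> ball c (6 * l)" if "y \<in> {x0 - l..x0 + l}" for y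
    proof -
      have "dist c (of_real y) = \<bar>x0 - y\<bar>" unfolding c_def dist_norm by (metis norm_of_real of_real_diff)
      then show "of_real y \<in> cball c l" "of_real y \<in> ball c (6 * l)" using that l by auto
    qed
    have "norm (H (of_real x)) \<le> 2 * real N * (exp \<sigma> * \<epsilon> + \<eta>) * (6 * l / d) ^ (N - 1) + (exp \<sigma> * B + \<eta>) / 2 ^ N"
    proof (rule holomorphic_small_on_separated_nodes[OF l _ H(1), where E = "complex_of_real ` E"])
      show "card (complex_of_real ` E) = N" using E by (simp add: card_image inj_on_def)
      show "complex_of_real ` E \<subseteq> cball c l" using xs(1) E(2) by auto
      show "d \<le> dist y z" if yz: "y \<in> complex_of_real ` E" "z \<in> complex_of_real ` E" "y \<noteq> z" for y z
      proof -
        obtain u v where "u \<in> E" "v \<in> E" "y = of_real u" "z = of_real v" using yz(1,2) by blast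
        then show ?thesis using sep[of u v] yz(3) unfolding dist_norm by (metis norm_of_real of_real_diff)
      qed
      show "norm (H y) \<le> exp \<sigma> * \<epsilon> + \<eta>" if y: "y \<in> complex_of_real ` E" for y
      proof -
        obtain u where u: "u \<in> E" "y = of_real u" using y by blast
        have "norm (W y) \<le> \<epsilon>" unfolding u(2) W(5) norm_of_real by (rule \<epsilon>(1)[OF u(1)])
        then have "exp \<sigma> * norm (W y) \<le> exp \<sigma> * \<epsilon>" by simp
        moreover have "norm (H y) \<le> exp \<sigma> * norm (W y) + \<eta>"
          unfolding u(2) by (rule HW[OF xs(2)]) (use u(1) E(2) in blast)
        ultimately show ?thesis by linarith
      qed
      show "norm (H z) \<le> exp \<sigma> * B + \<eta>" if z: "z \<in> ball c (6 * l)" for z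
      proof -
        have "z \<in> cball c (7 * l)" using z l by auto
        then have "norm (W z) \<le> B" using re[of z] l by (intro W(6)) auto
        then have "exp \<sigma> * norm (W z) \<le> exp \<sigma> * B" by simp
        then show ?thesis using HW[OF z] by linarith
      qed
    qed (use E d xs[OF x] \<epsilon> \<eta> l in auto)
    moreover have "\<bar>\<Sum>k\<in>S. f k x\<bar> \<le> exp \<sigma> * (norm (H (of_real x)) + \<eta>)"
    proof -
      let ?z = "complex_of_real x"
      have "\<bar>\<Sum>k\<in>S. f k x\<bar> = norm (W ?z)" unfolding W(5) by (simp only: norm_of_real)
      also have "W ?z = exp (s ?z) * (W ?z * exp (- s ?z))" by (simp add: exp_minus)
      also have "norm \<dots> \<le> exp \<sigma> * norm (W ?z * exp (- s ?z))"
        unfolding norm_mult[of "exp (s ?z)"] by (intro mult_right_mono es xs[OF x]) auto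
      also have "norm (W ?z * exp (- s ?z)) \<le> norm (H ?z) + \<eta>"
        using H(3)[OF xs(2)[OF x]] norm_triangle_sub[of "W ?z * exp (- s ?z)" "H ?z"] by linarith
      finally show ?thesis by simp
    qed
    ultimately have "\<bar>\<Sum>k\<in>S. f k x\<bar> \<le> exp \<sigma> * ((2 * real N * (exp \<sigma> * \<epsilon> + \<eta>) * (6 * l / d) ^ (N - 1) + (exp \<sigma> * B + \<eta>) / 2 ^ N) + \<eta>)"
      by (meson add_right_mono exp_ge_zero mult_left_mono order_trans)
    also have "\<dots> = exp \<sigma> * exp \<sigma> * (2 * real N * \<epsilon> * (6 * l / d) ^ (N - 1) + B / 2 ^ N) + \<eta> * C"
      by (simp add: C_def algebra_simps add_divide_distrib)
    also have "exp \<sigma> * exp \<sigma> = exp (2 * \<sigma>)" by (simp flip: exp_add)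
    finally show ?thesis .
  qed
  moreover have "((\<lambda>\<eta>. exp (2 * \<sigma>) * (2 * real N * \<epsilon> * (6 * l / d) ^ (N - 1) + B / 2 ^ N) + \<eta> * C) \<longlongrightarrow>
      exp (2 * \<sigma>) * (2 * real N * \<epsilon> * (6 * l / d) ^ (N - 1) + B / 2 ^ N) + 0 * C) (at_right 0)"
    by (intro tendsto_intros)
  ultimately have "\<bar>\<Sum>k\<in>S. f k x\<bar> \<le> exp (2 * \<sigma>) * (2 * real N * \<epsilon> * (6 * l / d) ^ (N - 1) + B / 2 ^ N) + 0 * C"
    by (intro tendsto_lowerbound) (auto simp: eventually_at_filter)
  then show ?thesis by simp
qed

section \<open>Eigenfunctions of the Schroedinger operator\<close>

lemma mult_le_sum_squares: "x * y \<le> x\<^sup>2 + (y::real)\<^sup>2"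
  using sum_squares_bound[of x y] sum_power2_ge_zero[of x y] by (simp only: mult.assoc)

lemma L2_mult_integrable:
  assumes "f \<in> L2" "g \<in> L2"
  shows "integrable lebesgue (\<lambda>x. f x * cnj (g x))"
proof (rule Bochner_Integration.integrable_bound[where f = "\<lambda>x. (norm (f x))\<^sup>2 + (norm (g x))\<^sup>2"])
  show "integrable lebesgue (\<lambda>x. (norm (f x))\<^sup>2 + (norm (g x))\<^sup>2)"
    using assms by (auto simp: L2_def)
  have "f \<in> borel_measurable lebesgue" "g \<in> borel_measurable lebesgue" using assms by (auto simp: L2_def)
  then show "(\<lambda>x. f x * cnj (g x)) \<in> borel_measurable lebesgue"
    by (intro borel_measurable_times) (auto intro: borel_measurable_continuous_on[of cnj] continuous_intros)
  show "AE x in lebesgue. norm (f x * cnj (g x)) \<le> norm ((norm (f x))\<^sup>2 + (norm (g x))\<^sup>2)"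
  proof (rule AE_I2)
    fix x
    show "norm (f x * cnj (g x)) \<le> norm ((norm (f x))\<^sup>2 + (norm (g x))\<^sup>2)"
      using mult_le_sum_squares[of "norm (f x)" "norm (g x)"] by (simp add: norm_mult)
  qed
qed

lemma orthonormal_combination:
  assumes \<phi>: "orthonormal_basis \<phi>" and S: "finite S"
  shows "integrable lebesgue (\<lambda>x. (norm (\<Sum>k\<in>S. d k * \<phi> k x))\<^sup>2)"
    and "(LINT x|lebesgue. (norm (\<Sum>k\<in>S. d k * \<phi> k x))\<^sup>2) = (\<Sum>k\<in>S. (norm (d k))\<^sup>2)"
proof -
  have L: "\<phi> k \<in> L2" for k using \<phi> by (simp add: orthonormal_basis_def)
  have o: "(LINT x|lebesgue. \<phi> j x * cnj (\<phi> k x)) = (if j = k then 1 else 0)" for j k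
    using \<phi> by (simp add: orthonormal_basis_def l2_inner_def)
  have eq: "complex_of_real ((norm (\<Sum>k\<in>S. d k * \<phi> k x))\<^sup>2) =
      (\<Sum>j\<in>S. \<Sum>k\<in>S. d j * cnj (d k) * (\<phi> j x * cnj (\<phi> k x)))" for x
    unfolding complex_norm_square cnj_sum sum_product by (simp add: mult_ac)
  have i: "integrable lebesgue (\<lambda>x. d j * cnj (d k) * (\<phi> j x * cnj (\<phi> k x)))" for j k
    using L2_mult_integrable[OF L L] by simp
  have ii: "integrable lebesgue (\<lambda>x. \<Sum>j\<in>S. \<Sum>k\<in>S. d j * cnj (d k) * (\<phi> j x * cnj (\<phi> k x)))"
    by (intro Bochner_Integration.integrable_sum i)
  have int: "integrable lebesgue (\<lambda>x. complex_of_real ((norm (\<Sum>k\<in>S. d k * \<phi> k x))\<^sup>2))"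
    unfolding eq by (rule ii)
  then show "integrable lebesgue (\<lambda>x. (norm (\<Sum>k\<in>S. d k * \<phi> k x))\<^sup>2)"
    by (simp only: complex_of_real_integrable_eq)
  have "complex_of_real (LINT x|lebesgue. (norm (\<Sum>k\<in>S. d k * \<phi> k x))\<^sup>2) =
     (LINT x|lebesgue. complex_of_real ((norm (\<Sum>k\<in>S. d k * \<phi> k x))\<^sup>2))"
    by (rule integral_complex_of_real[symmetric])
  also have "\<dots> = (\<Sum>j\<in>S. \<Sum>k\<in>S. d j * cnj (d k) * (if j = k then 1 else 0))"
    unfolding eq by (simp add: Bochner_Integration.integral_sum i Bochner_Integration.integrable_sum o del: of_real_power)
  also have "\<dots> = (\<Sum>j\<in>S. d j * cnj (d j))"
    using S by (simp add: if_distrib cong: if_cong)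
  also have "\<dots> = complex_of_real (\<Sum>k\<in>S. (norm (d k))\<^sup>2)"
    by (simp add: complex_norm_square del: of_real_power)
  finally show "(LINT x|lebesgue. (norm (\<Sum>k\<in>S. d k * \<phi> k x))\<^sup>2) = (\<Sum>k\<in>S. (norm (d k))\<^sup>2)"
    by (simp only: of_real_eq_iff)
qed

lemma nth_deriv_of_real:
  assumes "smooth g"
  shows "nth_deriv n (\<lambda>x. complex_of_real (g x)) = (\<lambda>x. of_real (nth_deriv n g x))"
proof (induction n)
  case (Suc n)
  have "((\<lambda>x. complex_of_real (nth_deriv n g x)) has_vector_derivative of_real (nth_deriv (Suc n) g x)) (at x)" for x
  proof (rule bounded_linear.has_vector_derivative[OF bounded_linear_of_real])
    show "(nth_deriv n g has_vector_derivative nth_deriv (Suc n) g x) (at x)"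
      using assms by (simp add: smooth_def nth_deriv_Suc vector_derivative_works)
  qed
  then show ?case unfolding nth_deriv_Suc[of n "\<lambda>x. complex_of_real (g x)"] Suc
    by (intro ext vector_derivative_at)
qed simp

lemma test_function_nth_deriv: "test_function g \<Longrightarrow> test_function (nth_deriv n g)"
proof (induction n arbitrary: g)
  case (Suc n)
  then show ?case unfolding nth_deriv_Suc_shift using test_function_nth_deriv_1 by blast
qed simp

text \<open>The action of the operator is prescribed only on Schwartz functions; this makes
  compactly supported test functions available for the weak equation.\<close>

lemma schwartz_of_test_function:
  assumes g: "test_function g"
  shows "(\<lambda>x. complex_of_real (g x)) \<in> schwartz"
proof -
  have sm: "smooth g" using g by (simp add: test_function_def)
  have d: "nth_deriv n (\<lambda>x. complex_of_real (g x)) differentiable (at x)" for n x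
  proof -
    have "smooth (nth_deriv n g)" using test_function_nth_deriv[OF g] by (simp add: test_function_def)
    then have "(nth_deriv n g has_vector_derivative nth_deriv 1 (nth_deriv n g) x) (at x)"
      by (rule smooth_has_derivative)
    from bounded_linear.has_vector_derivative[OF bounded_linear_of_real this]
    show ?thesis unfolding nth_deriv_of_real[OF sm] by (rule differentiableI_vector)
  qed
  have "\<exists>B. \<forall>x. \<bar>x\<bar> ^ m * norm (nth_deriv n (\<lambda>x. complex_of_real (g x)) x) \<le> B" for m n
  proof -
    let ?h = "\<lambda>x. \<bar>x\<bar> ^ m * \<bar>nth_deriv n g x\<bar>"
    obtain R where R: "R > 0" "\<And>x. \<bar>x\<bar> \<ge> R \<Longrightarrow> nth_deriv n g x = 0"
      using test_function_supportE[OF test_function_nth_deriv[OF g]] by metis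
    have "continuous_on {-R..R} ?h"
      using test_function_nth_deriv[OF g, of n] by (intro continuous_intros smooth_continuous_on) (simp add: test_function_def)
    then have "bounded (?h ` {-R..R})" by (intro compact_imp_bounded compact_continuous_image) auto
    then obtain B where B: "B > 0" "\<forall>y\<in>?h ` {-R..R}. norm y \<le> B" unfolding bounded_pos by blast
    have "?h x \<le> B" for x
    proof (cases "x \<in> {-R..R}")
      case True
      then show ?thesis using B(2) by fastforce
    next
      case False
      then show ?thesis using R(2)[of x] B(1) by auto
    qed
    then show ?thesis unfolding nth_deriv_of_real[OF sm] by auto
  qed
  then show ?thesis using d unfolding schwartz_def smooth_def by blast
qed

lemma L2_component_locally_integrable:
  assumes "\<phi> \<in> L2"
  shows "locally_integrable (\<lambda>x. Re (c * \<phi> x))"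
  unfolding locally_integrable_def
proof (intro allI)
  fix a b :: real
  have m: "(\<lambda>x. Re (c * \<phi> x)) \<in> borel_measurable lebesgue"
    using assms by (auto simp: L2_def)
  have i: "integrable lebesgue (\<lambda>x. (norm (\<phi> x))\<^sup>2)" using assms by (simp add: L2_def)
  show "(\<lambda>x. Re (c * \<phi> x)) absolutely_integrable_on {a..b}"
    unfolding set_integrable_def
  proof (rule Bochner_Integration.integrable_bound[where f = "\<lambda>x. indicat_real {a..b} x * (norm c)\<^sup>2 + (norm (\<phi> x))\<^sup>2"])
    show "integrable lebesgue (\<lambda>x. indicat_real {a..b} x * (norm c)\<^sup>2 + (norm (\<phi> x))\<^sup>2)"
    proof (intro Bochner_Integration.integrable_add integrable_mult_left i)
      show "integrable lebesgue (indicat_real {a..b})"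
        using lmeasurable_cbox[of a b] by (intro integrable_real_indicator) (auto simp: fmeasurable_def)
    qed
    show "(\<lambda>x. indicat_real {a..b} x *\<^sub>R Re (c * \<phi> x)) \<in> borel_measurable lebesgue"
      using m by (intro borel_measurable_scaleR borel_measurable_indicator) auto
    show "AE x in lebesgue. norm (indicat_real {a..b} x *\<^sub>R Re (c * \<phi> x)) \<le> norm (indicat_real {a..b} x * (norm c)\<^sup>2 + (norm (\<phi> x))\<^sup>2)"
    proof (rule AE_I2)
      fix x
      have "\<bar>Re (c * \<phi> x)\<bar> \<le> norm c * norm (\<phi> x)" using abs_Re_le_cmod[of "c * \<phi> x"] by (simp only: norm_mult)
      also have "\<dots> \<le> (norm c)\<^sup>2 + (norm (\<phi> x))\<^sup>2"
        by (rule mult_le_sum_squares)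
      finally show "norm (indicat_real {a..b} x *\<^sub>R Re (c * \<phi> x)) \<le> norm (indicat_real {a..b} x * (norm c)\<^sup>2 + (norm (\<phi> x))\<^sup>2)"
        by (auto simp: indicator_def)
    qed
  qed
qed

lemma locally_integrable_bounded_times:
  assumes V: "V \<in> borel_measurable lebesgue" "\<And>a b. \<exists>M. \<forall>x\<in>{a..b}. \<bar>V x\<bar> \<le> M" and f: "locally_integrable f"
  shows "locally_integrable (\<lambda>x. V x * f x)"
  unfolding locally_integrable_def
proof (intro allI absolutely_integrable_bounded_measurable_product_real)
  fix a b :: real
  show "V \<in> borel_measurable (lebesgue_on {a..b})" using V(1) by (rule measurable_restrict_space1)
  show "bounded (V ` {a..b})" using V(2)[of a b] unfolding bounded_iff by auto
  show "f absolutely_integrable_on {a..b}" using f by (simp add: locally_integrable_def)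
qed auto

text \<open>Self-adjointness enters as \<open>H = op_adjoint H\<close>: pairing (\<phi>, E \<phi>)
  with the graph element of a test function is the weak eigenvalue equation. The factor
  \<open>c\<close> absorbs the coefficients of u and selects real or imaginary parts.
  \<open>U\<close> is a representative of V bounded at every point of each compact interval.\<close>

lemma eigenfunction_regularity:
  assumes H: "schroedinger_operator V H" and \<phi>H: "(\<phi>, \<lambda>x. complex_of_real E * \<phi> x) \<in> H" and \<phi>: "\<phi> \<in> L2"
    and U: "U \<in> borel_measurable lebesgue" "\<And>a b. \<exists>M. \<forall>x\<in>{a..b}. \<bar>U x\<bar> \<le> M" "AE x in lebesgue. V x = U x"
  shows "\<exists>p p'. (AE x in lebesgue. Re (c * \<phi> x) = p x) \<and> (\<forall>x. (p has_real_derivative p' x) (at x)) \<and>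
    (\<forall>x y. x \<le> y \<longrightarrow> ((\<lambda>t. (U t - E) * p t) has_integral (p' y - p' x)) {x..y})"
proof -
  define \<theta> where "\<theta> = (\<lambda>x. Re (c * \<phi> x))"
  have \<theta>l: "locally_integrable \<theta>" unfolding \<theta>_def by (rule L2_component_locally_integrable[OF \<phi>])
  have UE: "(\<lambda>x. U x - E) \<in> borel_measurable lebesgue" using U(1) by measurable
  have UEb: "\<exists>M. \<forall>x\<in>{a..b}. \<bar>U x - E\<bar> \<le> M" for a b
  proof -
    obtain M where "\<forall>x\<in>{a..b}. \<bar>U x\<bar> \<le> M" using U(2) by blast
    then have "\<forall>x\<in>{a..b}. \<bar>U x - E\<bar> \<le> M + \<bar>E\<bar>" by fastforce
    then show ?thesis by blast
  qed
  have Ul: "locally_integrable (\<lambda>x. (U x - E) * \<theta> x)"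
    by (rule locally_integrable_bounded_times[OF UE UEb \<theta>l])
  have weak: "(LINT x|lebesgue. \<theta> x * nth_deriv 2 g x) = (LINT x|lebesgue. (U x - E) * \<theta> x * g x)"
    if g: "test_function g" for g
  proof -
    let ?F = "\<lambda>x. complex_of_real (g x)"
    let ?G = "\<lambda>x. - nth_deriv 2 ?F x + complex_of_real (V x) * ?F x"
    have sm: "smooth g" using g by (simp add: test_function_def)
    have FG: "(?F, ?G) \<in> H" using H schwartz_of_test_function[OF g] by (simp add: schroedinger_operator_def)
    have sa: "op_adjoint H = H" "H \<subseteq> L2 \<times> L2"
      using H by (auto simp: schroedinger_operator_def self_adjoint_def densely_defined_def)
    have L: "?F \<in> L2" "?G \<in> L2" "(\<lambda>x. complex_of_real E * \<phi> x) \<in> L2" using FG \<phi>H sa(2) by auto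
    have "(\<phi>, \<lambda>x. complex_of_real E * \<phi> x) \<in> op_adjoint H" using \<phi>H sa by simp
    then have "l2_inner ?G \<phi> = l2_inner ?F (\<lambda>x. complex_of_real E * \<phi> x)"
      using FG unfolding op_adjoint_def by blast
    then have e: "(LINT x|lebesgue. ?G x * cnj (\<phi> x)) = (LINT x|lebesgue. ?F x * cnj (complex_of_real E * \<phi> x))"
      by (simp add: l2_inner_def)
    note i1 = L2_mult_integrable[OF L(2) \<phi>] and i2 = L2_mult_integrable[OF L(1,3)]
    have re: "Re (cnj c * (LINT x|lebesgue. h x)) = (LINT x|lebesgue. Re (cnj c * h x))"
      "integrable lebesgue (\<lambda>x. Re (cnj c * h x))"
      if "integrable lebesgue h" for h :: "real \<Rightarrow> complex"
    proof -
      have "integrable lebesgue (\<lambda>x. cnj c * h x)" using that by simp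
      then show "integrable lebesgue (\<lambda>x. Re (cnj c * h x))" by (rule integrable_Re)
      show "Re (cnj c * (LINT x|lebesgue. h x)) = (LINT x|lebesgue. Re (cnj c * h x))"
        using \<open>integrable lebesgue (\<lambda>x. cnj c * h x)\<close> by (subst integral_Re) auto
    qed
    have p1: "Re (cnj c * (?G x * cnj (\<phi> x))) = (V x * g x - nth_deriv 2 g x) * \<theta> x" for x
      unfolding nth_deriv_of_real[OF sm] by (simp add: \<theta>_def algebra_simps)
    have p2: "Re (cnj c * (?F x * cnj (complex_of_real E * \<phi> x))) = E * g x * \<theta> x" for x
      by (simp add: \<theta>_def algebra_simps)
    have eq: "(LINT x|lebesgue. (V x * g x - nth_deriv 2 g x) * \<theta> x) = (LINT x|lebesgue. E * g x * \<theta> x)"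
      using re(1)[OF i1] re(1)[OF i2] e unfolding p1 p2 by simp
    have ia: "integrable lebesgue (\<lambda>x. E * g x * \<theta> x)" using re(2)[OF i2] unfolding p2 .
    have lti: "integrable lebesgue (\<lambda>x. h x * k x)" if "locally_integrable h" "test_function k" for h k :: "real \<Rightarrow> real"
      using test_function_supportE[OF that(2)] locally_integrable_times_compact_support(1)[OF that(1) smooth_continuous_on]
        that(2) unfolding test_function_def by metis
    have j1: "integrable lebesgue (\<lambda>x. \<theta> x * nth_deriv 2 g x)" by (rule lti[OF \<theta>l test_function_nth_deriv[OF g]])
    have j2: "integrable lebesgue (\<lambda>x. (U x - E) * \<theta> x * g x)" by (rule lti[OF Ul g])
    have "(LINT x|lebesgue. (V x * g x - nth_deriv 2 g x) * \<theta> x) =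
        (LINT x|lebesgue. ((U x - E) * \<theta> x * g x - \<theta> x * nth_deriv 2 g x) + E * g x * \<theta> x)"
    proof (rule integral_cong_AE)
      show "(\<lambda>x. (V x * g x - nth_deriv 2 g x) * \<theta> x) \<in> borel_measurable lebesgue"
        using re(2)[OF i1] unfolding p1 by auto
      show "(\<lambda>x. ((U x - E) * \<theta> x * g x - \<theta> x * nth_deriv 2 g x) + E * g x * \<theta> x) \<in> borel_measurable lebesgue"
        using j1 j2 ia by auto
      show "AE x in lebesgue. (V x * g x - nth_deriv 2 g x) * \<theta> x = ((U x - E) * \<theta> x * g x - \<theta> x * nth_deriv 2 g x) + E * g x * \<theta> x"
        using U(3) by eventually_elim (simp add: algebra_simps)
    qed
    also have "\<dots> = ((LINT x|lebesgue. (U x - E) * \<theta> x * g x) - (LINT x|lebesgue. \<theta> x * nth_deriv 2 g x)) + (LINT x|lebesgue. E * g x * \<theta> x)"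
      using j1 j2 ia by (subst Bochner_Integration.integral_add) auto
    finally show ?thesis using eq by simp
  qed
  have "\<exists>p p'. (AE x in lebesgue. \<theta> x = p x) \<and> (\<forall>x. (p has_real_derivative p' x) (at x)) \<and>
    (\<forall>x y. x \<le> y \<longrightarrow> ((\<lambda>t. (U t - E) * p t) has_integral (p' y - p' x)) {x..y})"
    by (rule weak_solution_regularity[OF \<theta>l Ul weak]) blast+
  then show ?thesis by (simp only: \<theta>_def)
qed

text \<open>The equation g'' = U g - G is tested with \<xi>^2 g, where \<xi> = 1 - (x/R)^2 vanishes
  at both ends and leaves no boundary terms. The gradient part is g' (\<xi>^2 g)' = (\<xi> g' +
  \<xi>' g)^2 - \<xi>'^2 g^2; the square is dropped and |\<xi>'|^2 \<le> 4/R^2. With the cutoff no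
  decay of g' or integrability of U g^2 on the line has to be known beforehand.\<close>

lemma cutoff_energy_estimate:
  fixes U g g' G :: "real \<Rightarrow> real"
  assumes R: "R > 0" and U: "U \<in> borel_measurable lebesgue" "\<And>x. x \<in> {-R..R} \<Longrightarrow> \<bar>U x\<bar> \<le> M"
    and g: "\<And>x. (g has_real_derivative g' x) (at x)" and g': "continuous_on UNIV g'" and G: "continuous_on UNIV G"
    and eq: "\<And>x y. x \<le> y \<Longrightarrow> ((\<lambda>t. U t * g t - G t) has_integral (g' y - g' x)) {x..y}"
    and \<mu>: "\<mu> > 0"
  shows "integral {-R..R} (\<lambda>x. (1 - (x / R)\<^sup>2)\<^sup>2 * (U x * (g x)\<^sup>2)) \<le>
    integral {-R..R} (\<lambda>x. (\<mu>\<^sup>2 * (g x)\<^sup>2 + (G x)\<^sup>2 / \<mu>\<^sup>2) / 2) + 4 / R\<^sup>2 * integral {-R..R} (\<lambda>x. (g x)\<^sup>2)"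
proof -
  define \<xi> where "\<xi> = (\<lambda>x. 1 - (x / R)\<^sup>2)"
  define \<xi>' where "\<xi>' = (\<lambda>x. - 2 * x / R\<^sup>2)"
  have \<xi>d: "(\<xi> has_real_derivative \<xi>' x) (at x within A)" for x A
    unfolding \<xi>_def \<xi>'_def using R by (auto intro!: derivative_eq_intros simp: power2_eq_square field_simps)
  have c: "continuous_on A \<xi>" "continuous_on A \<xi>'" for A
    unfolding \<xi>_def \<xi>'_def using R by (auto intro!: continuous_intros)
  have cg: "continuous_on A g" for A using g by (meson DERIV_continuous_on has_field_derivative_at_within)
  have cg': "continuous_on A g'" "continuous_on A G" for A using g' G continuous_on_subset by blast+
  let ?k = "\<lambda>x. (\<xi> x)\<^sup>2 * g x"
  let ?k' = "\<lambda>x. 2 * \<xi> x * \<xi>' x * g x + (\<xi> x)\<^sup>2 * g' x"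
  have aU: "(\<lambda>x. U x * h x) absolutely_integrable_on {-R..R}" if "continuous_on UNIV h" for h
    using that by (intro absolutely_integrable_bounded_times_continuous[OF U]) (auto intro: continuous_on_subset)
  have a: "(\<lambda>t. U t * g t - G t) absolutely_integrable_on {-R..R}"
    by (intro set_integral_diff(1) aU cg absolutely_integrable_continuous_real cg')
  have kd: "(?k has_real_derivative ?k' x) (at x within {-R..R})" for x
    using \<xi>d[of x "{-R..R}"] has_field_derivative_at_within[OF g[of x], of "{-R..R}"]
    by (auto intro!: derivative_eq_intros simp: power2_eq_square algebra_simps)
  have ibp: "((\<lambda>t. (U t * g t - G t) * ?k t + g' t * ?k' t) has_integral (g' R * ?k R - g' (-R) * ?k (-R))) {-R..R}"
    by (rule integration_by_parts_primitive[OF _ _ a kd]) (use R eq in \<open>auto intro!: continuous_intros c cg cg'\<close>)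
  have ib0: "((\<lambda>t. (U t * g t - G t) * ?k t + g' t * ?k' t) has_integral 0) {-R..R}"
    using ibp R by (simp add: \<xi>_def)
  have i1: "(\<lambda>x. (\<mu>\<^sup>2 * (g x)\<^sup>2 + (G x)\<^sup>2 / \<mu>\<^sup>2) / 2) integrable_on {-R..R}"
    by (intro integrable_continuous_real continuous_intros cg cg') (use \<mu> in auto)
  have i2: "(\<lambda>x. 4 / R\<^sup>2 * (g x)\<^sup>2) integrable_on {-R..R}"
    by (intro integrable_continuous_real continuous_intros cg)
  have i0: "(\<lambda>x. (\<xi> x)\<^sup>2 * (U x * (g x)\<^sup>2)) integrable_on {-R..R}"
  proof -
    have "(\<lambda>x. U x * ((\<xi> x)\<^sup>2 * (g x)\<^sup>2)) absolutely_integrable_on {-R..R}"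
      by (intro aU continuous_intros c cg)
    then show ?thesis by (simp add: absolutely_integrable_on_def mult.left_commute)
  qed
  have "integral {-R..R} (\<lambda>x. (\<xi> x)\<^sup>2 * (U x * (g x)\<^sup>2)) \<le>
     integral {-R..R} (\<lambda>x. ((U x * g x - G x) * ?k x + g' x * ?k' x) + ((\<mu>\<^sup>2 * (g x)\<^sup>2 + (G x)\<^sup>2 / \<mu>\<^sup>2) / 2 + 4 / R\<^sup>2 * (g x)\<^sup>2))"
  proof (rule integral_le[OF i0])
    show "(\<lambda>x. ((U x * g x - G x) * ?k x + g' x * ?k' x) + ((\<mu>\<^sup>2 * (g x)\<^sup>2 + (G x)\<^sup>2 / \<mu>\<^sup>2) / 2 + 4 / R\<^sup>2 * (g x)\<^sup>2)) integrable_on {-R..R}"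
      by (rule integrable_add[OF has_integral_integrable[OF ib0] integrable_add[OF i1 i2]])
    fix x assume x: "x \<in> {-R..R}"
    have xR: "x\<^sup>2 \<le> R\<^sup>2" using x by (intro abs_le_square_iff[THEN iffD1]) auto
    have \<xi>1: "0 \<le> (\<xi> x)\<^sup>2" "(\<xi> x)\<^sup>2 \<le> 1"
    proof -
      have "0 \<le> \<xi> x" "\<xi> x \<le> 1" using xR R by (auto simp: \<xi>_def power_divide)
      then show "0 \<le> (\<xi> x)\<^sup>2" "(\<xi> x)\<^sup>2 \<le> 1" by (auto intro: power_le_one)
    qed
    have \<xi>'2: "(\<xi>' x)\<^sup>2 \<le> 4 / R\<^sup>2"
    proof -
      have "(\<xi>' x)\<^sup>2 = 4 * x\<^sup>2 / (R\<^sup>2 * R\<^sup>2)" by (simp add: \<xi>'_def power2_eq_square)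
      also have "\<dots> \<le> 4 * R\<^sup>2 / (R\<^sup>2 * R\<^sup>2)" using xR by (intro divide_right_mono) auto
      also have "\<dots> = 4 / R\<^sup>2" using R by (simp add: field_simps power2_eq_square)
      finally show ?thesis .
    qed
    \<comment> \<open>Young's inequality weighted by \<mu>: for G with coefficients ev_k^2 \<le>
      \<mu>^2 both terms have the same bound after integration.\<close>
    have "(\<xi> x)\<^sup>2 * (G x * g x) \<le> (\<mu>\<^sup>2 * (g x)\<^sup>2 + (G x)\<^sup>2 / \<mu>\<^sup>2) / 2"
    proof -
      have "(\<mu> * \<bar>g x\<bar> - \<bar>G x\<bar> / \<mu>)\<^sup>2 = \<mu>\<^sup>2 * (g x)\<^sup>2 + (G x)\<^sup>2 / \<mu>\<^sup>2 - 2 * (\<bar>G x\<bar> * \<bar>g x\<bar>)"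
        using \<mu> by (simp add: power2_diff power_mult_distrib power_divide)
      then have 1: "\<bar>G x\<bar> * \<bar>g x\<bar> \<le> (\<mu>\<^sup>2 * (g x)\<^sup>2 + (G x)\<^sup>2 / \<mu>\<^sup>2) / 2"
        using zero_le_power2[of "\<mu> * \<bar>g x\<bar> - \<bar>G x\<bar> / \<mu>"] by simp
      have "(\<xi> x)\<^sup>2 * (G x * g x) \<le> (\<xi> x)\<^sup>2 * (\<bar>G x\<bar> * \<bar>g x\<bar>)"
        by (intro mult_left_mono \<xi>1(1)) (simp add: abs_mult[symmetric])
      also have "\<dots> \<le> 1 * (\<bar>G x\<bar> * \<bar>g x\<bar>)" by (intro mult_right_mono \<xi>1(2)) simp
      finally show ?thesis using 1 by linarith
    qed
    moreover have "(\<xi>' x)\<^sup>2 * (g x)\<^sup>2 \<le> 4 / R\<^sup>2 * (g x)\<^sup>2" using \<xi>'2 by (rule mult_right_mono) simp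
    moreover have "0 \<le> (\<xi> x * g' x + \<xi>' x * g x)\<^sup>2" by simp
    moreover have "((U x * g x - G x) * ?k x + g' x * ?k' x) =
        (\<xi> x)\<^sup>2 * (U x * (g x)\<^sup>2) - (\<xi> x)\<^sup>2 * (G x * g x) + (\<xi> x * g' x + \<xi>' x * g x)\<^sup>2 - (\<xi>' x)\<^sup>2 * (g x)\<^sup>2"
      by (simp add: power2_eq_square algebra_simps)
    ultimately show "(\<xi> x)\<^sup>2 * (U x * (g x)\<^sup>2) \<le>
      ((U x * g x - G x) * ?k x + g' x * ?k' x) + ((\<mu>\<^sup>2 * (g x)\<^sup>2 + (G x)\<^sup>2 / \<mu>\<^sup>2) / 2 + 4 / R\<^sup>2 * (g x)\<^sup>2)"
      by linarith
  qed
  also have "\<dots> = 0 + (integral {-R..R} (\<lambda>x. (\<mu>\<^sup>2 * (g x)\<^sup>2 + (G x)\<^sup>2 / \<mu>\<^sup>2) / 2) + integral {-R..R} (\<lambda>x. 4 / R\<^sup>2 * (g x)\<^sup>2))"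
    using has_integral_add[OF ib0 has_integral_add[OF integrable_integral[OF i1] integrable_integral[OF i2]]]
    by (rule integral_unique)
  finally show ?thesis by (simp add: \<xi>_def)
qed

section \<open>Localization and good points\<close>

text \<open>Greedy choice: the intervals of length 2 d around the points already chosen have too
  small a total measure to cover \<open>E\<close>.\<close>

lemma separated_points_in_set_of_positive_measure:
  fixes E :: "real set"
  assumes E: "E \<in> lmeasurable" and d: "d > 0" and "2 * d * real N < measure lebesgue E"
  shows "\<exists>F\<subseteq>E. finite F \<and> card F = N \<and> (\<forall>x\<in>F. \<forall>y\<in>F. x \<noteq> y \<longrightarrow> d \<le> \<bar>x - y\<bar>)"
  using assms(3)
proof (induction N)
  case 0
  then show ?case by (intro exI[of _ "{}"]) auto
next
  case (Suc N)
  have "2 * d * real N \<le> 2 * d * real (Suc N)" using d by simp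
  then obtain F where F: "F \<subseteq> E" "finite F" "card F = N" "\<And>x y. x \<in> F \<Longrightarrow> y \<in> F \<Longrightarrow> x \<noteq> y \<Longrightarrow> d \<le> \<bar>x - y\<bar>"
    using Suc by force
  define U where "U = (\<Union>x\<in>F. {x - d..x + d})"
  have "measure lebesgue U \<le> (\<Sum>x\<in>F. measure lebesgue {x - d..x + d})"
    unfolding U_def using F(2) by (intro measure_UNION_le) auto
  also have "\<dots> = 2 * d * real N" using d F(3) by simp
  finally have U: "measure lebesgue U < measure lebesgue E" using Suc.prems d by (simp add: algebra_simps)
  have "\<not> E \<subseteq> U"
  proof
    assume "E \<subseteq> U"
    moreover have "U \<in> lmeasurable" unfolding U_def using F(2)
      by (intro fmeasurable.finite_UN) auto
    ultimately have "measure lebesgue E \<le> measure lebesgue U"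
      using E by (intro measure_mono_fmeasurable) auto
    then show False using U by simp
  qed
  then obtain y where y: "y \<in> E" "y \<notin> U" by blast
  have yd: "d \<le> \<bar>x - y\<bar>" if "x \<in> F" for x using y(2) that unfolding U_def by fastforce
  have "y \<notin> F" using yd d by force
  then show ?case
    using F y(1) yd by (intro exI[of _ "insert y F"]) (auto simp: abs_minus_commute)
qed

text \<open>Chebyshev's inequality for the square of \<open>g\<close> on \<open>E\<close>.\<close>

lemma large_sublevel_set:
  fixes g :: "real \<Rightarrow> real"
  assumes E: "E \<in> lmeasurable" and g: "g \<in> borel_measurable lebesgue" and i: "set_integrable lebesgue E (\<lambda>x. (g x)\<^sup>2)"
    and \<epsilon>: "\<epsilon> > 0" and le: "(LINT x:E|lebesgue. (g x)\<^sup>2) \<le> \<epsilon>\<^sup>2 * \<delta>"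
  shows "{x \<in> E. \<bar>g x\<bar> \<le> \<epsilon>} \<in> lmeasurable" "measure lebesgue E - \<delta> \<le> measure lebesgue {x \<in> E. \<bar>g x\<bar> \<le> \<epsilon>}"
proof -
  let ?A = "{x \<in> E. \<bar>g x\<bar> \<le> \<epsilon>}" and ?B = "{x \<in> E. (g x)\<^sup>2 \<ge> \<epsilon>\<^sup>2}"
  have Es: "E \<in> sets lebesgue" using E by auto
  have "{x \<in> space lebesgue. \<bar>g x\<bar> \<le> \<epsilon>} \<in> sets lebesgue" "{x \<in> space lebesgue. (g x)\<^sup>2 \<ge> \<epsilon>\<^sup>2} \<in> sets lebesgue"
    using g by measurable
  then have s: "E \<inter> {x. \<bar>g x\<bar> \<le> \<epsilon>} \<in> sets lebesgue" "E \<inter> {x. (g x)\<^sup>2 \<ge> \<epsilon>\<^sup>2} \<in> sets lebesgue"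
    using Es by auto
  have AB: "?A = E \<inter> {x. \<bar>g x\<bar> \<le> \<epsilon>}" "?B = E \<inter> {x. (g x)\<^sup>2 \<ge> \<epsilon>\<^sup>2}" by auto
  show Am: "?A \<in> lmeasurable" unfolding AB using s by (intro fmeasurableI2[OF E]) auto
  have Bm: "?B \<in> lmeasurable" unfolding AB using s by (intro fmeasurableI2[OF E]) auto
  have "E \<subseteq> ?A \<union> ?B" using \<epsilon> by (auto simp: abs_le_square_iff[symmetric])
  then have "measure lebesgue E \<le> measure lebesgue (?A \<union> ?B)"
    using E Am Bm by (intro measure_mono_fmeasurable) auto
  also have "\<dots> \<le> measure lebesgue ?A + measure lebesgue ?B" using Am Bm by (intro measure_Un_le) auto
  also have "measure lebesgue ?B \<le> (LINT x:E|lebesgue. (g x)\<^sup>2) / \<epsilon>\<^sup>2"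
  proof -
    have "measure lebesgue {x \<in> space lebesgue. indicat_real E x *\<^sub>R (g x)\<^sup>2 \<ge> \<epsilon>\<^sup>2} \<le> (LINT x:E|lebesgue. (g x)\<^sup>2) / \<epsilon>\<^sup>2"
      unfolding set_lebesgue_integral_def
      using i \<epsilon> Es unfolding set_integrable_def by (intro integral_Markov_inequality_measure) auto
    also have "{x \<in> space lebesgue. indicat_real E x *\<^sub>R (g x)\<^sup>2 \<ge> \<epsilon>\<^sup>2} = ?B"
      using \<epsilon> by (auto simp: indicator_def split: if_splits)
    finally show ?thesis .
  qed
  also have "\<dots> \<le> \<delta>" using le \<epsilon> by (simp add: field_simps)
  finally show "measure lebesgue E - \<delta> \<le> measure lebesgue ?A" by simp
qed

section \<open>Localization of the mass\<close>

lemma tendsto_integral_exhaustion: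
  fixes h :: "real \<Rightarrow> real"
  assumes h: "integrable lebesgue h"
  shows "(\<lambda>n. integral {- real n..real n} h) \<longlonglongrightarrow> (LINT x|lebesgue. h x)"
proof -
  have "(\<lambda>n. LINT x|lebesgue. indicat_real {- real n..real n} x *\<^sub>R h x) \<longlonglongrightarrow> (LINT x|lebesgue. h x)"
  proof (rule integral_dominated_convergence[where w = "\<lambda>x. norm (h x)"])
    show "h \<in> borel_measurable lebesgue" using h by auto
    then show "(\<lambda>x. indicat_real {- real n..real n} x *\<^sub>R h x) \<in> borel_measurable lebesgue" for n
      by (intro borel_measurable_scaleR borel_measurable_indicator) auto
    show "AE x in lebesgue. (\<lambda>n. indicat_real {- real n..real n} x *\<^sub>R h x) \<longlonglongrightarrow> h x"
    proof (rule AE_I2)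
      fix x :: real
      obtain N where N: "\<bar>x\<bar> \<le> real N" using real_arch_simple by blast
      have "\<forall>\<^sub>F n in sequentially. indicat_real {- real n..real n} x *\<^sub>R h x = h x"
        using eventually_ge_at_top[of N]
      proof eventually_elim
        case (elim n)
        then have "\<bar>x\<bar> \<le> real n" using N by simp
        then show ?case by (auto simp: indicator_def abs_le_iff)
      qed
      then show "(\<lambda>n. indicat_real {- real n..real n} x *\<^sub>R h x) \<longlonglongrightarrow> h x"
        by (rule tendsto_eventually)
    qed
  qed (use h in \<open>auto simp: indicator_def\<close>)
  moreover have "(LINT x|lebesgue. indicat_real {- real n..real n} x *\<^sub>R h x) = integral {- real n..real n} h" for n
  proof -
    have "h absolutely_integrable_on {- real n..real n}"
      unfolding set_integrable_def using h by (intro integrable_mult_indicator) auto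
    from set_lebesgue_integral_eq_integral(2)[OF this] show ?thesis by (simp add: set_lebesgue_integral_def)
  qed
  ultimately show ?thesis by simp
qed

text \<open>The combination is the real part of an orthonormal sum with coefficients \<alpha>_k c_k,
  so Parseval bounds it independently of the number of terms. Serves both the energy estimate and
  the locale assumption \<open>A\<close>.\<close>

lemma combination_square_integral:
  fixes f :: "nat \<Rightarrow> real \<Rightarrow> real"
  assumes \<phi>: "orthonormal_basis \<phi>" and S: "finite S"
    and f: "\<And>k. k \<in> S \<Longrightarrow> AE x in lebesgue. Re (c k * \<phi> k x) = f k x"
    and X: "0 \<le> X" "\<And>k. k \<in> S \<Longrightarrow> \<bar>\<alpha> k\<bar> \<le> X"
    and cf: "\<And>k. k \<in> S \<Longrightarrow> continuous_on UNIV (f k)"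
  shows "integrable lebesgue (\<lambda>x. (\<Sum>k\<in>S. \<alpha> k * f k x)\<^sup>2)"
    and "integral {a..b} (\<lambda>x. (\<Sum>k\<in>S. \<alpha> k * f k x)\<^sup>2) \<le> X\<^sup>2 * (\<Sum>k\<in>S. (norm (c k))\<^sup>2)"
proof -
  define d where "d = (\<lambda>k. of_real (\<alpha> k) * c k)"
  have ae: "AE x in lebesgue. \<forall>k\<in>S. Re (c k * \<phi> k x) = f k x"
    using S f by (simp add: AE_finite_all)
  have ae2: "AE x in lebesgue. (\<Sum>k\<in>S. \<alpha> k * f k x) = Re (\<Sum>k\<in>S. d k * \<phi> k x)"
    using ae
  proof eventually_elim
    case (elim x)
    have "Re (\<Sum>k\<in>S. d k * \<phi> k x) = (\<Sum>k\<in>S. \<alpha> k * Re (c k * \<phi> k x))"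
      unfolding Re_sum by (intro sum.cong) (auto simp: d_def algebra_simps)
    also have "\<dots> = (\<Sum>k\<in>S. \<alpha> k * f k x)" using elim by (intro sum.cong) auto
    finally show ?case ..
  qed
  have le: "AE x in lebesgue. norm ((\<Sum>k\<in>S. \<alpha> k * f k x)\<^sup>2) \<le> norm ((norm (\<Sum>k\<in>S. d k * \<phi> k x))\<^sup>2)"
    using ae2
  proof eventually_elim
    case (elim x)
    show ?case unfolding elim using abs_Re_le_cmod[of "\<Sum>k\<in>S. d k * \<phi> k x"]
      by (simp del: Re_sum add: abs_le_square_iff[symmetric])
  qed
  have c: "continuous_on UNIV (\<lambda>x. (\<Sum>k\<in>S. \<alpha> k * f k x)\<^sup>2)" by (intro continuous_intros cf)
  have m: "(\<lambda>x. (\<Sum>k\<in>S. \<alpha> k * f k x)\<^sup>2) \<in> borel_measurable lebesgue"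
    using borel_measurable_continuous_onI[OF c] by (intro measurable_completion) simp
  show i: "integrable lebesgue (\<lambda>x. (\<Sum>k\<in>S. \<alpha> k * f k x)\<^sup>2)"
    by (rule Bochner_Integration.integrable_bound[OF orthonormal_combination(1)[OF \<phi> S] m le])
  have "integral {a..b} (\<lambda>x. (\<Sum>k\<in>S. \<alpha> k * f k x)\<^sup>2) \<le> integral UNIV (\<lambda>x. (\<Sum>k\<in>S. \<alpha> k * f k x)\<^sup>2)"
    using integrable_on_lebesgue[OF i] continuous_on_subset[OF c subset_UNIV, of "{a..b}"]
    by (intro integral_subset_le integrable_continuous_real) auto
  also have "\<dots> = (LINT x|lebesgue. (\<Sum>k\<in>S. \<alpha> k * f k x)\<^sup>2)" by (rule integral_lebesgue[OF i])
  also have "\<dots> \<le> (LINT x|lebesgue. (norm (\<Sum>k\<in>S. d k * \<phi> k x))\<^sup>2)"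
    using le by (intro integral_mono_AE i orthonormal_combination(1)[OF \<phi> S]) auto
  also have "\<dots> = (\<Sum>k\<in>S. (norm (d k))\<^sup>2)" by (rule orthonormal_combination(2)[OF \<phi> S])
  also have "\<dots> \<le> (\<Sum>k\<in>S. X\<^sup>2 * (norm (c k))\<^sup>2)"
  proof (rule sum_mono)
    fix k assume k: "k \<in> S"
    have "(\<alpha> k)\<^sup>2 \<le> X\<^sup>2" using X(2)[OF k] X(1) by (intro abs_le_square_iff[THEN iffD1]) auto
    then show "(norm (d k))\<^sup>2 \<le> X\<^sup>2 * (norm (c k))\<^sup>2"
      by (simp add: d_def norm_mult power_mult_distrib mult_right_mono)
  qed
  finally show "integral {a..b} (\<lambda>x. (\<Sum>k\<in>S. \<alpha> k * f k x)\<^sup>2) \<le> X\<^sup>2 * (\<Sum>k\<in>S. (norm (c k))\<^sup>2)"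
    by (simp add: sum_distrib_left)
qed

text \<open>The weighted energies of the two components add up to at most 2 (\<mu>^2 + 1) M = v M /
  4. On the inner half of [-R, R] the cutoff is at least 9/16, and outside [-\<rho>, \<rho>] the
  potential is at least v. The mass outside is therefore at most 4 M / 9, less than half.\<close>

lemma mass_in_well:
  fixes h g1 g2 :: "real \<Rightarrow> real"
  assumes \<mu>: "\<mu> \<ge> 1" and \<rho>: "\<rho> > 0" and m: "0 \<le> M"
    and U: "\<And>x. \<bar>x\<bar> \<ge> \<rho> \<Longrightarrow> 8 * (\<mu>\<^sup>2 + 1) \<le> U x" "\<And>x. 0 \<le> U x"
    and h: "h = (\<lambda>x. (g1 x)\<^sup>2 + (g2 x)\<^sup>2)" "continuous_on UNIV h" "integrable lebesgue h" "(LINT x|lebesgue. h x) = M"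
    and Um: "U \<in> borel_measurable lebesgue" "\<And>a b. \<exists>B. \<forall>x\<in>{a..b}. \<bar>U x\<bar> \<le> B"
    and g: "continuous_on UNIV g1" "continuous_on UNIV g2"
    and e: "\<And>R. R \<ge> 2 \<Longrightarrow> integral {-R..R} (\<lambda>x. (1 - (x / R)\<^sup>2)\<^sup>2 * (U x * (g1 x)\<^sup>2)) \<le> (\<mu>\<^sup>2 + 1) * M"
      "\<And>R. R \<ge> 2 \<Longrightarrow> integral {-R..R} (\<lambda>x. (1 - (x / R)\<^sup>2)\<^sup>2 * (U x * (g2 x)\<^sup>2)) \<le> (\<mu>\<^sup>2 + 1) * M"
  shows "M / 2 \<le> integral {-\<rho>..\<rho>} h"
proof -
  define v where "v = 8 * (\<mu>\<^sup>2 + 1)"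
  have v: "v > 0" by (simp add: v_def add_nonneg_pos)
  have h0: "0 \<le> h x" for x by (simp add: h(1))
  have ch: "continuous_on A h" for A using h(2) continuous_on_subset by blast
  have main: "integral {- real n..real n} h \<le> 4 / 9 * M + integral {-\<rho>..\<rho>} h" if n: "real n \<ge> 1" "real n \<ge> \<rho>" for n
  proof -
    \<comment> \<open>Twice the integration range, so that |x / R| \<le> 1/2 and the cutoff is at
      least (3/4)^2 there.\<close>
    define R where "R = 2 * real n"
    have R: "R \<ge> 2" using n by (simp add: R_def)
    let ?\<xi> = "\<lambda>x. (1 - (x / R)\<^sup>2)\<^sup>2"
    let ?w = "\<lambda>x. ?\<xi> x * (U x * h x)"
    have int: "(\<lambda>x. ?\<xi> x * (U x * k x)) integrable_on {-R..R}" if "continuous_on UNIV k" for k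
    proof -
      obtain B where B: "\<And>x. x \<in> {-R..R} \<Longrightarrow> \<bar>U x\<bar> \<le> B" using Um(2)[of "-R" R] by blast
      have "(\<lambda>x. U x * (?\<xi> x * k x)) absolutely_integrable_on {-R..R}"
        by (rule absolutely_integrable_bounded_times_continuous[OF Um(1) B])
           (use R in \<open>auto intro!: continuous_intros continuous_on_subset[OF that]\<close>)
      then show ?thesis by (simp add: absolutely_integrable_on_def mult.left_commute)
    qed
    have wle: "integral {-R..R} ?w \<le> 2 * ((\<mu>\<^sup>2 + 1) * M)"
    proof -
      have "?w = (\<lambda>x. ?\<xi> x * (U x * (g1 x)\<^sup>2) + ?\<xi> x * (U x * (g2 x)\<^sup>2))"
        by (simp add: h(1) fun_eq_iff algebra_simps)
      then have "integral {-R..R} ?w = integral {-R..R} (\<lambda>x. ?\<xi> x * (U x * (g1 x)\<^sup>2)) + integral {-R..R} (\<lambda>x. ?\<xi> x * (U x * (g2 x)\<^sup>2))"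
        by (simp only:) (intro Henstock_Kurzweil_Integration.integral_add int continuous_intros g)
      then show ?thesis using e[OF R] by simp
    qed
    have sub: "{- real n..real n} \<subseteq> {-R..R}" "{-\<rho>..\<rho>} \<subseteq> {- real n..real n}" using n by (auto simp: R_def)
    have hin: "(\<lambda>x. if x \<in> {-\<rho>..\<rho>} then h x else 0) integrable_on {- real n..real n}"
      unfolding integrable_restrict_Int using sub(2)
      by (simp add: Int_absorb2 Int_commute integrable_continuous_real[OF ch])
    have "9 / 16 * v * integral {- real n..real n} h = integral {- real n..real n} (\<lambda>x. 9 / 16 * v * h x)" by simp
    also have "\<dots> \<le> integral {- real n..real n} (\<lambda>x. ?w x + 9 / 16 * v * (if x \<in> {-\<rho>..\<rho>} then h x else 0))"
    proof (rule integral_le)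
      show "(\<lambda>x. 9 / 16 * v * h x) integrable_on {- real n..real n}"
        by (intro integrable_continuous_real continuous_intros ch)
      show "(\<lambda>x. ?w x + 9 / 16 * v * (if x \<in> {-\<rho>..\<rho>} then h x else 0)) integrable_on {- real n..real n}"
        by (intro integrable_add integrable_on_mult_right hin integrable_on_subinterval[OF int[OF h(2)] sub(1)])
      fix x assume x: "x \<in> {- real n..real n}"
      show "9 / 16 * v * h x \<le> ?w x + 9 / 16 * v * (if x \<in> {-\<rho>..\<rho>} then h x else 0)"
      proof (cases "x \<in> {-\<rho>..\<rho>}")
        case True
        have "0 \<le> ?w x" using U(2)[of x] h0[of x] by simp
        then show ?thesis using True by simp
      next
        case False
        then have "\<bar>x\<bar> \<ge> \<rho>" by auto
        then have Ux: "v \<le> U x" using U(1) by (simp add: v_def)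
        have "\<bar>x / R\<bar> \<le> 1 / 2" using x n by (auto simp: R_def abs_divide field_simps)
        then have "(x / R)\<^sup>2 \<le> (1 / 2)\<^sup>2" by (metis abs_ge_zero power2_abs power_mono)
        then have "3 / 4 \<le> 1 - (x / R)\<^sup>2" by (simp add: power2_eq_square)
        then have "(3 / 4)\<^sup>2 \<le> ?\<xi> x" by (rule power_mono) simp
        then have "9 / 16 \<le> ?\<xi> x" by (simp add: power2_eq_square)
        then have "9 / 16 * (v * h x) \<le> ?\<xi> x * (U x * h x)"
          using Ux h0[of x] v by (intro mult_mono) auto
        moreover have "(if x \<in> {-\<rho>..\<rho>} then h x else 0) = 0" using False by (simp only: if_False)
        ultimately show ?thesis by (simp only: mult.assoc mult_zero_right add_0_right)
      qed
    qed
    also have "\<dots> = integral {- real n..real n} ?w + 9 / 16 * v * integral {-\<rho>..\<rho>} h"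
    proof -
      have "integral {- real n..real n} (\<lambda>x. if x \<in> {-\<rho>..\<rho>} then h x else 0) = integral {-\<rho>..\<rho>} h"
        by (simp only: integral_restrict_Int Int_absorb1[OF sub(2)] Int_absorb2[OF sub(2)])
      then show ?thesis
        using integrable_on_subinterval[OF int[OF h(2)] sub(1)] hin
        by (subst Henstock_Kurzweil_Integration.integral_add) (auto intro: integrable_on_mult_right)
    qed
    also have "integral {- real n..real n} ?w \<le> integral {-R..R} ?w"
      using integrable_on_subinterval[OF int[OF h(2)] sub(1)] int[OF h(2)] U(2) h0 sub(1)
      by (intro integral_subset_le) auto
    also have "\<dots> \<le> v / 4 * M"
    proof -
      have "v / 4 * M = 2 * ((\<mu>\<^sup>2 + 1) * M)" by (simp add: v_def)
      then show ?thesis using wle by (simp only:)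
    qed
    finally have "9 / 16 * v * integral {- real n..real n} h \<le> 9 / 16 * v * (4 / 9 * M + integral {-\<rho>..\<rho>} h)"
      by (simp add: algebra_simps)
    then show ?thesis using v by (simp add: mult_le_cancel_left_pos)
  qed
  have "M \<le> 4 / 9 * M + integral {-\<rho>..\<rho>} h"
  proof (rule LIMSEQ_le_const2)
    show "(\<lambda>n. integral {- real n..real n} h) \<longlonglongrightarrow> M"
      using tendsto_integral_exhaustion[OF h(3)] h(4) by simp
    obtain N where N: "max 1 \<rho> \<le> real N" using real_arch_simple by blast
    have "\<forall>n\<ge>N. integral {- real n..real n} h \<le> 4 / 9 * M + integral {-\<rho>..\<rho>} h"
    proof (intro allI impI main)
      fix n assume "N \<le> n"
      then have "max 1 \<rho> \<le> real n" using N by simp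
      then show "1 \<le> real n" "\<rho> \<le> real n" by auto
    qed
    then show "\<exists>N. \<forall>n\<ge>N. integral {- real n..real n} h \<le> 4 / 9 * M + integral {-\<rho>..\<rho>} h" by blast
  qed
  then show ?thesis using m by simp
qed

lemma interval_pigeonhole:
  fixes h :: "real \<Rightarrow> real"
  assumes L: "L > 0" and h: "continuous_on UNIV h" and K: "K > 0"
    and A: "A \<le> integral {- (L * real K)..L * real K} h"
  shows "\<exists>n::int. - int K \<le> n \<and> n < int K \<and> A / (2 * real K) \<le> integral {L * of_int n..L * (of_int n + 1)} h"
proof (rule ccontr)
  assume "\<not> ?thesis"
  then have neg: "integral {L * of_int n..L * (of_int n + 1)} h < A / (2 * real K)" if "- int K \<le> n" "n < int K" for n :: int
    using that by force
  have i: "h integrable_on {x..y}" for x y using h by (intro integrable_continuous_real) (auto intro: continuous_on_subset)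
  \<comment> \<open>The first j of the 2 K intervals. The strict inequality starts at j = 1, because
    the empty sum gives equality.\<close>
  have "integral {- (L * real K)..L * (real j - real K)} h \<le> real j * (A / (2 * real K)) \<and>
     (j > 0 \<longrightarrow> integral {- (L * real K)..L * (real j - real K)} h < real j * (A / (2 * real K)))" if "j \<le> 2 * K" for j
    using that
  proof (induction j)
    case 0
    then show ?case by simp
  next
    case (Suc j)
    define n where "n = int j - int K"
    have n: "- int K \<le> n" "n < int K" using Suc.prems by (auto simp: n_def)
    have rn: "real_of_int n = real j - real K" by (simp add: n_def)
    have "integral {- (L * real K)..L * (real j - real K)} h + integral {L * (real j - real K)..L * (real (Suc j) - real K)} h
        = integral {- (L * real K)..L * (real (Suc j) - real K)} h"
      using L by (intro Henstock_Kurzweil_Integration.integral_combine i) (auto simp: algebra_simps)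
    moreover have "integral {L * (real j - real K)..L * (real (Suc j) - real K)} h < A / (2 * real K)"
      using neg[OF n] by (simp add: rn algebra_simps)
    moreover have "integral {- (L * real K)..L * (real j - real K)} h \<le> real j * (A / (2 * real K))"
      using Suc by simp
    moreover have "real (Suc j) * (A / (2 * real K)) = real j * (A / (2 * real K)) + A / (2 * real K)"
      by (simp only: of_nat_Suc distrib_right mult_1_left add.commute)
    ultimately show ?case by simp
  qed
  from this[of "2 * K"] have "integral {- (L * real K)..L * (real (2 * K) - real K)} h < real (2 * K) * (A / (2 * real K))"
    using K by simp
  then show False using A K by simp
qed

text \<open>At a maximum of the sum of squares the sum is at least its mean, and one of the two
  squares is at least half of it.\<close>

lemma large_value_of_one_component:
  fixes g1 g2 :: "real \<Rightarrow> real"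
  assumes ab: "a < b" and g: "continuous_on UNIV g1" "continuous_on UNIV g2"
    and Q: "Q \<le> integral {a..b} (\<lambda>x. (g1 x)\<^sup>2 + (g2 x)\<^sup>2)"
  shows "\<exists>x\<in>{a..b}. Q / (2 * (b - a)) \<le> (g1 x)\<^sup>2 \<or> Q / (2 * (b - a)) \<le> (g2 x)\<^sup>2"
proof -
  let ?h = "\<lambda>x. (g1 x)\<^sup>2 + (g2 x)\<^sup>2"
  have c: "continuous_on {a..b} ?h" using g by (intro continuous_intros) (auto intro: continuous_on_subset)
  obtain x where x: "x \<in> {a..b}" "\<And>y. y \<in> {a..b} \<Longrightarrow> ?h y \<le> ?h x"
    using continuous_attains_sup[OF _ _ c] ab by auto
  have "Q \<le> integral {a..b} (\<lambda>_. ?h x)"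
    using Q integral_le[OF integrable_continuous_real[OF c] _ x(2)] by fastforce
  then have "Q / (b - a) \<le> ?h x" using ab by (simp add: field_simps)
  then have "Q / (2 * (b - a)) \<le> (g1 x)\<^sup>2 \<or> Q / (2 * (b - a)) \<le> (g2 x)\<^sup>2"
    using ab by (auto simp: field_simps)
  then show ?thesis using x(1) by blast
qed

lemma integral_abs_le_sqrt:
  fixes f :: "real \<Rightarrow> real"
  assumes ab: "a < b" and f: "continuous_on {a..b} f" and Q: "integral {a..b} (\<lambda>x. (f x)\<^sup>2) \<le> Q"
  shows "integral {a..b} (\<lambda>x. \<bar>f x\<bar>) \<le> sqrt ((b - a) * Q)"
proof -
  have c: "continuous_on {a..b} (\<lambda>x. \<bar>f x\<bar>)" "continuous_on {a..b} (\<lambda>x. (f x)\<^sup>2)" by (intro continuous_intros f)+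
  have "(integral {a..b} (\<lambda>x. \<bar>f x\<bar>))\<^sup>2 \<le> (b - a) * Q"
  proof -
    define I where "I = integral {a..b} (\<lambda>x. \<bar>f x\<bar>)"
    define l where "l = b - a"
    have l: "l > 0" using ab by (simp add: l_def)
    \<comment> \<open>Cauchy-Schwarz as nonnegativity of the variance of |f| about its mean I /
      l.\<close>
    have "0 \<le> integral {a..b} (\<lambda>x. (\<bar>f x\<bar> - I / l)\<^sup>2)"
      by (intro integral_nonneg integrable_continuous_real continuous_intros f) auto
    also have "(\<lambda>x. (\<bar>f x\<bar> - I / l)\<^sup>2) = (\<lambda>x. ((f x)\<^sup>2 - 2 * I / l * \<bar>f x\<bar>) + (I / l)\<^sup>2)"
      by (simp add: power2_diff fun_eq_iff)
    also have "integral {a..b} (\<lambda>x. ((f x)\<^sup>2 - 2 * I / l * \<bar>f x\<bar>) + (I / l)\<^sup>2) =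
        (integral {a..b} (\<lambda>x. (f x)\<^sup>2) - 2 * I / l * I) + l * (I / l)\<^sup>2"
      using has_integral_add[OF has_integral_diff[OF integrable_integral[OF integrable_continuous_real[OF c(2)]]
          has_integral_mult_right[OF integrable_integral[OF integrable_continuous_real[OF c(1)]], of "2 * I / l"]]
          has_integral_const_real[of "(I / l)\<^sup>2" a b]] ab
      by (intro integral_unique) (simp add: I_def l_def)
    also have "\<dots> = integral {a..b} (\<lambda>x. (f x)\<^sup>2) - I\<^sup>2 / l" using l by (simp add: power2_eq_square field_simps)
    finally have "I\<^sup>2 / l \<le> Q" using Q by simp
    then show ?thesis using l by (simp add: I_def l_def field_simps)
  qed
  then show ?thesis by (rule real_le_rsqrt)
qed

section \<open>The inequality at a fixed energy\<close>

lemma l2_norm_on_nonneg: "0 \<le> l2_norm_on A f"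
proof -
  have "0 \<le> (LINT x:A|lebesgue. (norm (f x))\<^sup>2)"
    unfolding set_lebesgue_integral_def by (rule integral_nonneg_AE) (auto simp: indicator_def)
  then show ?thesis by (simp add: l2_norm_on_def)
qed

text \<open>All parameters are fixed here and chosen as functions of \<mu> later. The 2 K intervals
  of length L cover the well [-\<rho>, \<rho>]; \<open>m\<close> dominates the potential on them and
  on the enlarged windows; \<delta> is the least share of \<Omega>; \<open>N\<close> is so large
  that the 2^(-N) remainder can be absorbed by half of the lower bound for u.\<close>

lemma spectral_inequality_at_energy:
  fixes V U :: "real \<Rightarrow> real" and \<phi> :: "nat \<Rightarrow> real \<Rightarrow> complex" and N K :: nat
  assumes H: "schroedinger_operator V H" and eb: "eigenbasis H \<phi> ev" and VU: "AE x in lebesgue. V x = U x"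
    and Um: "U \<in> borel_measurable lebesgue" and U0: "\<And>x. 0 \<le> U x"
    and Ub: "\<And>a b. \<exists>B. \<forall>x\<in>{a..b}. \<bar>U x\<bar> \<le> B"
    and \<mu>: "\<mu> \<ge> 1" and L: "L > 0"
    and \<rho>: "\<rho> > 0" "\<And>x. \<bar>x\<bar> \<ge> \<rho> \<Longrightarrow> 8 * (\<mu>\<^sup>2 + 1) \<le> U x"
    and K: "K > 0" "\<rho> \<le> L * real K"
    and m: "m > 0" "\<And>x. \<bar>x\<bar> \<le> L * (real K + 5) \<Longrightarrow> U x \<le> m\<^sup>2"
    and \<Omega>: "\<Omega> \<in> sets lebesgue" and \<delta>: "\<delta> > 0"
      "\<And>n::int. \<bar>n\<bar> \<le> int K \<Longrightarrow> \<delta> \<le> measure lebesgue (\<Omega> \<inter> {L * of_int n .. L * (of_int n + 1)})"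
    and \<sigma>: "\<sigma> = 7 * (L / 2) * m + 1"
    and \<kappa>1: "\<kappa>1 = 18 / (16 * (L / 2))\<^sup>2 + m\<^sup>2 + \<mu>\<^sup>2" and \<kappa>0: "\<kappa>0 = 3 / (16 * (L / 2)) + 16 * (L / 2) * \<kappa>1"
    and \<kappa>: "\<kappa> = \<kappa>0 + 7 * (L / 2) * \<kappa>1 + 7 * (L / 2) * m * \<kappa>0"
    and N: "N > 0" "2 * exp (2 * \<sigma>) * (exp (\<mu> * (7 * (L / 2))) * \<kappa>) * sqrt (8 * L) * sqrt (8 * real K * L) \<le> 2 ^ N"
    and u: "u \<in> spectral_subspace \<phi> ev \<mu>"
  shows "l2_norm u \<le> sqrt (8 * real K * L) * (4 * real N * exp (2 * \<sigma>) * (24 * L * real N / \<delta>) ^ (N - 1)) * sqrt (2 / \<delta>)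
     * l2_norm_on \<Omega> u"
proof -
  have \<phi>: "orthonormal_basis \<phi>" and ev0: "\<And>k. ev k > 0" and \<phi>H: "\<And>k. (\<phi> k, \<lambda>x. complex_of_real ((ev k)\<^sup>2) * \<phi> k x) \<in> H"
  proof -
    show "orthonormal_basis \<phi>" "\<And>k. (\<phi> k, \<lambda>x. complex_of_real ((ev k)\<^sup>2) * \<phi> k x) \<in> H"
      using eb by (auto simp: eigenbasis_def)
    show "ev k > 0" for k
      using eb incseqD[of ev 0 k] unfolding eigenbasis_def by force
  qed
  have \<phi>L: "\<phi> k \<in> L2" for k using \<phi> by (simp add: orthonormal_basis_def)
  obtain S c where S: "finite S" "\<And>k. k \<in> S \<Longrightarrow> ev k \<le> \<mu>" and uS: "AE x in lebesgue. u x = (\<Sum>k\<in>S. c k * \<phi> k x)"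
    using u unfolding spectral_subspace_def by blast
  define \<Phi> where "\<Phi> = (\<lambda>z k p p'. (AE x in lebesgue. Re (z * \<phi> k x) = p x) \<and> (\<forall>x. (p has_real_derivative p' x) (at x)) \<and>
    (\<forall>x y. x \<le> y \<longrightarrow> ((\<lambda>t. (U t - (ev k)\<^sup>2) * p t) has_integral (p' y - p' x)) {x..y}))"
  have ex: "\<exists>p p'. \<Phi> z k p p'" for z k
    unfolding \<Phi>_def by (rule eigenfunction_regularity[OF H \<phi>H \<phi>L Um Ub VU])
  \<comment> \<open>A regular representative of Re(z \<phi>_k) for every complex z and every index
    k, since both the coefficients of u and the choice of a component enter through z.\<close>
  define P where "P = (\<lambda>z k. SOME p. \<exists>p'. \<Phi> z k p p')"
  define P' where "P' = (\<lambda>z k. SOME p'. \<Phi> z k (P z k) p')"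
  have "\<exists>p'. \<Phi> z k (P z k) p'" for z k unfolding P_def by (rule someI_ex[OF ex])
  then have "\<Phi> z k (P z k) (P' z k)" for z k unfolding P'_def by (rule someI_ex)
  then have P: "\<And>z k. AE x in lebesgue. Re (z * \<phi> k x) = P z k x"
    "\<And>z k x. (P z k has_real_derivative P' z k x) (at x)"
    "\<And>z k x y. x \<le> y \<Longrightarrow> ((\<lambda>t. (U t - (ev k)\<^sup>2) * P z k t) has_integral (P' z k y - P' z k x)) {x..y}"
    unfolding \<Phi>_def by blast+
  have cP: "continuous_on A (P z k)" for A z k
    using P(2) by (meson DERIV_continuous_on has_field_derivative_at_within)
  \<comment> \<open>Continuity of the derivative is not part of the choice; it holds because P'
    differs by a constant from a continuous primitive of the same integrand.\<close>
  have cP': "continuous_on A (P' z k)" for A z k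
  proof -
    have "locally_integrable (\<lambda>t. (U t - (ev k)\<^sup>2) * P z k t)"
    proof (rule locally_integrable_bounded_times)
      show "(\<lambda>t. U t - (ev k)\<^sup>2) \<in> borel_measurable lebesgue" using Um by measurable
      show "\<exists>B. \<forall>x\<in>{a..b}. \<bar>U x - (ev k)\<^sup>2\<bar> \<le> B" for a b
      proof -
        obtain B where B: "\<forall>x\<in>{a..b}. \<bar>U x\<bar> \<le> B" using Ub by blast
        have "\<bar>U x - (ev k)\<^sup>2\<bar> \<le> B + (ev k)\<^sup>2" if "x \<in> {a..b}" for x
          using abs_triangle_ineq4[of "U x" "(ev k)\<^sup>2"] bspec[OF B that] by simp
        then show ?thesis by blast
      qed
    qed (rule locally_integrable_continuous[OF cP])
    then obtain F where F: "\<And>x y. x \<le> y \<Longrightarrow> ((\<lambda>t. (U t - (ev k)\<^sup>2) * P z k t) has_integral (F y - F x)) {x..y}"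
        "continuous_on UNIV F"
      using locally_integrable_primitive by blast
    have eq: "P' z k x = P' z k 0 + (F x - F 0)" for x
      using has_integral_unique[OF P(3)[of 0 x k z] F(1)[of 0 x]] has_integral_unique[OF P(3)[of x 0 k z] F(1)[of x 0]]
      by (cases "x \<ge> 0") auto
    have "continuous_on UNIV (\<lambda>x. P' z k 0 + (F x - F 0))" by (intro continuous_intros F(2))
    then show ?thesis using eq by (metis (no_types, lifting) ext continuous_on_subset subset_UNIV)
  qed
  define M where "M = (\<Sum>k\<in>S. (norm (c k))\<^sup>2)"
  have M0: "0 \<le> M" unfolding M_def by (rule sum_nonneg) simp
  have v2: "(\<lambda>x. (norm (\<Sum>k\<in>S. c k * \<phi> k x))\<^sup>2) absolutely_integrable_on UNIV"
    unfolding set_integrable_def using orthonormal_combination(1)[OF \<phi> S(1), of c] by simp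
  obtain Z where Z: "negligible Z" "{x. u x \<noteq> (\<Sum>k\<in>S. c k * \<phi> k x)} \<subseteq> Z"
    using uS unfolding eventually_ae_filter_negligible by blast
  have uZ: "u x = (\<Sum>k\<in>S. c k * \<phi> k x)" if "x \<notin> Z" for x using Z(2) that by blast
  have u2: "(\<lambda>x. (norm (u x))\<^sup>2) absolutely_integrable_on UNIV"
    by (rule absolutely_integrable_spike[OF v2 Z(1)]) (simp add: uZ)
  have u2i: "integrable lebesgue (\<lambda>x. (norm (u x))\<^sup>2)" using u2 by (simp add: set_integrable_def)
  have uM: "l2_norm u = sqrt M"
  proof -
    have "(LINT x:UNIV|lebesgue. (norm (u x))\<^sup>2) = integral UNIV (\<lambda>x. (norm (u x))\<^sup>2)"
      by (rule set_lebesgue_integral_eq_integral(2)[OF u2])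
    also have "\<dots> = integral UNIV (\<lambda>x. (norm (\<Sum>k\<in>S. c k * \<phi> k x))\<^sup>2)"
      by (rule integral_spike[OF Z(1)]) (simp add: uZ)
    also have "\<dots> = (LINT x:UNIV|lebesgue. (norm (\<Sum>k\<in>S. c k * \<phi> k x))\<^sup>2)"
      by (rule set_lebesgue_integral_eq_integral(2)[OF v2, symmetric])
    also have "\<dots> = M" unfolding M_def set_lebesgue_integral_def using orthonormal_combination(2)[OF \<phi> S(1), of c] by simp
    finally show ?thesis by (simp add: l2_norm_on_def)
  qed
  define e where "e = l2_norm_on \<Omega> u"
  have e0: "0 \<le> e" unfolding e_def by (rule l2_norm_on_nonneg)
  have e2: "(LINT x:\<Omega>|lebesgue. (norm (u x))\<^sup>2) = e\<^sup>2"
  proof -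
    have "0 \<le> (LINT x:\<Omega>|lebesgue. (norm (u x))\<^sup>2)"
      unfolding set_lebesgue_integral_def by (rule integral_nonneg_AE) (auto simp: indicator_def)
    then show ?thesis by (simp add: e_def l2_norm_on_def)
  qed
  \<comment> \<open>The continuous representative of Re(z u); z = 1 and z = -i give the real and
    imaginary parts of u.\<close>
  let ?g = "\<lambda>z x. \<Sum>k\<in>S. P (z * c k) k x"
  have g_ae: "AE x in lebesgue. ?g z x = Re (z * u x)" for z
  proof -
    have "AE x in lebesgue. \<forall>k\<in>S. Re ((z * c k) * \<phi> k x) = P (z * c k) k x"
      unfolding AE_finite_all[OF S(1)] using P(1) by blast
    then show ?thesis using uS
    proof eventually_elim
      case (elim x)
      have "Re (z * u x) = (\<Sum>k\<in>S. Re ((z * c k) * \<phi> k x))"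
        unfolding elim(2) sum_distrib_left Re_sum by (simp add: mult.assoc)
      then show ?case using elim(1) by simp
    qed
  qed
  have cg: "continuous_on A (?g z)" for A z by (intro continuous_intros cP)
  have nz: "(\<Sum>k\<in>S. (norm (z * c k))\<^sup>2) = M" if "norm z = 1" for z
    using that by (simp add: M_def norm_mult)
  have comb: "integrable lebesgue (\<lambda>x. (\<Sum>k\<in>S. \<alpha> k * P (z * c k) k x)\<^sup>2)"
      "integral {a..b} (\<lambda>x. (\<Sum>k\<in>S. \<alpha> k * P (z * c k) k x)\<^sup>2) \<le> X\<^sup>2 * M"
    if "norm z = 1" "0 \<le> X" "\<And>k. k \<in> S \<Longrightarrow> \<bar>\<alpha> k\<bar> \<le> X" for z X \<alpha> a b
    using combination_square_integral[where c = "\<lambda>k. z * c k", OF \<phi> S(1) P(1) that(2,3) cP]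
    unfolding nz[OF that(1)] by auto
  have energy: "integral {-R..R} (\<lambda>x. (1 - (x / R)\<^sup>2)\<^sup>2 * (U x * (?g z x)\<^sup>2)) \<le> (\<mu>\<^sup>2 + 1) * M"
    if z: "norm z = 1" and R: "R \<ge> 2" for z R
  proof -
    let ?G = "\<lambda>x. \<Sum>k\<in>S. (ev k)\<^sup>2 * P (z * c k) k x"
    obtain B where B: "\<And>x. x \<in> {-R..R} \<Longrightarrow> \<bar>U x\<bar> \<le> B" using Ub[of "-R" R] by blast
    have "integral {-R..R} (\<lambda>x. (1 - (x / R)\<^sup>2)\<^sup>2 * (U x * (?g z x)\<^sup>2)) \<le>
        integral {-R..R} (\<lambda>x. (\<mu>\<^sup>2 * (?g z x)\<^sup>2 + (?G x)\<^sup>2 / \<mu>\<^sup>2) / 2) + 4 / R\<^sup>2 * integral {-R..R} (\<lambda>x. (?g z x)\<^sup>2)"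
    proof (rule cutoff_energy_estimate[OF _ Um B, where g' = "\<lambda>x. \<Sum>k\<in>S. P' (z * c k) k x"])
      show "(?g z has_real_derivative (\<Sum>k\<in>S. P' (z * c k) k x)) (at x)" for x
        by (intro DERIV_sum P(2))
      show "((\<lambda>t. U t * ?g z t - ?G t) has_integral ((\<Sum>k\<in>S. P' (z * c k) k y) - (\<Sum>k\<in>S. P' (z * c k) k x))) {x..y}"
        if "x \<le> y" for x y
      proof -
        have "((\<lambda>t. \<Sum>k\<in>S. (U t - (ev k)\<^sup>2) * P (z * c k) k t) has_integral (\<Sum>k\<in>S. P' (z * c k) k y - P' (z * c k) k x)) {x..y}"
          by (intro has_integral_sum S(1) P(3) that)
        then show ?thesis by (simp add: left_diff_distrib sum_subtractf sum_distrib_left)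
      qed
    qed (use R \<mu> in \<open>auto intro!: continuous_intros cP cP'\<close>)
    also have "integral {-R..R} (\<lambda>x. (\<mu>\<^sup>2 * (?g z x)\<^sup>2 + (?G x)\<^sup>2 / \<mu>\<^sup>2) / 2) =
        (\<mu>\<^sup>2 * integral {-R..R} (\<lambda>x. (?g z x)\<^sup>2) + integral {-R..R} (\<lambda>x. (?G x)\<^sup>2) / \<mu>\<^sup>2) / 2"
    proof -
      have "(\<lambda>x. (?g z x)\<^sup>2) integrable_on {-R..R}" "(\<lambda>x. (?G x)\<^sup>2) integrable_on {-R..R}"
        by (intro integrable_continuous_real continuous_intros cP)+
      from has_integral_divide[OF has_integral_add[OF has_integral_mult_right[OF integrable_integral[OF this(1)], of "\<mu>\<^sup>2"]
         has_integral_divide[OF integrable_integral[OF this(2)], of "\<mu>\<^sup>2"]], of 2]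
      show ?thesis by (rule integral_unique)
    qed
    \<comment> \<open>The two Young terms are bounded by \<mu>^2 M each, and R \<ge> 2 makes the
      cutoff term at most M.\<close>
    also have "\<dots> + 4 / R\<^sup>2 * integral {-R..R} (\<lambda>x. (?g z x)\<^sup>2) \<le> (\<mu>\<^sup>2 * M + ((\<mu>\<^sup>2)\<^sup>2 * M) / \<mu>\<^sup>2) / 2 + 1 * M"
    proof (intro add_mono divide_right_mono mult_left_mono mult_mono)
      show gM: "integral {-R..R} (\<lambda>x. (?g z x)\<^sup>2) \<le> M" "integral {-R..R} (\<lambda>x. (?g z x)\<^sup>2) \<le> M"
        using comb(2)[OF z, of 1 "\<lambda>_. 1"] by simp_all
      show "integral {-R..R} (\<lambda>x. (?G x)\<^sup>2) \<le> (\<mu>\<^sup>2)\<^sup>2 * M"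
      proof (rule comb(2)[OF z])
        show "\<bar>(ev k)\<^sup>2\<bar> \<le> \<mu>\<^sup>2" if "k \<in> S" for k
          using S(2)[OF that] ev0[of k] by (simp add: power_mono)
      qed simp
      have "(2::real)\<^sup>2 \<le> R\<^sup>2" using R by (intro power_mono) auto
      then show "4 / R\<^sup>2 \<le> 1" using R by (simp add: divide_le_eq_1)
      show "0 \<le> integral {-R..R} (\<lambda>x. (?g z x)\<^sup>2)"
        by (intro integral_nonneg integrable_continuous_real continuous_intros cP) auto
    qed auto
    also have "\<dots> = (\<mu>\<^sup>2 + 1) * M" using \<mu> by (simp add: power2_eq_square field_simps)
    finally show ?thesis .
  qed
  define h where "h = (\<lambda>x. (?g 1 x)\<^sup>2 + (?g (- \<i>) x)\<^sup>2)"
  have ch: "continuous_on UNIV h" unfolding h_def by (intro continuous_intros cP)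
  have hi: "integrable lebesgue h"
    unfolding h_def using comb(1)[of 1 1 "\<lambda>_. 1"] comb(1)[of "- \<i>" 1 "\<lambda>_. 1"]
    by (intro Bochner_Integration.integrable_add) auto
  have hM: "(LINT x|lebesgue. h x) = M"
  proof -
    have "AE x in lebesgue. h x = (norm (u x))\<^sup>2"
      using g_ae[of 1] g_ae[of "- \<i>"]
    proof eventually_elim
      case (elim x)
      then show ?case unfolding h_def by (simp add: cmod_power2)
    qed
    then have "(LINT x|lebesgue. h x) = (LINT x|lebesgue. (norm (u x))\<^sup>2)"
      using hi u2i by (intro integral_cong_AE) auto
    also have "\<dots> = (l2_norm u)\<^sup>2" unfolding l2_norm_on_def set_lebesgue_integral_def by simp
    also have "\<dots> = M" unfolding uM using M0 by simp
    finally show ?thesis .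
  qed
  have ih: "h integrable_on {x..y}" for x y
    using ch by (intro integrable_continuous_real) (auto intro: continuous_on_subset)
  have "M / 2 \<le> integral {-\<rho>..\<rho>} h"
    by (rule mass_in_well[where ?g1.0 = "?g 1" and ?g2.0 = "?g (- \<i>)", OF \<mu> \<rho>(1) M0 \<rho>(2) U0 h_def ch hi hM Um Ub cg cg energy energy])
       auto
  also have "\<dots> \<le> integral {- (L * real K)..L * real K} h"
    using K by (intro integral_subset_le ih) (auto simp: h_def)
  finally obtain n :: int where n: "- int K \<le> n" "n < int K"
    and In: "M / 2 / (2 * real K) \<le> integral {L * of_int n..L * (of_int n + 1)} h"
    using interval_pigeonhole[OF L ch K(1)] by blast
  define x0 where "x0 = L * of_int n + L / 2"
  have I: "{L * of_int n..L * (of_int n + 1)} = {x0 - L / 2..x0 + L / 2}"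
    by (simp add: x0_def algebra_simps)
  have x0b: "\<bar>x0\<bar> \<le> L * real K + L / 2"
  proof -
    have "real_of_int \<bar>n\<bar> \<le> real K" using n by linarith
    then have "L * \<bar>real_of_int n\<bar> \<le> L * real K" using L by simp
    moreover have "\<bar>L * real_of_int n\<bar> = L * \<bar>real_of_int n\<bar>" using L by (simp add: abs_mult)
    ultimately show ?thesis unfolding x0_def using L by linarith
  qed
  \<comment> \<open>The mass M/2 spread over 2 K intervals, then over length L, then halved between
    two components: together M / (8 K L).\<close>
  obtain z x where z: "norm z = 1" and x: "x \<in> {x0 - L / 2..x0 + L / 2}" and gx: "M / (8 * real K * L) \<le> (?g z x)\<^sup>2"
  proof -
    have "L * of_int n < L * (of_int n + 1)" using L by simp
    from large_value_of_one_component[OF this cg cg In[unfolded h_def]]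
    obtain x where x: "x \<in> {L * of_int n..L * (of_int n + 1)}"
      "M / 2 / (2 * real K) / (2 * (L * (of_int n + 1) - L * of_int n)) \<le> (?g 1 x)\<^sup>2 \<or>
       M / 2 / (2 * real K) / (2 * (L * (of_int n + 1) - L * of_int n)) \<le> (?g (- \<i>) x)\<^sup>2" by blast
    have eq: "M / 2 / (2 * real K) / (2 * (L * (of_int n + 1) - L * of_int n)) = M / (8 * real K * L)"
      by (simp add: algebra_simps)
    show ?thesis using x(1) x(2)[unfolded eq] that[of 1 x] that[of "- \<i>" x] unfolding I by auto
  qed
  define T where "T = sqrt M / sqrt (8 * real K * L)"
  have KL: "sqrt (8 * real K * L) > 0" using K(1) L by simp
  have T: "T \<le> \<bar>?g z x\<bar>"
    using real_sqrt_le_mono[OF gx] by (simp add: T_def real_sqrt_divide)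
  \<comment> \<open>Cauchy-Schwarz on a window of length 16 (L/2) = 8 L, for functions of squared
    norm at most M.\<close>
  define A where "A = sqrt (8 * L * M)"
  have loc: "eigenfunctions_on_interval U S (\<lambda>k. P (z * c k) k) (\<lambda>k. P' (z * c k) k) ev
      (x0 - 8 * (L / 2)) (x0 + 8 * (L / 2)) m \<mu> A"
  proof
    show "x0 - 8 * (L / 2) < x0 + 8 * (L / 2)" using L by simp
    \<comment> \<open>The window reaches 4 L beyond a centre with |x0| \<le> L K + L/2, hence stays
      within L (K + 5).\<close>
    show "U y \<le> m\<^sup>2" if "y \<in> {x0 - 8 * (L / 2)..x0 + 8 * (L / 2)}" for y
      by (rule m(2)) (use that x0b L in \<open>auto simp: algebra_simps abs_le_iff\<close>)
    show "integral {x0 - 8 * (L / 2)..x0 + 8 * (L / 2)} (\<lambda>x. \<bar>\<Sum>k\<in>S. \<alpha> k * P (z * c k) k x\<bar>) \<le> X * A"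
      if X: "0 \<le> X" "\<And>k. k \<in> S \<Longrightarrow> \<bar>\<alpha> k\<bar> \<le> X" for \<alpha> X
    proof -
      have "integral {x0 - 8 * (L / 2)..x0 + 8 * (L / 2)} (\<lambda>x. \<bar>\<Sum>k\<in>S. \<alpha> k * P (z * c k) k x\<bar>) \<le>
          sqrt ((x0 + 8 * (L / 2) - (x0 - 8 * (L / 2))) * (X\<^sup>2 * M))"
        using L by (intro integral_abs_le_sqrt comb(2)[OF z X] continuous_intros cP) auto
      also have "\<dots> = sqrt (X\<^sup>2 * (8 * L * M))" by (simp add: algebra_simps)
      also have "\<dots> = X * A" using X(1) by (simp add: A_def real_sqrt_mult)
      finally show ?thesis .
    qed
    show "(P (z * c k) k has_real_derivative P' (z * c k) k y) (at y within {x0 - 8 * (L / 2)..x0 + 8 * (L / 2)})" for k y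
      using P(2) by (rule has_field_derivative_at_within)
  qed (use S ev0 Um U0 m \<mu> P(3) in \<open>auto intro: cP'\<close>)
  define E where "E = \<Omega> \<inter> {x0 - L / 2..x0 + L / 2}"
  have Em: "E \<in> lmeasurable" unfolding E_def
    by (rule fmeasurableI2[of "{x0 - L / 2..x0 + L / 2}"]) (use \<Omega> in auto)
  have E\<delta>: "\<delta> \<le> measure lebesgue E" using \<delta>(2)[of n] n unfolding E_def I by simp
  have gm: "?g z \<in> borel_measurable lebesgue"
    using borel_measurable_continuous_onI[OF cg] by (intro measurable_completion) simp
  have g2: "integrable lebesgue (\<lambda>x. (?g z x)\<^sup>2)" using comb(1)[OF z, of 1 "\<lambda>_. 1"] by simp
  have gE: "set_integrable lebesgue E (\<lambda>x. (?g z x)\<^sup>2)"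
    unfolding set_integrable_def using Em g2 by (intro integrable_mult_indicator) auto
  have gEe: "(LINT x:E|lebesgue. (?g z x)\<^sup>2) \<le> e\<^sup>2"
  proof -
    have "(LINT x:E|lebesgue. (?g z x)\<^sup>2) \<le> (LINT x:\<Omega>|lebesgue. (norm (u x))\<^sup>2)"
      unfolding set_lebesgue_integral_def
    proof (rule integral_mono_AE)
      show "integrable lebesgue (\<lambda>x. indicat_real E x *\<^sub>R (?g z x)\<^sup>2)" using gE by (simp add: set_integrable_def)
      show "integrable lebesgue (\<lambda>x. indicat_real \<Omega> x *\<^sub>R (norm (u x))\<^sup>2)"
        using \<Omega> u2i by (intro integrable_mult_indicator)
      show "AE x in lebesgue. indicat_real E x *\<^sub>R (?g z x)\<^sup>2 \<le> indicat_real \<Omega> x *\<^sub>R (norm (u x))\<^sup>2"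
        using g_ae[of z]
      proof eventually_elim
        case (elim x)
        have "\<bar>Re (z * u x)\<bar> \<le> norm (u x)" using abs_Re_le_cmod[of "z * u x"] z by (simp add: norm_mult)
        then have "(?g z x)\<^sup>2 \<le> (norm (u x))\<^sup>2" unfolding elim by (simp add: abs_le_square_iff[symmetric])
        then show ?case by (auto simp: E_def indicator_def)
      qed
    qed
    then show ?thesis using e2 by simp
  qed
  \<comment> \<open>With this spacing N nodes require measure more than \<delta>/4, while the
    sublevel set below has measure at least \<delta>/2. The ratio 6 (L/2) / d is then 24 L N /
    \<delta>.\<close>
  define d where "d = \<delta> / (8 * real N)"
  have d: "d > 0" using \<delta>(1) N(1) by (simp add: d_def)
  define Q where "Q = 4 * real N * exp (2 * \<sigma>) * (24 * L * real N / \<delta>) ^ (N - 1)"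
  have Q0: "Q \<ge> 0" unfolding Q_def using L \<delta>(1) by simp
  have "T \<le> Q * (sqrt (2 / \<delta>) * (e + \<eta>))" if \<eta>: "\<eta> > 0" for \<eta>
  proof -
    \<comment> \<open>The threshold for which Chebyshev discards at most \<delta>/2. The addition of
      \<eta> keeps it positive even when u vanishes on \<Omega>; \<eta> tends to 0 at the
      end.\<close>
    define \<epsilon> where "\<epsilon> = sqrt (2 / \<delta>) * (e + \<eta>)"
    have \<epsilon>: "\<epsilon> > 0" using \<delta>(1) e0 \<eta> by (simp add: \<epsilon>_def)
    have "e\<^sup>2 \<le> (e + \<eta>)\<^sup>2" using e0 \<eta> by (intro power_mono) auto
    also have "\<dots> = \<epsilon>\<^sup>2 * (\<delta> / 2)" using \<delta>(1) by (simp add: \<epsilon>_def power_mult_distrib)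
    finally have le: "(LINT x:E|lebesgue. (?g z x)\<^sup>2) \<le> \<epsilon>\<^sup>2 * (\<delta> / 2)" using gEe by simp
    note sub = large_sublevel_set[OF Em gm gE \<epsilon> le]
    have "2 * d * real N = \<delta> / 4" using N(1) by (simp add: d_def)
    then have "2 * d * real N < measure lebesgue {x \<in> E. \<bar>?g z x\<bar> \<le> \<epsilon>}"
      using sub(2) E\<delta> \<delta>(1) by linarith
    from separated_points_in_set_of_positive_measure[OF sub(1) d this]
    obtain F where F: "F \<subseteq> {x \<in> E. \<bar>?g z x\<bar> \<le> \<epsilon>}" "finite F" "card F = N"
      "\<And>x y. x \<in> F \<Longrightarrow> y \<in> F \<Longrightarrow> x \<noteq> y \<Longrightarrow> d \<le> \<bar>x - y\<bar>" by blast
    have FI: "F \<subseteq> {x0 - L / 2..x0 + L / 2}" and F\<epsilon>: "\<And>x. x \<in> F \<Longrightarrow> \<bar>?g z x\<bar> \<le> \<epsilon>" using F(1) by (auto simp: E_def)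
    define B where "B = exp (\<mu> * (7 * (L / 2))) * A * (\<kappa>0 + 7 * (L / 2) * \<kappa>1 + 7 * (L / 2) * m * \<kappa>0)"
    have L2: "L / 2 > 0" using L by simp
    have loc_bound: "\<bar>?g z x\<bar> \<le> exp (2 * \<sigma>) * (2 * real N * \<epsilon> * (6 * (L / 2) / d) ^ (N - 1) + B / 2 ^ N)"
      by (rule local_propagation_of_smallness[OF loc L2 F(2) FI F(3,4) d F\<epsilon> _ x \<sigma> \<kappa>1 \<kappa>0 B_def]) (use \<epsilon> in auto)
    have ratio: "6 * (L / 2) / d = 24 * L * real N / \<delta>" by (simp add: d_def)
    \<comment> \<open>The choice of N: B and T both scale like sqrt M, so the condition on N is free
      of u. Moving T/2 to the left doubles the factor 2 N to 4 N.\<close>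
    have "exp (2 * \<sigma>) * (B / 2 ^ N) \<le> T / 2"
    proof -
      have B: "B = exp (\<mu> * (7 * (L / 2))) * \<kappa> * sqrt (8 * L) * sqrt M"
        unfolding B_def \<kappa> A_def by (simp add: real_sqrt_mult)
      have "(2 * exp (2 * \<sigma>) * (exp (\<mu> * (7 * (L / 2))) * \<kappa>) * sqrt (8 * L) * sqrt (8 * real K * L)) * sqrt M \<le> 2 ^ N * sqrt M"
        by (rule mult_right_mono[OF N(2)]) (use M0 in simp)
      then have "2 * (exp (2 * \<sigma>) * B) * sqrt (8 * real K * L) \<le> 2 ^ N * sqrt M"
        unfolding B by (simp only: mult_ac)
      then show ?thesis using KL unfolding T_def by (simp add: field_simps)
    qed
    then have "T \<le> exp (2 * \<sigma>) * (2 * real N * \<epsilon> * (24 * L * real N / \<delta>) ^ (N - 1)) + T / 2"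
      using loc_bound[unfolded ratio distrib_left] T by linarith
    then show ?thesis unfolding Q_def \<epsilon>_def[symmetric] by (simp add: mult_ac)
  qed
  then have TQ: "T \<le> Q * (sqrt (2 / \<delta>) * (e + \<eta>))" if "\<eta> > 0" for \<eta> using that by blast
  have "T \<le> Q * (sqrt (2 / \<delta>) * (e + 0))"
  proof (rule tendsto_lowerbound)
    show "((\<lambda>\<eta>. Q * (sqrt (2 / \<delta>) * (e + \<eta>))) \<longlongrightarrow> Q * (sqrt (2 / \<delta>) * (e + 0))) (at_right 0)"
      by (intro tendsto_intros)
    show "\<forall>\<^sub>F \<eta> in at_right 0. T \<le> Q * (sqrt (2 / \<delta>) * (e + \<eta>))"
      using TQ by (auto simp: eventually_at_filter)
  qed simp
  then have "sqrt M \<le> sqrt (8 * real K * L) * (Q * (sqrt (2 / \<delta>) * e))"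
    using KL by (simp add: T_def field_simps)
  then show ?thesis unfolding uM e_def Q_def by (simp only: mult.assoc)
qed

section \<open>Growth of the constant\<close>

definition poly_growth :: "real \<Rightarrow> (real \<Rightarrow> real) \<Rightarrow> bool" where
  "poly_growth p F \<longleftrightarrow> (\<exists>C\<ge>0. \<forall>\<mu>\<ge>1. F \<mu> \<le> C * \<mu> powr p)"

lemma poly_growthI: "0 \<le> C \<Longrightarrow> (\<And>\<mu>. \<mu> \<ge> 1 \<Longrightarrow> F \<mu> \<le> C * \<mu> powr p) \<Longrightarrow> poly_growth p F"
  unfolding poly_growth_def by blast

lemma poly_growth_le:
  "poly_growth p G \<Longrightarrow> (\<And>\<mu>. \<mu> \<ge> 1 \<Longrightarrow> F \<mu> \<le> G \<mu>) \<Longrightarrow> poly_growth p F"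
  unfolding poly_growth_def by (meson order_trans)

lemma poly_growth_const: "0 \<le> p \<Longrightarrow> poly_growth p (\<lambda>_. c)"
proof (rule poly_growthI[of "\<bar>c\<bar>"])
  fix \<mu> :: real assume "0 \<le> p" "1 \<le> \<mu>"
  then have "1 \<le> \<mu> powr p" by (simp add: ge_one_powr_ge_zero)
  then have "\<bar>c\<bar> * 1 \<le> \<bar>c\<bar> * \<mu> powr p" by (intro mult_left_mono) auto
  then show "c \<le> \<bar>c\<bar> * \<mu> powr p" by simp
qed simp

lemma poly_growth_power: "poly_growth (real n) (\<lambda>\<mu>. \<mu> ^ n)"
  by (rule poly_growthI[of 1]) (auto simp: powr_realpow)

lemma poly_growth_mono: "poly_growth p F \<Longrightarrow> p \<le> q \<Longrightarrow> poly_growth q F"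
  unfolding poly_growth_def by (meson mult_left_mono order_trans powr_mono)

lemma poly_growth_add:
  assumes "poly_growth p F" "poly_growth p G" shows "poly_growth p (\<lambda>\<mu>. F \<mu> + G \<mu>)"
proof -
  obtain C D where "0 \<le> C" "\<forall>\<mu>\<ge>1. F \<mu> \<le> C * \<mu> powr p" "0 \<le> D" "\<forall>\<mu>\<ge>1. G \<mu> \<le> D * \<mu> powr p"
    using assms unfolding poly_growth_def by blast
  then show ?thesis
    by (intro poly_growthI[of "C + D"]) (auto simp: distrib_right intro: add_mono)
qed

lemma poly_growth_cmult:
  assumes "poly_growth p F" "0 \<le> c" shows "poly_growth p (\<lambda>\<mu>. c * F \<mu>)"
proof -
  obtain C where "0 \<le> C" "\<forall>\<mu>\<ge>1. F \<mu> \<le> C * \<mu> powr p"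
    using assms unfolding poly_growth_def by blast
  then show ?thesis using assms(2)
    by (intro poly_growthI[of "c * C"]) (auto simp: mult.assoc intro: mult_left_mono)
qed

lemma poly_growth_mult:
  assumes "poly_growth p F" "poly_growth q G" "\<And>\<mu>. \<mu> \<ge> 1 \<Longrightarrow> 0 \<le> F \<mu>" "\<And>\<mu>. \<mu> \<ge> 1 \<Longrightarrow> 0 \<le> G \<mu>"
  shows "poly_growth (p + q) (\<lambda>\<mu>. F \<mu> * G \<mu>)"
proof -
  obtain C D where CD: "0 \<le> C" "\<forall>\<mu>\<ge>1. F \<mu> \<le> C * \<mu> powr p" "0 \<le> D" "\<forall>\<mu>\<ge>1. G \<mu> \<le> D * \<mu> powr q"
    using assms unfolding poly_growth_def by blast
  show ?thesis
  proof (rule poly_growthI[of "C * D"])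
    fix \<mu> :: real assume \<mu>: "\<mu> \<ge> 1"
    have "F \<mu> * G \<mu> \<le> (C * \<mu> powr p) * (D * \<mu> powr q)"
      using CD assms(3,4) \<mu> by (intro mult_mono) auto
    then show "F \<mu> * G \<mu> \<le> C * D * \<mu> powr (p + q)" by (simp add: powr_add mult_ac)
  qed (use CD in simp)
qed

lemma poly_growth_powr:
  assumes "poly_growth p F" "\<And>\<mu>. \<mu> \<ge> 1 \<Longrightarrow> 0 \<le> F \<mu>" "0 \<le> a"
  shows "poly_growth (p * a) (\<lambda>\<mu>. F \<mu> powr a)"
proof -
  obtain C where C: "0 \<le> C" "\<forall>\<mu>\<ge>1. F \<mu> \<le> C * \<mu> powr p"
    using assms unfolding poly_growth_def by blast
  show ?thesis
  proof (rule poly_growthI[of "C powr a"])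
    fix \<mu> :: real assume \<mu>: "\<mu> \<ge> 1"
    have "F \<mu> powr a \<le> (C * \<mu> powr p) powr a"
      using C assms(2,3) \<mu> by (intro powr_mono2) auto
    then show "F \<mu> powr a \<le> C powr a * \<mu> powr (p * a)" using C by (simp add: powr_mult powr_powr)
  qed simp
qed

lemma poly_growth_sqrt:
  assumes "poly_growth p F" "\<And>\<mu>. \<mu> \<ge> 1 \<Longrightarrow> 0 \<le> F \<mu>"
  shows "poly_growth (p / 2) (\<lambda>\<mu>. sqrt (F \<mu>))"
  using poly_growth_le[OF poly_growth_powr[OF assms, of "1 / 2"], of "\<lambda>\<mu>. sqrt (F \<mu>)"] assms(2)
  by (simp add: powr_half_sqrt)

text \<open>Kept apart from \<open>poly_growth\<close> because the product N ln N must cost one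
  logarithm and not a larger power. The shift to ln(\<mu> + 1) keeps the comparison function at
  least ln 2, so constants can be absorbed.\<close>

definition log_growth :: "(real \<Rightarrow> real) \<Rightarrow> bool" where
  "log_growth F \<longleftrightarrow> (\<exists>C\<ge>0. \<forall>\<mu>\<ge>1. F \<mu> \<le> C * ln (\<mu> + 1))"

lemma log_growth_ln:
  assumes "poly_growth p F" "\<And>\<mu>. \<mu> \<ge> 1 \<Longrightarrow> 0 < F \<mu>"
  shows "log_growth (\<lambda>\<mu>. ln (F \<mu>))"
proof -
  obtain C where C: "0 \<le> C" "\<forall>\<mu>\<ge>1. F \<mu> \<le> C * \<mu> powr p"
    using assms unfolding poly_growth_def by blast
  have "F 1 \<le> C" using C(2)[rule_format, of 1] by simp
  then have C0: "C > 0" using assms(2)[of 1] by simp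
  have l2: "ln (2::real) > 0" by simp
  have "ln (F \<mu>) \<le> (\<bar>ln C\<bar> / ln 2 + \<bar>p\<bar>) * ln (\<mu> + 1)" if \<mu>: "\<mu> \<ge> 1" for \<mu>
  proof -
    have "ln (F \<mu>) \<le> ln (C * \<mu> powr p)"
      using assms(2)[OF \<mu>] C \<mu> C0 by (subst ln_le_cancel_iff) auto
    also have "\<dots> = ln C + p * ln \<mu>" using C0 \<mu> by (simp add: ln_mult ln_powr)
    also have "\<dots> \<le> \<bar>ln C\<bar> / ln 2 * ln (\<mu> + 1) + \<bar>p\<bar> * ln (\<mu> + 1)"
    proof (rule add_mono)
      have "ln 2 \<le> ln (\<mu> + 1)" using \<mu> by simp
      then have "\<bar>ln C\<bar> / ln 2 * ln 2 \<le> \<bar>ln C\<bar> / ln 2 * ln (\<mu> + 1)"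
        using l2 by (intro mult_left_mono) auto
      then show "ln C \<le> \<bar>ln C\<bar> / ln 2 * ln (\<mu> + 1)" using l2 by simp
      have "p * ln \<mu> \<le> \<bar>p\<bar> * ln \<mu>" using \<mu> by (intro mult_right_mono) auto
      also have "\<dots> \<le> \<bar>p\<bar> * ln (\<mu> + 1)" using \<mu> by (intro mult_left_mono) auto
      finally show "p * ln \<mu> \<le> \<bar>p\<bar> * ln (\<mu> + 1)" .
    qed
    finally show ?thesis by (simp add: distrib_right)
  qed
  then show ?thesis unfolding log_growth_def using l2 by (intro exI[of _ "\<bar>ln C\<bar> / ln 2 + \<bar>p\<bar>"]) auto
qed

lemma log_growth_imp_poly_growth:
  assumes "log_growth F" "1 \<le> p" shows "poly_growth p F"
proof -
  obtain C where C: "0 \<le> C" "\<forall>\<mu>\<ge>1. F \<mu> \<le> C * ln (\<mu> + 1)" using assms unfolding log_growth_def by blast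
  have "poly_growth 1 F"
  proof (rule poly_growthI[OF C(1)])
    fix \<mu> :: real assume \<mu>: "\<mu> \<ge> 1"
    have "ln (\<mu> + 1) \<le> \<mu>" using \<mu> ln_add_one_self_le_self[of \<mu>] by (simp add: add.commute)
    then have "C * ln (\<mu> + 1) \<le> C * \<mu>" using C(1) by (rule mult_left_mono)
    moreover have "F \<mu> \<le> C * ln (\<mu> + 1)" using C(2) \<mu> by blast
    ultimately show "F \<mu> \<le> C * \<mu> powr 1" using \<mu> by simp
  qed
  then show ?thesis using assms(2) by (rule poly_growth_mono)
qed

lemma poly_growth_le_times_log:
  assumes "poly_growth p F" "p \<le> \<zeta>"
  shows "\<exists>C\<ge>0. \<forall>\<mu>\<ge>1. F \<mu> \<le> C * (\<mu> powr \<zeta> * ln (\<mu> + 1))"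
proof -
  obtain C where C: "0 \<le> C" "\<forall>\<mu>\<ge>1. F \<mu> \<le> C * \<mu> powr \<zeta>"
    using poly_growth_mono[OF assms] unfolding poly_growth_def by blast
  have l2: "ln (2::real) > 0" by simp
  show ?thesis
  proof (intro exI[of _ "C / ln 2"] conjI allI impI)
    fix \<mu> :: real assume \<mu>: "\<mu> \<ge> 1"
    have "C * \<mu> powr \<zeta> = C / ln 2 * (\<mu> powr \<zeta> * ln 2)" using l2 by simp
    also have "\<dots> \<le> C / ln 2 * (\<mu> powr \<zeta> * ln (\<mu> + 1))"
      using C \<mu> l2 by (intro mult_left_mono) auto
    finally show "F \<mu> \<le> C / ln 2 * (\<mu> powr \<zeta> * ln (\<mu> + 1))" using C(2) \<mu> by (meson order_trans)
  qed (use C l2 in auto)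
qed

lemma poly_times_log_growth:
  assumes F: "poly_growth p F" "\<And>\<mu>. \<mu> \<ge> 1 \<Longrightarrow> 0 \<le> F \<mu>" and G: "log_growth G" and p: "p \<le> \<zeta>"
  shows "\<exists>C\<ge>0. \<forall>\<mu>\<ge>1. F \<mu> * G \<mu> \<le> C * (\<mu> powr \<zeta> * ln (\<mu> + 1))"
proof -
  obtain C where C: "0 \<le> C" "\<forall>\<mu>\<ge>1. F \<mu> \<le> C * \<mu> powr \<zeta>"
    using poly_growth_mono[OF F(1) p] unfolding poly_growth_def by blast
  obtain D where D: "0 \<le> D" "\<forall>\<mu>\<ge>1. G \<mu> \<le> D * ln (\<mu> + 1)" using G unfolding log_growth_def by blast
  show ?thesis
  proof (intro exI[of _ "C * D"] conjI allI impI)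
    fix \<mu> :: real assume \<mu>: "\<mu> \<ge> 1"
    have "F \<mu> * G \<mu> \<le> F \<mu> * (D * ln (\<mu> + 1))" using D(2) \<mu> F(2) by (intro mult_left_mono) auto
    also have "\<dots> \<le> (C * \<mu> powr \<zeta>) * (D * ln (\<mu> + 1))" using C(2) D(1) \<mu> by (intro mult_right_mono) auto
    finally show "F \<mu> * G \<mu> \<le> C * D * (\<mu> powr \<zeta> * ln (\<mu> + 1))" by (simp add: mult_ac)
  qed (use C D in auto)
qed

section \<open>Assembly of the constant\<close>

lemma jbr_bounds: "1 \<le> jbr x" "jbr x \<le> 1 + \<bar>x\<bar>"
proof -
  show "1 \<le> jbr x" by (simp add: jbr_def)
  have "1 + \<bar>x\<bar>\<^sup>2 \<le> (1 + \<bar>x\<bar>)\<^sup>2" by (simp add: power2_eq_square algebra_simps)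
  then show "jbr x \<le> 1 + \<bar>x\<bar>" unfolding jbr_def by (intro real_le_lsqrt) auto
qed

text \<open>Takes the logarithm of the factor in \<open>spectral_inequality_at_energy\<close>. With
  \<delta> = \<gamma>^G L the length L cancels in 24 L N / \<delta>. The factor N + 1 of G
  ln(1/\<gamma>) counts the power, whose exponent is at most N, and the remaining
  sqrt(2/\<delta>).\<close>

lemma ln_of_factor:
  fixes K N L \<sigma> \<gamma> \<tau> :: real
  assumes "K > 0" "N \<ge> 1" "L > 0" "\<gamma> > 0" "\<gamma> < 1" "G \<ge> 0" "real n = N" "\<delta> = \<gamma> powr G * L"
  shows "sqrt (8 * K * L) * (4 * N * exp (2 * \<sigma>) * (24 * L * N / \<delta>) ^ (n - 1)) * sqrt (2 / \<delta>)
    \<le> exp (((ln (8 * K * L) / 2 + ln (4 * N) + 2 * \<sigma>) + N * ln (24 * N) + (N + 1) * G * ln (1 / \<gamma>)) + \<bar>ln (2 / L)\<bar>)"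
proof -
  have \<delta>: "\<delta> > 0" using assms by simp
  have n: "real (n - 1) \<le> N" using assms(7) by simp
  have g: "ln (1 / \<gamma>) > 0" using assms by simp
  have e: "24 * L * N / \<delta> > 0" "2 / \<delta> > 0" using assms \<delta> by auto
  have l1: "ln (24 * L * N / \<delta>) = ln (24 * N) + G * ln (1 / \<gamma>)"
    using assms by (simp add: ln_mult ln_div ln_powr algebra_simps)
  have l2: "ln (2 / \<delta>) = ln (2 / L) + G * ln (1 / \<gamma>)"
    using assms by (simp add: ln_mult ln_div ln_powr algebra_simps)
  have "ln (sqrt (8 * K * L) * (4 * N * exp (2 * \<sigma>) * (24 * L * N / \<delta>) ^ (n - 1)) * sqrt (2 / \<delta>))
     = ln (8 * K * L) / 2 + (ln (4 * N) + 2 * \<sigma> + real (n - 1) * ln (24 * L * N / \<delta>)) + ln (2 / \<delta>) / 2"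
    using assms e by (simp add: ln_mult_pos ln_realpow ln_sqrt)
  also have "\<dots> \<le> ((ln (8 * K * L) / 2 + ln (4 * N) + 2 * \<sigma>) + N * ln (24 * N) + (N + 1) * G * ln (1 / \<gamma>)) + \<bar>ln (2 / L)\<bar>"
  proof -
    have "0 \<le> ln (24 * N)" using assms by simp
    then have "0 \<le> ln (24 * N) + G * ln (1 / \<gamma>)" using g assms by simp
    then have le: "real (n - 1) * ln (24 * L * N / \<delta>) \<le> N * (ln (24 * N) + G * ln (1 / \<gamma>))"
      unfolding l1 by (rule mult_right_mono[OF n])
    have nn: "0 \<le> G * ln (1 / \<gamma>)" using g assms by simp
    have "p + (q + s + x) + (z + y) / 2 \<le> (p + q + s + N * a + (N + 1) * y) + \<bar>z\<bar>"
      if "x \<le> N * (a + y)" "0 \<le> y" for p q s x y z a :: real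
      using that abs_ge_self[of z] abs_ge_zero[of z]
      by (simp only: distrib_left distrib_right mult_1_left add_divide_distrib)
    from this[OF le nn] show ?thesis unfolding l2 mult.assoc[of "N + 1" G] .
  qed
  finally have le: "ln (sqrt (8 * K * L) * (4 * N * exp (2 * \<sigma>) * (24 * L * N / \<delta>) ^ (n - 1)) * sqrt (2 / \<delta>)) \<le> \<dots>" .
  have "sqrt (8 * K * L) * (4 * N * exp (2 * \<sigma>) * (24 * L * N / \<delta>) ^ (n - 1)) * sqrt (2 / \<delta>) > 0"
    using assms e by (intro mult_pos_pos) auto
  then show ?thesis using le by (metis exp_le_cancel_iff exp_ln)
qed

theorem theorem1p9:
  fixes V V1 DV1 V2 :: "real \<Rightarrow> real" and \<Omega> :: "real set"
    and \<beta>1 \<beta>2 c1 c2 c3 c4 L \<gamma> \<tau> :: real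
  assumes "\<beta>1 > 0" and "\<beta>2 \<ge> \<beta>1"
    and "c1 > 0" and "c2 > 0" and "c3 > 0" and "c4 > 0"
    and "V \<in> Linfty_loc"
    and "AE x in lebesgue. 0 \<le> V x"
    and "AE x in lebesgue. c1 * (max 0 (\<bar>x\<bar> - c3)) powr \<beta>1 \<le> V x \<and> V x \<le> c2 * jbr x powr \<beta>2"
    and "AE x in lebesgue. V x = V1 x + V2 x"
    and "has_weak_derivative V1 DV1"
    and "AE x in lebesgue. \<bar>V1 x\<bar> + \<bar>DV1 x\<bar> + \<bar>V2 x\<bar> powr (4 / 3) \<le> c4 * jbr x powr \<beta>2"
    and "\<Omega> \<in> sets lebesgue"
    and "L > 0" and "0 < \<gamma>" and "\<gamma> < 1" and "\<tau> \<ge> 0"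
    and "\<forall>n::int. measure lebesgue (\<Omega> \<inter> {L * of_int n .. L * (of_int n + 1)})
           \<ge> \<gamma> powr (jbr (of_int n) powr \<tau>) * L"
  shows "\<exists>C>0. \<forall>H \<phi> ev. schroedinger_operator V H \<longrightarrow> eigenbasis H \<phi> ev \<longrightarrow>
           (\<forall>\<mu>>0. \<forall>u\<in>spectral_subspace \<phi> ev \<mu>.
              l2_norm u \<le> C * exp (C * \<mu> powr (4 * \<tau> / \<beta>1 + \<beta>2 / \<beta>1) * ln (\<mu> + 1))
                           * l2_norm_on \<Omega> u)"
proof -
  note \<beta> = assms(1,2) and c = assms(3-5) and L = assms(14) and \<gamma> = assms(15,16) and \<tau> = assms(17)
  have \<beta>2: "\<beta>2 > 0" using \<beta> by simp
  define lower where "lower = (\<lambda>x. c1 * (max 0 (\<bar>x\<bar> - c3)) powr \<beta>1)"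
  define upper where "upper = (\<lambda>x. c2 * jbr x powr \<beta>2)"
  \<comment> \<open>A representative of V for which the lower bound holds at every point. On the
    exceptional null set it takes the value \<open>lower\<close>, and the bound by
    \<open>upper + lower\<close> covers both cases without comparing the two functions.\<close>
  define U where "U = (\<lambda>x. if lower x \<le> V x \<and> V x \<le> upper x then V x else lower x)"
  have lm: "lower \<in> borel_measurable lebesgue" "upper \<in> borel_measurable lebesgue"
  proof -
    have "lower \<in> borel_measurable borel" "upper \<in> borel_measurable borel"
      unfolding lower_def upper_def jbr_def by measurable
    then show "lower \<in> borel_measurable lebesgue" "upper \<in> borel_measurable lebesgue"
      by (auto intro: measurable_completion)
  qed
  have Um: "U \<in> borel_measurable lebesgue"
    unfolding U_def using lm assms(7) by (auto simp: Linfty_loc_def)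
  have VU: "AE x in lebesgue. V x = U x"
    using assms(9) by eventually_elim (simp add: U_def lower_def upper_def)
  have l0: "0 \<le> lower x" "0 \<le> upper x" for x using c by (auto simp: lower_def upper_def)
  have Ul: "lower x \<le> U x" "U x \<le> upper x + lower x" for x using l0[of x] by (auto simp: U_def)
  have U0: "0 \<le> U x" for x using l0(1)[of x] Ul(1)[of x] by linarith
  have UX: "U x \<le> c2 * (1 + X) powr \<beta>2 + c1 * X powr \<beta>1" if "\<bar>x\<bar> \<le> X" for x X
  proof -
    have "upper x \<le> c2 * (1 + X) powr \<beta>2"
      unfolding upper_def using jbr_bounds[of x] that c \<beta>2 by (intro mult_left_mono powr_mono2) auto
    moreover have "lower x \<le> c1 * X powr \<beta>1"
      unfolding lower_def using that c \<beta> by (intro mult_left_mono powr_mono2) auto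
    ultimately show ?thesis using Ul(2)[of x] by linarith
  qed
  have Ub: "\<exists>B. \<forall>x\<in>{a..b}. \<bar>U x\<bar> \<le> B" for a b
  proof (intro exI ballI)
    fix x assume "x \<in> {a..b}"
    then have "\<bar>x\<bar> \<le> \<bar>a\<bar> + \<bar>b\<bar>" by auto
    from UX[OF this] show "\<bar>U x\<bar> \<le> c2 * (1 + (\<bar>a\<bar> + \<bar>b\<bar>)) powr \<beta>2 + c1 * (\<bar>a\<bar> + \<bar>b\<bar>) powr \<beta>1"
      using U0[of x] by simp
  qed
  \<comment> \<open>Solves c1 (\<rho> - c3)^\<beta>1 = 8 (\<mu>^2 + 1), the height of the potential
    that \<open>mass_in_well\<close> requires; hence \<rho> = O(\<mu>^(2/\<beta>1)).\<close>
  define \<rho> where "\<rho> = (\<lambda>\<mu>::real. c3 + (8 / c1 * (\<mu> ^ 2 + 1)) powr (1 / \<beta>1))"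
  define K where "K = (\<lambda>\<mu>. nat \<lceil>\<rho> \<mu> / L\<rceil>)"
  define X where "X = (\<lambda>\<mu>. L * (real (K \<mu>) + 5))"
  define m where "m = (\<lambda>\<mu>. sqrt (c2 * (1 + X \<mu>) powr \<beta>2 + c1 * X \<mu> powr \<beta>1))"
  define \<sigma> where "\<sigma> = (\<lambda>\<mu>. 7 * (L / 2) * m \<mu> + 1)"
  define \<kappa>1 where "\<kappa>1 = (\<lambda>\<mu>. 18 / (16 * (L / 2))\<^sup>2 + (m \<mu>)\<^sup>2 + \<mu>\<^sup>2)"
  define \<kappa>0 where "\<kappa>0 = (\<lambda>\<mu>. 3 / (16 * (L / 2)) + 16 * (L / 2) * \<kappa>1 \<mu>)"
  define \<kappa> where "\<kappa> = (\<lambda>\<mu>. \<kappa>0 \<mu> + 7 * (L / 2) * \<kappa>1 \<mu> + 7 * (L / 2) * m \<mu> * \<kappa>0 \<mu>)"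
  define Y where "Y = (\<lambda>\<mu>. 2 * exp (2 * \<sigma> \<mu>) * (exp (\<mu> * (7 * (L / 2))) * \<kappa> \<mu>) * sqrt (8 * L) * sqrt (8 * real (K \<mu>) * L))"
  \<comment> \<open>The ceiling gives Y \<le> 2^N, also when the logarithm is negative; the added 1
    makes N positive.\<close>
  define N where "N = (\<lambda>\<mu>. nat \<lceil>log 2 (Y \<mu>)\<rceil> + 1)"
  define G where "G = (\<lambda>\<mu>. (1 + real (K \<mu>)) powr \<tau>)"
  define \<delta> where "\<delta> = (\<lambda>\<mu>. \<gamma> powr G \<mu> * L)"
  \<comment> \<open>\<open>b\<close> is the growth exponent of m and of N; \<open>t\<close> that of
    G, since |n| \<le> K = O(\<mu>^(2/\<beta>1)) is raised to the power \<tau>.\<close>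
  define b where "b = \<beta>2 / \<beta>1"
  define t where "t = 2 * \<tau> / \<beta>1"
  define \<zeta> where "\<zeta> = 4 * \<tau> / \<beta>1 + \<beta>2 / \<beta>1"
  have bt: "1 \<le> b" "0 \<le> t" "\<zeta> = b + 2 * t" using \<beta> \<tau> by (auto simp: b_def t_def \<zeta>_def)
  have \<rho>0: "\<rho> \<mu> > 0" for \<mu> using c by (simp add: \<rho>_def add_pos_nonneg)
  have K0: "K \<mu> > 0" for \<mu> using \<rho>0[of \<mu>] L by (simp add: K_def)
  have K\<rho>: "\<rho> \<mu> \<le> L * real (K \<mu>)" "real (K \<mu>) \<le> \<rho> \<mu> / L + 1" for \<mu>
  proof -
    have pos: "0 < \<rho> \<mu> / L" using \<rho>0 L by simp
    then have "real (K \<mu>) = of_int \<lceil>\<rho> \<mu> / L\<rceil>" unfolding K_def by simp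
    then have "\<rho> \<mu> / L \<le> real (K \<mu>)" "real (K \<mu>) \<le> \<rho> \<mu> / L + 1" by linarith+
    then show "\<rho> \<mu> \<le> L * real (K \<mu>)" "real (K \<mu>) \<le> \<rho> \<mu> / L + 1" using L by (auto simp: field_simps)
  qed
  have X0: "X \<mu> > 0" for \<mu> using L by (simp add: X_def)
  have m0: "m \<mu> > 0" for \<mu> unfolding m_def using X0[of \<mu>] c by (simp add: add_pos_nonneg)
  have m2: "(m \<mu>)\<^sup>2 = c2 * (1 + X \<mu>) powr \<beta>2 + c1 * X \<mu> powr \<beta>1" for \<mu>
    unfolding m_def using c by simp
  have \<kappa>p: "\<kappa>1 \<mu> > 0" "\<kappa>0 \<mu> > 0" "\<kappa> \<mu> > 0" for \<mu>
  proof -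
    show 1: "\<kappa>1 \<mu> > 0" unfolding \<kappa>1_def using L by (intro add_pos_nonneg) auto
    show 2: "\<kappa>0 \<mu> > 0" unfolding \<kappa>0_def using L 1 by (intro add_pos_nonneg) auto
    show "\<kappa> \<mu> > 0" unfolding \<kappa>_def using L 1 2 m0[of \<mu>] by (intro add_pos_nonneg) auto
  qed
  have Y0: "Y \<mu> > 0" for \<mu> unfolding Y_def using \<kappa>p(3)[of \<mu>] L K0[of \<mu>] by simp
  have N0: "N \<mu> > 0" for \<mu> by (simp add: N_def)
  have YN: "Y \<mu> \<le> 2 ^ N \<mu>" for \<mu>
  proof -
    have "log 2 (Y \<mu>) \<le> real (N \<mu>)" unfolding N_def by linarith
    then have "Y \<mu> \<le> 2 powr real (N \<mu>)" using Y0[of \<mu>] by (simp add: log_le_iff)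
    then show ?thesis by (simp add: powr_realpow)
  qed
  define Fac where "Fac = (\<lambda>\<mu>. sqrt (8 * real (K \<mu>) * L) * (4 * real (N \<mu>) * exp (2 * \<sigma> \<mu>) *
     (24 * L * real (N \<mu>) / \<delta> \<mu>) ^ (N \<mu> - 1)) * sqrt (2 / \<delta> \<mu>))"
  have main: "l2_norm u \<le> Fac \<mu> * l2_norm_on \<Omega> u"
    if H: "schroedinger_operator V H" and eb: "eigenbasis H \<phi> ev" and \<mu>: "\<mu> \<ge> 1" and u: "u \<in> spectral_subspace \<phi> ev \<mu>"
    for H \<phi> ev \<mu> u
    unfolding Fac_def
  proof (rule spectral_inequality_at_energy[OF H eb VU Um U0 Ub \<mu> L \<rho>0[of \<mu>] _ K0[of \<mu>] K\<rho>(1)[of \<mu>] m0[of \<mu>] _ assms(13) _ _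
        \<sigma>_def[THEN fun_cong] \<kappa>1_def[THEN fun_cong] \<kappa>0_def[THEN fun_cong] \<kappa>_def[THEN fun_cong] N0[of \<mu>] _ u])
    show "8 * (\<mu>\<^sup>2 + 1) \<le> U x" if x: "\<rho> \<mu> \<le> \<bar>x\<bar>" for x
    proof -
      let ?p = "(8 / c1 * (\<mu> ^ 2 + 1))"
      have p: "?p \<ge> 0" using c by simp
      have "8 * (\<mu>\<^sup>2 + 1) = c1 * (?p powr (1 / \<beta>1)) powr \<beta>1"
        using c \<beta> p by (simp add: powr_powr)
      also have "\<dots> \<le> lower x" unfolding lower_def
        using x c \<beta> by (intro mult_left_mono powr_mono2) (auto simp: \<rho>_def)
      finally show ?thesis using Ul(1)[of x] by linarith
    qed
    show "U x \<le> (m \<mu>)\<^sup>2" if "\<bar>x\<bar> \<le> L * (real (K \<mu>) + 5)" for x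
      unfolding m2 by (rule UX) (use that in \<open>simp add: X_def\<close>)
    show "\<delta> \<mu> > 0" using \<gamma> L by (simp add: \<delta>_def)
    show "\<delta> \<mu> \<le> measure lebesgue (\<Omega> \<inter> {L * of_int n .. L * (of_int n + 1)})" if n: "\<bar>n\<bar> \<le> int (K \<mu>)" for n
    proof -
      have "jbr (of_int n) \<le> 1 + real (K \<mu>)" using jbr_bounds(2)[of "of_int n"] n by linarith
      then have "jbr (of_int n) powr \<tau> \<le> G \<mu>" unfolding G_def
        using jbr_bounds(1)[of "of_int n"] \<tau> by (intro powr_mono2) auto
      then have "\<gamma> powr G \<mu> \<le> \<gamma> powr (jbr (of_int n) powr \<tau>)" using \<gamma> by (intro powr_mono') auto
      then have "\<delta> \<mu> \<le> \<gamma> powr (jbr (of_int n) powr \<tau>) * L" unfolding \<delta>_def using L by simp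
      also have "\<dots> \<le> measure lebesgue (\<Omega> \<inter> {L * of_int n .. L * (of_int n + 1)})" using assms(18) by blast
      finally show ?thesis .
    qed
    show "2 * exp (2 * \<sigma> \<mu>) * (exp (\<mu> * (7 * (L / 2))) * \<kappa> \<mu>) * sqrt (8 * L) * sqrt (8 * real (K \<mu>) * L) \<le> 2 ^ N \<mu>"
      using YN[of \<mu>] by (simp add: Y_def)
  qed
  have g\<rho>: "poly_growth (2 / \<beta>1) \<rho>"
  proof -
    have "poly_growth 2 (\<lambda>\<mu>. 8 / c1 * (\<mu> ^ 2 + 1))"
      using poly_growth_power[of 2] poly_growth_const[of 2 1] c
      by (intro poly_growth_cmult poly_growth_add) auto
    from poly_growth_powr[OF this, of "1 / \<beta>1"] have "poly_growth (2 / \<beta>1) (\<lambda>\<mu>. (8 / c1 * (\<mu> ^ 2 + 1)) powr (1 / \<beta>1))"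
      using c \<beta> by simp
    then show ?thesis unfolding \<rho>_def using \<beta> by (intro poly_growth_add poly_growth_const) auto
  qed
  have gK: "poly_growth (2 / \<beta>1) (\<lambda>\<mu>. real (K \<mu>))"
  proof (rule poly_growth_le[OF _ K\<rho>(2)])
    show "poly_growth (2 / \<beta>1) (\<lambda>\<mu>. \<rho> \<mu> / L + 1)"
      using poly_growth_cmult[OF g\<rho>, of "1 / L"] L \<beta> by (intro poly_growth_add poly_growth_const) auto
  qed
  have gX: "poly_growth (2 / \<beta>1) X" unfolding X_def
    using L \<beta> by (intro poly_growth_cmult poly_growth_add gK poly_growth_const) auto
  have gm: "poly_growth b m"
  proof -
    have "poly_growth (2 / \<beta>1 * \<beta>2) (\<lambda>\<mu>. (1 + X \<mu>) powr \<beta>2)"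
      using X0 \<beta> \<beta>2 by (intro poly_growth_powr poly_growth_add gX poly_growth_const) (auto simp: less_imp_le add_nonneg_nonneg)
    then have 1: "poly_growth (2 * b) (\<lambda>\<mu>. (1 + X \<mu>) powr \<beta>2)" by (simp add: b_def)
    have "poly_growth (2 / \<beta>1 * \<beta>1) (\<lambda>\<mu>. X \<mu> powr \<beta>1)"
      using X0 \<beta> by (intro poly_growth_powr gX) (auto simp: less_imp_le)
    then have 2: "poly_growth (2 * b) (\<lambda>\<mu>. X \<mu> powr \<beta>1)"
      by (rule poly_growth_mono) (use bt \<beta> in auto)
    have "poly_growth (2 * b) (\<lambda>\<mu>. c2 * (1 + X \<mu>) powr \<beta>2 + c1 * X \<mu> powr \<beta>1)"
      using 1 2 c by (intro poly_growth_add poly_growth_cmult) auto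
    from poly_growth_sqrt[OF this] show ?thesis unfolding m_def using c by simp
  qed
  have g\<sigma>: "poly_growth b \<sigma>" unfolding \<sigma>_def
    using L bt by (intro poly_growth_add poly_growth_cmult gm poly_growth_const) auto
  have g\<kappa>1: "poly_growth (2 * b) \<kappa>1"
  proof -
    have 1: "poly_growth (2 * b) (\<lambda>\<mu>. (m \<mu>)\<^sup>2)"
      using poly_growth_mult[OF gm gm] m0 by (simp add: power2_eq_square less_imp_le)
    have 2: "poly_growth (2 * b) (\<lambda>\<mu>. \<mu>\<^sup>2)"
      by (rule poly_growth_mono[OF poly_growth_power[of 2]]) (use bt in auto)
    show ?thesis unfolding \<kappa>1_def using bt by (intro poly_growth_add 1 2 poly_growth_const) auto
  qed
  have g\<kappa>0: "poly_growth (2 * b) \<kappa>0" unfolding \<kappa>0_def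
    using L bt by (intro poly_growth_add poly_growth_cmult g\<kappa>1 poly_growth_const) auto
  have g\<kappa>: "poly_growth (3 * b) \<kappa>"
  proof -
    have 1: "poly_growth (3 * b) (\<lambda>\<mu>. 7 * (L / 2) * m \<mu> * \<kappa>0 \<mu>)"
    proof -
      have "poly_growth (b + 2 * b) (\<lambda>\<mu>. m \<mu> * \<kappa>0 \<mu>)"
        by (rule poly_growth_mult[OF gm g\<kappa>0]) (use m0 \<kappa>p in \<open>auto simp: less_imp_le\<close>)
      from poly_growth_cmult[OF this, of "7 * (L / 2)"] show ?thesis using L by (simp add: mult.assoc)
    qed
    have 2: "poly_growth (3 * b) \<kappa>0" "poly_growth (3 * b) \<kappa>1"
      by (rule poly_growth_mono[OF g\<kappa>0] poly_growth_mono[OF g\<kappa>1]; use bt in simp)+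
    show ?thesis unfolding \<kappa>_def using L by (intro poly_growth_add 1 2 poly_growth_cmult) auto
  qed
  have lK: "log_growth (\<lambda>\<mu>. ln (8 * real (K \<mu>) * L))"
  proof (rule log_growth_ln)
    show "poly_growth (2 / \<beta>1) (\<lambda>\<mu>. 8 * real (K \<mu>) * L)"
      using poly_growth_cmult[OF gK, of "8 * L"] L by (simp add: mult_ac)
  qed (use K0 L in simp)
  \<comment> \<open>ln Y is a sum of \<sigma>, a multiple of \<mu>, and logarithms. All are
    O(\<mu>^b) because b \<ge> 1, and N exceeds log_2 Y by less than 2 when that logarithm is
    nonnegative.\<close>
  have gN: "poly_growth b (\<lambda>\<mu>. real (N \<mu>))"
  proof -
    have lnY: "ln (Y \<mu>) = ln 2 + 2 * \<sigma> \<mu> + 7 * (L / 2) * \<mu> + ln (\<kappa> \<mu>) + ln (8 * L) / 2 + ln (8 * real (K \<mu>) * L) / 2" for \<mu>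
      unfolding Y_def using \<kappa>p(3)[of \<mu>] L K0[of \<mu>] by (simp add: ln_mult_pos ln_sqrt mult_ac)
    have l\<kappa>: "log_growth (\<lambda>\<mu>. ln (\<kappa> \<mu>))" by (rule log_growth_ln[OF g\<kappa>]) (rule \<kappa>p)
    have \<mu>1: "poly_growth b (\<lambda>\<mu>. \<mu>)"
      using poly_growth_mono[OF poly_growth_power[of 1], of b] bt by simp
    have hK: "poly_growth b (\<lambda>\<mu>. ln (8 * real (K \<mu>) * L) / 2)"
      using poly_growth_cmult[OF log_growth_imp_poly_growth[OF lK bt(1)], of "1 / 2"] by simp
    have "poly_growth b (\<lambda>\<mu>. ln (Y \<mu>))"
      unfolding lnY using L bt
      by (intro poly_growth_add poly_growth_cmult g\<sigma> \<mu>1 hK log_growth_imp_poly_growth[OF l\<kappa>] poly_growth_const) auto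
    then obtain C where C: "0 \<le> C" "\<And>\<mu>. \<mu> \<ge> 1 \<Longrightarrow> ln (Y \<mu>) \<le> C * \<mu> powr b" unfolding poly_growth_def by blast
    have "poly_growth b (\<lambda>\<mu>. C / ln 2 * \<mu> powr b + 2)"
      using C(1) bt by (intro poly_growth_add poly_growth_cmult poly_growth_const poly_growthI[of 1]) auto
    then show ?thesis
    proof (rule poly_growth_le)
      fix \<mu> :: real assume \<mu>: "\<mu> \<ge> 1"
      have "log 2 (Y \<mu>) \<le> C / ln 2 * \<mu> powr b" using C(2)[OF \<mu>] by (simp add: log_def divide_right_mono)
      moreover have "0 \<le> C / ln 2 * \<mu> powr b" using C(1) by simp
      ultimately show "real (N \<mu>) \<le> C / ln 2 * \<mu> powr b + 2" unfolding N_def by linarith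
    qed
  qed
  have lN: "log_growth (\<lambda>\<mu>. ln (c * real (N \<mu>)))" if "c > 0" for c
    by (rule log_growth_ln[OF poly_growth_cmult[OF gN]]) (use that N0 in auto)
  have gG: "poly_growth t G"
  proof -
    have "poly_growth (2 / \<beta>1 * \<tau>) G" unfolding G_def
      using \<beta> \<tau> by (intro poly_growth_powr poly_growth_add gK poly_growth_const) auto
    then show ?thesis by (simp add: t_def)
  qed
  have G0: "0 \<le> G \<mu>" for \<mu> by (simp add: G_def)
  \<comment> \<open>The exponent is split by growth: \<open>S1\<close> is O(\<mu>^b),
    \<open>S2\<close> is O(\<mu>^b) times a logarithm, \<open>S3\<close> is O(\<mu>^(b+t)).\<close>
  define S1 where "S1 = (\<lambda>\<mu>. ln (8 * real (K \<mu>) * L) / 2 + ln (4 * real (N \<mu>)) + 2 * \<sigma> \<mu>)"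
  define S2 where "S2 = (\<lambda>\<mu>. real (N \<mu>) * ln (24 * real (N \<mu>)))"
  define S3 where "S3 = (\<lambda>\<mu>. (real (N \<mu>) + 1) * G \<mu> * ln (1 / \<gamma>))"
  have FacE: "Fac \<mu> \<le> exp ((S1 \<mu> + S2 \<mu> + S3 \<mu>) + \<bar>ln (2 / L)\<bar>)" for \<mu>
    unfolding Fac_def S1_def S2_def S3_def
  proof (rule ln_of_factor[OF _ _ L \<gamma> G0 refl \<delta>_def[THEN fun_cong]])
    show "1 \<le> real (N \<mu>)" using N0[of \<mu>] by linarith
  qed (use K0 in simp)
  have \<zeta>: "b \<le> \<zeta>" "b + t \<le> \<zeta>" "0 \<le> \<zeta>" using bt by auto
  have gS1: "poly_growth b S1"
    unfolding S1_def
    using poly_growth_cmult[OF log_growth_imp_poly_growth[OF lK bt(1)], of "1 / 2"]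
    by (intro poly_growth_add poly_growth_cmult[OF g\<sigma>] log_growth_imp_poly_growth[OF lN bt(1)]) auto
  have gS3: "poly_growth (b + t) S3"
  proof -
    have "poly_growth (b + t) (\<lambda>\<mu>. (real (N \<mu>) + 1) * G \<mu>)"
      using bt G0 by (intro poly_growth_mult poly_growth_add gN gG poly_growth_const) auto
    from poly_growth_cmult[OF this, of "ln (1 / \<gamma>)"] show ?thesis unfolding S3_def using \<gamma> by (simp add: mult_ac)
  qed
  obtain C1 where C1: "C1 \<ge> 0" "\<And>\<mu>. \<mu> \<ge> 1 \<Longrightarrow> S1 \<mu> \<le> C1 * (\<mu> powr \<zeta> * ln (\<mu> + 1))"
    using poly_growth_le_times_log[OF gS1 \<zeta>(1)] by blast
  obtain C2 where C2: "C2 \<ge> 0" "\<And>\<mu>. \<mu> \<ge> 1 \<Longrightarrow> S2 \<mu> \<le> C2 * (\<mu> powr \<zeta> * ln (\<mu> + 1))"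
    using poly_times_log_growth[OF gN _ lN \<zeta>(1), of 24] unfolding S2_def by auto
  obtain C3 where C3: "C3 \<ge> 0" "\<And>\<mu>. \<mu> \<ge> 1 \<Longrightarrow> S3 \<mu> \<le> C3 * (\<mu> powr \<zeta> * ln (\<mu> + 1))"
    using poly_growth_le_times_log[OF gS3 \<zeta>(2)] by blast
  define D where "D = C1 + C2 + C3"
  define D0 where "D0 = exp \<bar>ln (2 / L)\<bar>"
  have D: "0 \<le> D" "1 \<le> D0" using C1 C2 C3 by (auto simp: D_def D0_def)
  have FacD: "Fac \<mu> \<le> D0 * exp (D * (\<mu> powr \<zeta> * ln (\<mu> + 1)))" if \<mu>: "\<mu> \<ge> 1" for \<mu>
  proof -
    have "S1 \<mu> + S2 \<mu> + S3 \<mu> \<le> D * (\<mu> powr \<zeta> * ln (\<mu> + 1))"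
      using C1(2)[OF \<mu>] C2(2)[OF \<mu>] C3(2)[OF \<mu>] unfolding D_def distrib_right by linarith
    then have "exp (S1 \<mu> + S2 \<mu> + S3 \<mu>) * D0 \<le> exp (D * (\<mu> powr \<zeta> * ln (\<mu> + 1))) * D0"
      using D by (intro mult_right_mono) auto
    moreover have "Fac \<mu> \<le> exp (S1 \<mu> + S2 \<mu> + S3 \<mu>) * D0"
      using FacE[of \<mu>] unfolding exp_add[of "S1 \<mu> + S2 \<mu> + S3 \<mu>"] D0_def .
    ultimately show ?thesis by (simp only: mult.commute)
  qed
  \<comment> \<open>The second summand covers \<mu> < 1, where the exponent gives nothing in the
    limit \<mu> to 0; it is the bound for \<open>Fac\<close> at energy 1.\<close>
  define C where "C = D + D0 * exp (D * ln 2)"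
  have C: "0 < C" "D \<le> C" "D0 \<le> C" "D0 * exp (D * ln 2) \<le> C"
  proof -
    have "D0 * 1 \<le> D0 * exp (D * ln 2)" using D by (intro mult_left_mono) auto
    then show "D0 \<le> C" "0 < C" using D unfolding C_def by linarith+
    show "D \<le> C" "D0 * exp (D * ln 2) \<le> C" using D by (auto simp: C_def)
  qed
  show ?thesis
  proof (intro exI[of _ C] conjI allI impI ballI C(1))
    fix H \<phi> ev \<mu> u
    assume H: "schroedinger_operator V H" and eb: "eigenbasis H \<phi> ev" and \<mu>: "0 < \<mu>" and u: "u \<in> spectral_subspace \<phi> ev \<mu>"
    let ?E = "\<mu> powr \<zeta> * ln (\<mu> + 1)"
    have E0: "0 \<le> ?E" using \<mu> by simp
    have "l2_norm u \<le> (C * exp (C * ?E)) * l2_norm_on \<Omega> u"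
    proof (cases "\<mu> \<ge> 1")
      case True
      have "Fac \<mu> \<le> D0 * exp (D * ?E)" by (rule FacD[OF True])
      also have "\<dots> \<le> C * exp (C * ?E)" using C D E0 by (intro mult_mono) (auto intro: mult_right_mono)
      finally show ?thesis
        using main[OF H eb True u] mult_right_mono[OF _ l2_norm_on_nonneg[of \<Omega> u]] order_trans by blast
    next
      case False
      \<comment> \<open>Low energies are reduced to \<mu> = 1 by inclusion of the spectral
        subspaces.\<close>
      then have "spectral_subspace \<phi> ev \<mu> \<subseteq> spectral_subspace \<phi> ev 1"
        unfolding spectral_subspace_def by fastforce
      then have u1: "u \<in> spectral_subspace \<phi> ev 1" using u by blast
      have "Fac 1 \<le> D0 * exp (D * ln 2)" using FacD[of 1] by simp
      also have "\<dots> \<le> C * 1" using C(4) by simp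
      also have "\<dots> \<le> C * exp (C * ?E)" using C(1) E0 by (intro mult_left_mono) auto
      finally show ?thesis
        using main[OF H eb order_refl u1] mult_right_mono[OF _ l2_norm_on_nonneg[of \<Omega> u]] order_trans by blast
    qed
    then show "l2_norm u \<le> C * exp (C * \<mu> powr (4 * \<tau> / \<beta>1 + \<beta>2 / \<beta>1) * ln (\<mu> + 1)) * l2_norm_on \<Omega> u"
      unfolding \<zeta>_def by (simp only: mult.assoc)
  qed
qed

end
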